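(* Let $\alpha,\beta_1,\ldots,\beta_n\in\mathbb{C}$ with $\sum_{i=1}^n\beta_i=0$. Then the torus intertwining $n$-point function on $M\otimes e^\alpha$ for the highest weight vectors $e^{\beta_i}=\mathbf 1\otimes e^{\beta_i}$ is $$Z^{(1)}_\alpha\left(e^{\beta_1},z_1;\ldots;e^{\beta_n},z_n;q\right)=\frac{q^{\frac12\alpha^2}}{\eta(\tau)}\exp\left(\alpha\sum_{i=1}^n\beta_iz_i\right)\prod_{1\le r<s\le n}K(z_{rs},\tau)^{\beta_r\beta_s},$$ where $z_{rs}=z_r-z_s$ and $K(z,\tau)$ is the genus one prime form function.
   Context: $a(n)$ ($n\in\mathbb{Z}$) are Heisenberg modes, $[a(m),a(n)]=m\delta_{m,-n}$; $M$ is the rank one Heisenberg VOA with vacuum $\mathbf 1$, conformal vector $\omega=\frac12a(-1)^2\mathbf 1$ and Virasoro modes $L(n)$. For $\alpha\in\mathbb{C}$, $M\otimes e^\alpha$ is the irreducible $M$-module on which $a(0)=\alpha$; $\mathcal{M}=\bigoplus_{\alpha\in\mathbb{C}}M\otimes e^\alpha$; $e^{\alpha\widehat q}(u\otimes e^\beta)=u\otimes e^{\alpha+\beta}$. Put $Y_\pm(\alpha,z)=\exp\left(\mp\alpha\sum_{n>0}\frac{a(\pm n)}{n}z^{\mp n}\right)$ and $$\mathcal{Y}(u\otimes e^\alpha,z)=e^{\alpha\widehat q}\,Y_-(\alpha,z)\,Y(u,z)\,Y_+(\alpha,z)\,z^{\alpha a(0)}.$$ With $q_i=e^{z_i}$,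 $q=e^{2\pi i\tau}$, $\tau$ in the upper half-plane, for $v_i\in\mathcal M$ $$Z^{(1)}_\alpha(v_1,z_1;\ldots;v_n,z_n;q)=\mathrm{Tr}_{M\otimes e^\alpha}\left(\mathcal Y(q_1^{L(0)}v_1,q_1)\cdots\mathcal Y(q_n^{L(0)}v_n,q_n)\,q^{L(0)-1/24}\right).$$ $\eta(\tau)=q^{1/24}\prod_{n\ge1}(1-q^n)$; $K(z,\tau)=\vartheta_1(z,\tau)/\partial_z\vartheta_1(0,\tau)$, $\vartheta_1(z,\tau)=\sum_{n\in\mathbb{Z}}e^{i\pi(n+\frac12)^2\tau+(n+\frac12)(z+\pi i)}$, so $K(z,\tau)=z+O(z^3)$. Powers: $K(z_{rs},\tau)^{\chi}=z_{rs}^{\chi}\,(K(z_{rs},\tau)/z_{rs})^{\chi}$ with $z_{rs}^\chi=(z_r-z_s)^{\chi}$ expanded in non-negative powers of $z_s$ for $r<s$ (the ordering $|z_1|>\dots>|z_n|$); this corresponds to the factor $(q_r-q_s)^\chi$ produced by the ordered product of vertex operators. *)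

theory Defs
  imports "HOL-Analysis.Analysis" "HOL-Library.Multiset"
begin

section \<open>The charged Fock space\<close>

text \<open>
  A label \<open>(\<beta>, \<mu>)\<close>, with \<open>\<mu>\<close> a finite multiset of positive integers
  \<open>n\<^sub>1, \<dots>, n\<^sub>k\<close>, stands for the vector \<open>a(-n\<^sub>1) \<cdots> a(-n\<^sub>k) 1 \<otimes> e\<^sup>\<beta>\<close>.  These vectors form
  a basis of the direct sum of all the Heisenberg modules \<open>M \<otimes> e\<^sup>\<beta>\<close>.  A function on labels is
  the family of coordinates of a (possibly infinite) combination of basis vectors:
  elements of the direct sum are the finitely supported functions, and a vertex operator at a
  nonzero complex number maps these to functions without any support restriction.
\<close>

type_synonym state = "complex \<times> nat multiset"
type_synonym vec = "state \<Rightarrow> complex"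

definition fock_basis :: "state set" where
  "fock_basis = {s. 0 \<notin># snd s}"

definition ket :: "state \<Rightarrow> vec" where
  "ket s = (\<lambda>t. if t = s then 1 else 0)"

text \<open>
  In terms of polynomials in \<open>x\<^sub>k = a(-k)\<close>: \<open>a(-k)\<close> is multiplication by \<open>x\<^sub>k\<close> and \<open>a(k)\<close> is
  \<open>k \<partial>/\<partial>x\<^sub>k\<close> for \<open>k > 0\<close>, while \<open>a(0)\<close> is the charge.
\<close>

definition heis :: "int \<Rightarrow> vec \<Rightarrow> vec" where
  "heis m f = (\<lambda>(\<beta>, \<mu>).
     if m < 0 then (if nat (- m) \<in># \<mu> then f (\<beta>, \<mu> - {#nat (- m)#}) else 0)
     else if m = 0 then \<beta> * f (\<beta>, \<mu>)
     else of_int m * of_nat (count \<mu> (nat m) + 1) * f (\<beta>, add_mset (nat m) \<mu>))"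

lemma heis_commutator:
  "heis m (heis n f) s - heis n (heis m f) s = (if m + n = 0 then of_int m * f s else 0)"
proof -
  obtain \<beta> \<mu> where s: "s = (\<beta>, \<mu>)" by (cases s)
  have mixed: "heis (int k) (heis (- int l) f) s - heis (- int l) (heis (int k) f) s =
      (if k = l then of_nat k * f s else 0)" if "k > 0" "l > 0" for k l
  proof (cases "l \<in># \<mu>")
    case True
    then obtain \<nu> where "\<mu> = add_mset l \<nu>" by (meson multi_member_split)
    then show ?thesis using that by (auto simp: s heis_def algebra_simps add_mset_commute)
  next
    case False
    then have "count \<mu> l = 0" by (simp add: not_in_iff)
    then show ?thesis using that False by (auto simp: s heis_def)
  qed
  consider "m = 0" | "n = 0" | "m > 0" "n > 0" | "m < 0" "n < 0" | "m > 0" "n < 0" | "m < 0" "n > 0"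
    by linarith
  then show ?thesis
  proof cases
    case 3
    then show ?thesis
      by (cases "m = n") (simp_all add: s heis_def add_mset_commute)
  next
    case 4
    have mem: "(p \<in># \<mu> \<and> r \<in># \<mu> - {#p#}) = (r \<in># \<mu> \<and> p \<in># \<mu> - {#r#})" for p r
      by (cases "p = r") (auto simp: in_diff_count not_in_iff)
    have diff: "\<mu> - {#p#} - {#r#} = \<mu> - {#r#} - {#p#}" for p r
      by (rule multiset_eqI) simp
    have "heis m (heis n f) s = heis n (heis m f) s"
      using 4 mem[of "nat (- m)" "nat (- n)"] diff[of "nat (- m)" "nat (- n)"]
      by (simp only: s heis_def prod.case if_True if_False) presburger
    then show ?thesis using 4 by simp
  next
    case 5
    have "nat m = nat (- n) \<longleftrightarrow> m + n = 0" using 5 by linarith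
    then show ?thesis using mixed[of "nat m" "nat (- n)"] 5 by simp
  next
    case 6
    then show ?thesis using mixed[of "nat n" "nat (- m)"]
      by (auto simp: algebra_simps split: if_splits)
  qed (auto simp: s heis_def add_mset_commute)
qed

text \<open>
  All the infinite sums below are pointwise sums of coordinates.
\<close>

definition op_exp :: "(vec \<Rightarrow> vec) \<Rightarrow> vec \<Rightarrow> vec" where
  "op_exp A f = (\<lambda>s. \<Sum>\<^sub>\<infinity>k\<in>(UNIV :: nat set). (A ^^ k) f s / fact k)"

text \<open>
  The modes of \<open>Y(\<omega>, z) = \<Sum> L(n) z\<^bsup>-n-2\<^esup>\<close> for \<open>\<omega> = a(-1)\<^sup>2 1 / 2\<close>:
  \<open>L(n)\<close> is half the sum over \<open>m\<close> of the normally ordered products of \<open>a(m)\<close> and \<open>a(n-m)\<close>.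
\<close>

definition virasoro :: "int \<Rightarrow> vec \<Rightarrow> vec" where
  "virasoro n f = (\<lambda>s. 1 / 2 * (\<Sum>\<^sub>\<infinity>m\<in>(UNIV :: int set).
     heis (min m (n - m)) (heis (max m (n - m)) f) s))"

section \<open>Vertex operators and intertwining operators\<close>

text \<open>
  The creation part and the rest of
  \<open>(1/(n-1)!) \<partial>\<^bsup>n-1\<^esup> a(z) = \<Sum>\<^sub>m binom(-m-1, n-1) a(m) z\<^bsup>-m-n\<^esup>\<close>.
\<close>

definition field_creation :: "nat \<Rightarrow> complex \<Rightarrow> vec \<Rightarrow> vec" where
  "field_creation n z f = (\<lambda>s. \<Sum>\<^sub>\<infinity>m\<in>{..-1 :: int}.
     (of_int (- m - 1) gchoose (n - 1)) * z powi (- m - int n) * heis m f s)"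

definition field_annihilation :: "nat \<Rightarrow> complex \<Rightarrow> vec \<Rightarrow> vec" where
  "field_annihilation n z f = (\<lambda>s. \<Sum>\<^sub>\<infinity>m\<in>{0 :: int..}.
     (of_int (- m - 1) gchoose (n - 1)) * z powi (- m - int n) * heis m f s)"

text \<open>
  \<open>Y(a(-n\<^sub>1) \<cdots> a(-n\<^sub>k) 1, z)\<close> is the normally ordered product of the derived fields above;
  in it every creation part stands to the left of every annihilation part.
\<close>

fun vertex_monomial :: "complex \<Rightarrow> nat list \<Rightarrow> vec \<Rightarrow> vec" where
  "vertex_monomial z [] f = f"
| "vertex_monomial z (n # ns) f = (\<lambda>s.
     field_creation n z (vertex_monomial z ns f) s
   + vertex_monomial z ns (field_annihilation n z f) s)"

definition charge_shift :: "complex \<Rightarrow> vec \<Rightarrow> vec" where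
  "charge_shift \<alpha> f = (\<lambda>(\<beta>, \<mu>). f (\<beta> - \<alpha>, \<mu>))"

definition Y_minus :: "complex \<Rightarrow> complex \<Rightarrow> vec \<Rightarrow> vec" where
  "Y_minus \<alpha> z = op_exp (\<lambda>f s. \<alpha> *
     (\<Sum>\<^sub>\<infinity>n\<in>{1 :: nat..}. heis (- int n) f s / of_nat n * z powi int n))"

definition Y_plus :: "complex \<Rightarrow> complex \<Rightarrow> vec \<Rightarrow> vec" where
  "Y_plus \<alpha> z = op_exp (\<lambda>f s. - \<alpha> *
     (\<Sum>\<^sub>\<infinity>n\<in>{1 :: nat..}. heis (int n) f s / of_nat n * z powi (- int n)))"

text \<open>
  The intertwining operator of \<open>v\<close> at the point \<open>e\<^sup>\<zeta>\<close>.  It involves complex powers of the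
  point, so it takes the logarithm \<open>\<zeta>\<close> as its argument: the power \<open>\<chi>\<close> of the point is
  \<open>e\<^bsup>\<chi>\<zeta>\<^esup>\<close>.  It is linear in the finitely supported \<open>v\<close>.
\<close>

definition intertwiner :: "vec \<Rightarrow> complex \<Rightarrow> vec \<Rightarrow> vec" where
  "intertwiner v \<zeta> f = (\<lambda>s. \<Sum>\<^sub>\<infinity>(\<alpha>, \<mu>)\<in>fock_basis. v (\<alpha>, \<mu>) *
     charge_shift \<alpha>
       (Y_minus \<alpha> (exp \<zeta>)
         (vertex_monomial (exp \<zeta>) (sorted_list_of_multiset \<mu>)
           (Y_plus \<alpha> (exp \<zeta>)
             (op_exp (\<lambda>g t. \<alpha> * \<zeta> * heis 0 g t) f)))) s)"

section \<open>Traces and the torus functions\<close>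

text \<open>
  The trace over \<open>M \<otimes> e\<^sup>\<alpha>\<close> of \<open>A\<^sub>1 \<cdots> A\<^sub>N\<close> is the sum over closed paths
  \<open>s\<^sub>0, s\<^sub>1, \<dots>, s\<^sub>N = s\<^sub>0\<close> of basis labels, starting in \<open>M \<otimes> e\<^sup>\<alpha>\<close>, of the product of the
  matrix entries of the \<open>A\<^sub>i\<close> in row \<open>s\<^bsub>i-1\<^esub>\<close> and column \<open>s\<^sub>i\<close>.
  Summability of complex numbers is absolute; it implies convergence of
  all sums over intermediate states and of the trace itself, with any grouping and order.
\<close>

definition closed_paths :: "complex \<Rightarrow> nat \<Rightarrow> (nat \<Rightarrow> state) set" where
  "closed_paths \<alpha> N = {s \<in> {0..N} \<rightarrow>\<^sub>E fock_basis. s 0 = s N \<and> fst (s 0) = \<alpha>}"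

definition path_weight :: "nat \<Rightarrow> (nat \<Rightarrow> vec \<Rightarrow> vec) \<Rightarrow> (nat \<Rightarrow> state) \<Rightarrow> complex" where
  "path_weight N A s = (\<Prod>i = 1..N. A i (ket (s i)) (s (i - 1)))"

definition trace_converges :: "complex \<Rightarrow> nat \<Rightarrow> (nat \<Rightarrow> vec \<Rightarrow> vec) \<Rightarrow> bool" where
  "trace_converges \<alpha> N A \<longleftrightarrow> path_weight N A summable_on closed_paths \<alpha> N"

definition module_trace :: "complex \<Rightarrow> nat \<Rightarrow> (nat \<Rightarrow> vec \<Rightarrow> vec) \<Rightarrow> complex" where
  "module_trace \<alpha> N A = infsum (path_weight N A) (closed_paths \<alpha> N)"

text \<open>
  The operators whose product is traced: for \<open>1 \<le> i \<le> n\<close> the intertwining operator of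
  \<open>q\<^sub>i\<^bsup>L(0)\<^esup> v\<^sub>i\<close> at \<open>q\<^sub>i = e\<^bsup>z\<^sub>i\<^esup>\<close>, and last \<open>q\<^bsup>L(0)-1/24\<^esup>\<close> with \<open>q = e\<^bsup>2\<pi>i\<tau>\<^esup>\<close>.
\<close>

definition torus_ops ::
  "nat \<Rightarrow> (nat \<Rightarrow> vec) \<Rightarrow> (nat \<Rightarrow> complex) \<Rightarrow> complex \<Rightarrow> nat \<Rightarrow> vec \<Rightarrow> vec" where
  "torus_ops n v z \<tau> i =
     (if i \<le> n then intertwiner (op_exp (\<lambda>f s. z i * virasoro 0 f s) (v i)) (z i)
      else op_exp (\<lambda>f s. 2 * pi * \<i> * \<tau> * (virasoro 0 f s - f s / 24)))"

definition torus_converges ::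
  "complex \<Rightarrow> nat \<Rightarrow> (nat \<Rightarrow> vec) \<Rightarrow> (nat \<Rightarrow> complex) \<Rightarrow> complex \<Rightarrow> bool" where
  "torus_converges \<alpha> n v z \<tau> \<longleftrightarrow> trace_converges \<alpha> (Suc n) (torus_ops n v z \<tau>)"

definition torus_function ::
  "complex \<Rightarrow> nat \<Rightarrow> (nat \<Rightarrow> vec) \<Rightarrow> (nat \<Rightarrow> complex) \<Rightarrow> complex \<Rightarrow> complex" where
  "torus_function \<alpha> n v z \<tau> = module_trace \<alpha> (Suc n) (torus_ops n v z \<tau>)"

definition e_vec :: "complex \<Rightarrow> vec" where
  "e_vec \<beta> = ket (\<beta>, {#})"

section \<open>Eta function and genus one prime form\<close>

definition dedekind_eta :: "complex \<Rightarrow> complex" where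
  "dedekind_eta \<tau> = exp (2 * pi * \<i> * \<tau> / 24) *
     (\<Prod>n. 1 - exp (2 * pi * \<i> * \<tau>) ^ Suc n)"

definition theta1 :: "complex \<Rightarrow> complex \<Rightarrow> complex" where
  "theta1 z \<tau> = (\<Sum>\<^sub>\<infinity>n\<in>(UNIV :: int set).
     exp (\<i> * pi * (of_int n + 1 / 2)\<^sup>2 * \<tau> + (of_int n + 1 / 2) * (z + pi * \<i>)))"

definition prime_form :: "complex \<Rightarrow> complex \<Rightarrow> complex" where
  "prime_form z \<tau> = theta1 z \<tau> / deriv (\<lambda>w. theta1 w \<tau>) 0"

definition prime_form_ratio :: "complex \<Rightarrow> complex \<Rightarrow> complex" where
  "prime_form_ratio z \<tau> = (if z = 0 then 1 else prime_form z \<tau> / z)"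

text \<open>
  The logarithm of \<open>K(z, \<tau>)/z\<close> obtained by continuation from the value \<open>0\<close> at \<open>z = 0\<close> along
  the segment from \<open>0\<close> to \<open>z\<close>.  It is determined as long as the segment contains no
  zero of \<open>K(z, \<tau>)/z\<close>, hence for \<open>0 < Re z < 2 \<pi> Im \<tau>\<close> (the zeros of \<open>K\<close> are the
  points \<open>2 \<pi> i (a + b \<tau>)\<close> with integers \<open>a, b\<close>).
\<close>

definition log_prime_form_ratio :: "complex \<Rightarrow> complex \<Rightarrow> complex" where
  "log_prime_form_ratio z \<tau> = (THE l. \<exists>g. continuous_on {0..1 :: real} g \<and> g 0 = 0 \<and> g 1 = l \<and>
     (\<forall>t\<in>{0..1}. exp (g t) = prime_form_ratio (of_real t * z) \<tau>))"

text \<open>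
  \<open>K(w - z, \<tau>)\<^sup>\<chi> = (w - z)\<^sup>\<chi> (K(w - z, \<tau>)/(w - z))\<^sup>\<chi>\<close>.  The first factor is the principal
  power; by the lemma below it is, for \<open>Re z < Re w\<close>, the sum of the
  expansion of \<open>(w - z)\<^sup>\<chi>\<close> in non-negative powers of \<open>z\<close> wherever that converges.
\<close>

definition prime_form_power :: "complex \<Rightarrow> complex \<Rightarrow> complex \<Rightarrow> complex" where
  "prime_form_power z \<tau> c = z powr c * exp (c * log_prime_form_ratio z \<tau>)"

lemma powr_diff_expansion:
  fixes w z c :: complex
  assumes "norm z < norm w" and "Re z < Re w"
  shows "(\<lambda>k. (c gchoose k) * (- z) ^ k * w powr (c - of_nat k)) sums ((w - z) powr c)"
proof -
  define u where "u = 1 + (- z / w)"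
  have w0: "w \<noteq> 0" using assms by auto
  have small: "norm (- z / w) < 1" using assms w0 by (simp add: norm_divide)
  have wu: "w * u = w - z" using w0 by (simp add: u_def field_simps)
  have Reu: "Re u > 0" using small abs_Re_le_cmod[of "- z / w"] by (simp add: u_def)
  have u0: "u \<noteq> 0" using Reu by auto
  define x where "x = Im (Ln w + Ln u)"
  have "exp (Ln w + Ln u) = w - z" using w0 u0 wu by (simp add: exp_add)
  then have "exp (Re (Ln w + Ln u)) * cos x = Re (w - z)" by (metis Re_exp x_def)
  moreover have "Re (w - z) > 0" using assms(2) by simp
  ultimately have "exp (Re (Ln w + Ln u)) * cos x > 0" by (simp only:)
  then have cosx: "cos x > 0" by (rule zero_less_mult_pos) simp
  have ub: "\<bar>Im (Ln u)\<bar> < pi / 2" using Reu Re_Ln_pos_lt u0 by blast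
  have wb: "- pi < Im (Ln w)" "Im (Ln w) \<le> pi" using w0 by (auto simp: mpi_less_Im_Ln Im_Ln_le_pi)
  have bounds: "- (3 * pi / 2) < x" "x < 3 * pi / 2" using ub wb by (auto simp: x_def)
  have "cos (x - pi) = - cos x" "cos (x + pi) = - cos x" by (auto simp: cos_diff cos_add)
  then have nn: "cos (x - pi) < 0" "cos (x + pi) < 0" using cosx by auto
  have "x \<le> pi" using nn(1) bounds cos_ge_zero[of "x - pi"] by force
  moreover have "x > - pi" using nn(2) bounds cos_ge_zero[of "x + pi"] by force
  ultimately have "Ln (w * u) = Ln w + Ln u" using w0 u0 by (simp add: Ln_times x_def)
  then have prod: "w powr c * u powr c = (w - z) powr c"
    unfolding wu[symmetric] using w0 u0 by (simp add: powr_def exp_add distrib_left)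
  have "(\<lambda>k. (c gchoose k) * (- z / w) ^ k) sums (u powr c)"
    unfolding u_def by (rule gen_binomial_complex[OF small])
  then have "(\<lambda>k. w powr c * ((c gchoose k) * (- z / w) ^ k)) sums ((w - z) powr c)"
    using sums_mult prod by metis
  moreover have "w powr (c - of_nat k) = w powr c / w ^ k" for k
    using w0 by (simp add: powr_diff powr_nat')
  moreover have "(- z / w) ^ k = (- z) ^ k / w ^ k" for k
    by (rule power_divide)
  ultimately show ?thesis
    by (simp only: times_divide_eq_right mult_ac)
qed

end

theory Submission
  imports Defs
begin

text \<open>
  On each oscillator mode \<open>k\<close> the vertex operator of \<open>e\<^sup>\<beta>\<close> acts as a normally ordered product of
  an exponential of \<open>a(-k)\<close> and an exponential of \<open>a(k)\<close>, so its matrix entries factor over the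
  modes.  The trace is therefore a product over \<open>k\<close> of one-oscillator traces.  Each of these is
  elementary: reordering \<open>exp (y a(k)) exp (x a(-k))\<close> costs a scalar, and the trace of one normally
  ordered product against \<open>t\<^sup>N\<close> is \<open>exp (x y t / (1 - t)) / (1 - t)\<close>.  The same computation with
  absolute values gives absolute convergence in the region of the ordering.

  Neutrality turns the sum of all exponents into a sum over pairs \<open>r < s\<close>.  With
  \<open>w = e\<^bsup>-z\<^esup>\<close>, \<open>z = z\<^sub>r - z\<^sub>s\<close>, the contribution of the pair is \<open>\<beta>\<^sub>r \<beta>\<^sub>s\<close> times the logarithm of
  \<open>(1 - w) \<Prod>\<^sub>m (1 - q\<^sup>m w) (1 - q\<^sup>m / w) / (1 - q\<^sup>m)\<^sup>2\<close>, and the zero modes supply \<open>z / 2\<close>.  By the Jacobi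
  triple product this is a logarithm of the prime form; it is the one prescribed by continuation
  from \<open>z = 0\<close>, because it depends continuously on \<open>z\<close> along the segment.
\<close>

section \<open>One oscillator\<close>

text \<open>The trace is by definition one unconditional sum over closed paths, while its evaluation
  is a succession of iterated sums: over intermediate states, over the initial state, over modes.
  Every exchange needs absolute convergence, so summation results travel with a majorant, obtained
  by replacing the parameters of the entries by their norms. The majorant obeys the same identities
  over the reals; hence the elementary lemmas are stated over any complete normed field, and the
  path lemmas prove both sums at once. The parameters of mode k are
  \<open>x = \<beta> w^k / k\<close> and \<open>y = - \<beta> / w^k\<close>. Moving annihilation
  part i past creation part j costs the exponent
  \<open>- \<beta>_i \<beta>_j (w_j / w_i)^k / k\<close>; the trace repeats it with the factor T /
  (1 - T), where T = q^k. Since 1 + T / (1 - T) = 1 / (1 - T), this is the origin of the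
  coefficients of \<open>qlog\<close>. Neutrality trades the diagonal terms of the trace for pair
  terms, and these become the denominators (1 - q^m)^2 that normalise the prime form.\<close>

lemma has_sum_Sigma_dominated:
  fixes f :: "'a \<times> 'b \<Rightarrow> 'c::banach" and h :: "'a \<times> 'b \<Rightarrow> real"
  assumes f: "\<And>x. x \<in> A \<Longrightarrow> ((\<lambda>y. f (x, y)) has_sum g x) (B x)" and g: "(g has_sum S) A"
    and h: "\<And>x. x \<in> A \<Longrightarrow> ((\<lambda>y. h (x, y)) has_sum H x) (B x)" and H: "H summable_on A"
    and dom: "\<And>x y. x \<in> A \<Longrightarrow> y \<in> B x \<Longrightarrow> norm (f (x, y)) \<le> h (x, y)"
  shows "(f has_sum S) (Sigma A B)"
proof (rule has_sum_SigmaI[OF f g])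
  \<comment> \<open>For nonnegative terms iterated summability already implies joint summability;
    \<open>f\<close> inherits it by comparison.\<close>
  have "h summable_on Sigma A B"
    using h H by (rule summable_on_SigmaI) (use dom in \<open>auto intro: order_trans[OF norm_ge_zero]\<close>)
  then have "(\<lambda>p. norm (f p)) summable_on Sigma A B"
    by (rule summable_on_comparison_test) (use dom in auto)
  then show "f summable_on Sigma A B"
    by (rule abs_summable_summable)
qed auto

lemma has_sum_nat_shift:
  fixes f :: "nat \<Rightarrow> 'a::{comm_monoid_add, topological_space}"
  assumes "((\<lambda>d. f (d + k)) has_sum S) UNIV" and "\<And>d. d < k \<Longrightarrow> f d = 0"
  shows "(f has_sum S) UNIV"
proof -
  have "bij_betw (\<lambda>d. d + k) UNIV {k..}"
    by (rule bij_betwI[where g="\<lambda>d. d - k"]) auto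
  then have "(f has_sum S) {k..}"
    using assms(1) has_sum_reindex_bij_betw by blast
  then show ?thesis
    by (subst has_sum_cong_neutral[where T="{k..}" and g=f]) (use assms(2) in auto)
qed

lemma has_sum_sum:
  fixes f :: "'i \<Rightarrow> 'a \<Rightarrow> 'b::topological_comm_monoid_add"
  assumes "\<And>i. i \<in> I \<Longrightarrow> (f i has_sum S i) A"
  shows "((\<lambda>x. \<Sum>i\<in>I. f i x) has_sum (\<Sum>i\<in>I. S i)) A"
  using assms by (induction I rule: infinite_finite_induct) (auto intro: has_sum_add)

lemma exp_has_sum:
  fixes x :: "'a::{real_normed_field, banach}"
  shows "((\<lambda>n. x ^ n / fact n) has_sum exp x) UNIV"
proof (rule norm_summable_imp_has_sum)
  show "(\<lambda>n. x ^ n / fact n) sums exp x"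
    using exp_converges[of x] by (simp add: scaleR_conv_of_real divide_inverse mult.commute)
  show "summable (\<lambda>n. norm (x ^ n / fact n))"
    using summable_norm_exp[of x]
    by (simp add: scaleR_conv_of_real divide_inverse mult.commute)
qed

text \<open>Multiplying by one more geometric series raises \<open>d\<close> by one, and the
  coefficients of the Cauchy product are hockey-stick sums. Norm summability is carried along
  because Cauchy products require it.\<close>

lemma negative_binomial_sums:
  fixes t :: "'a::{real_normed_field, banach}"
  assumes t: "norm t < 1"
  shows "summable (\<lambda>j. norm (of_nat (j + d choose d) * t ^ j)) \<and>
    (\<lambda>j. of_nat (j + d choose d) * t ^ j) sums (1 / (1 - t) ^ Suc d)"
proof (induction d)
  case 0
  show ?case
    using t geometric_sums[OF t] by (simp add: norm_power summable_geometric)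
next
  case (Suc d)
  \<comment> \<open>The general semiring allows the use for \<open>t\<close> and for its
    norm.\<close>
  have hockey: "(\<Sum>i\<le>j. of_nat (i + d choose d) * u ^ i * u ^ (j - i)) = of_nat (j + Suc d choose Suc d) * u ^ j"
    for u :: "'b::comm_semiring_1" and j
  proof -
    have "(\<Sum>i\<le>j. of_nat (i + d choose d) * u ^ i * u ^ (j - i)) = (\<Sum>i\<le>j. of_nat (i + d choose d) * u ^ j)"
      by (intro sum.cong refl) (simp add: mult.assoc flip: power_add)
    also have "\<dots> = of_nat (\<Sum>i\<le>j. (d + i choose d)) * u ^ j"
      by (simp add: sum_distrib_right add.commute)
    also have "(\<Sum>i\<le>j. (d + i choose d)) = (j + Suc d choose Suc d)"
      using choose_rising_sum(1)[of d j] by (simp add: add.commute)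
    finally show ?thesis .
  qed
  have geo: "summable (\<lambda>j. norm (t ^ j))"
    using t by (simp add: norm_power summable_geometric)
  have "summable (\<lambda>j. \<Sum>i\<le>j. norm (of_nat (i + d choose d) * t ^ i) * norm (t ^ (j - i)))"
    using Suc geo by (intro summable_Cauchy_product) auto
  then have "summable (\<lambda>j. norm (of_nat (j + Suc d choose Suc d) * t ^ j))"
    using hockey[of "norm t"] by (simp add: norm_mult norm_power del: binomial_Suc_Suc)
  moreover have "(\<lambda>j. \<Sum>i\<le>j. of_nat (i + d choose d) * t ^ i * t ^ (j - i)) sums
      ((\<Sum>j. of_nat (j + d choose d) * t ^ j) * (\<Sum>j. t ^ j))"
    using Suc geo by (intro Cauchy_product_sums) auto
  then have "(\<lambda>j. of_nat (j + Suc d choose Suc d) * t ^ j) sums (1 / (1 - t) ^ Suc d * (1 / (1 - t)))"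
    using sums_unique[OF conjunct2[OF Suc]] sums_unique[OF geometric_sums[OF t]]
    by (simp only: hockey)
  ultimately show ?case by (simp add: mult.commute)
qed

lemma negative_binomial_has_sum:
  fixes t :: "'a::{real_normed_field, banach}"
  assumes "norm t < 1"
  shows "((\<lambda>j. of_nat (j + d choose d) * t ^ j) has_sum (1 / (1 - t) ^ Suc d)) UNIV"
  using negative_binomial_sums[OF assms, of d] by (blast intro: norm_summable_imp_has_sum)

text \<open>
  On polynomials in one variable \<open>X\<close>, with basis \<open>X\<^sup>a\<close>, these are the matrix entries (row \<open>a\<close>) of
  multiplication by \<open>exp (x X)\<close> and of the normally ordered product \<open>exp (x X) exp (y d/dX)\<close>.
\<close>

definition creation_entry :: "'a::field_char_0 \<Rightarrow> nat \<Rightarrow> nat \<Rightarrow> 'a" where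
  "creation_entry x a j = (if j \<le> a then x ^ (a - j) / fact (a - j) else 0)"

definition mode_entry :: "'a::field_char_0 \<Rightarrow> 'a \<Rightarrow> nat \<Rightarrow> nat \<Rightarrow> 'a" where
  "mode_entry x y a b = (\<Sum>j\<le>a. creation_entry x a j * (creation_entry y b j * fact b / fact j))"

text \<open>The law exp (x X) exp (y X) = exp ((x + y) X), which for each entry is the binomial
  theorem. Any \<open>N\<close> from \<open>a\<close> on will do because the matrices are lower
  triangular.\<close>

lemma creation_entry_add:
  fixes x y :: "'a::field_char_0"
  assumes "a \<le> N"
  shows "(\<Sum>j\<le>N. creation_entry x a j * creation_entry y j p) = creation_entry (x + y) a p"
proof (cases "p \<le> a")
  case False
  then show ?thesis by (auto simp: creation_entry_def intro!: sum.neutral)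
next
  case True
  have "(\<Sum>j\<le>N. creation_entry x a j * creation_entry y j p) =
      (\<Sum>j\<in>{p..a}. creation_entry x a j * creation_entry y j p)"
    by (rule sum.mono_neutral_right) (use assms in \<open>auto simp: creation_entry_def\<close>)
  also have "\<dots> = (\<Sum>i\<le>a - p. y ^ i / fact i * (x ^ (a - p - i) / fact (a - p - i)))"
    by (rule sum.reindex_bij_witness[where i="\<lambda>i. i + p" and j="\<lambda>j. j - p"])
      (use True in \<open>auto simp: creation_entry_def mult.commute\<close>)
  also have "\<dots> = (\<Sum>i\<le>a - p. of_nat (a - p choose i) * y ^ i * x ^ (a - p - i)) / fact (a - p)"
    unfolding sum_divide_distrib
    by (intro sum.cong refl) (simp add: binomial_fact field_simps)
  also have "\<dots> = (y + x) ^ (a - p) / fact (a - p)"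
    by (simp only: binomial_ring)
  finally show ?thesis using True by (simp add: creation_entry_def add.commute)
qed

text \<open>The operator exp (y d/dX) translates X to X + y, so its entries are the coefficients of
  (X + y)^b.\<close>

lemma creation_entry_binomial:
  "creation_entry y b j * fact b / fact j = of_nat (b choose j) * y ^ (b - j)"
  by (auto simp: creation_entry_def binomial_fact mult.commute)

text \<open>The sum over \<open>b\<close> is an entry of exp (y d/dX) exp (x X), to be brought into
  normal order. With b = l + d, Vandermonde's identity separates what is taken from X^l and from the
  newly created X^d; each part then sums to an exponential series.\<close>

lemma annihilation_creation_has_sum:
  fixes x y :: "'a::{real_normed_field, banach}"
  shows "((\<lambda>b. (creation_entry y b j * fact b / fact j) * creation_entry x b l) has_sum
    (exp (x * y) * mode_entry x y j l)) UNIV"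
proof -
  have one: "((\<lambda>d. of_nat (l choose p) * of_nat (d choose (j - p)) * y ^ (l + d - j) * (x ^ d / fact d))
      has_sum (exp (x * y) * (creation_entry x j p * (creation_entry y l p * fact l / fact p)))) UNIV"
    if p: "p \<le> j" for p
  \<comment> \<open>The binomial \<open>d choose (j - p)\<close> vanishes for d < j - p; from there
    on the terms are those of the exponential series of x y, up to a constant.\<close>
  proof (rule has_sum_nat_shift[where k="j - p"])
    have "of_nat (l choose p) * of_nat (d + (j - p) choose (j - p)) * y ^ (l + (d + (j - p)) - j) *
        (x ^ (d + (j - p)) / fact (d + (j - p))) =
        (creation_entry x j p * (creation_entry y l p * fact l / fact p)) * ((x * y) ^ d / fact d)" for d
    proof (cases "p \<le> l")
      case True
      then have e: "l + (d + (j - p)) - j = (l - p) + d" using p by simp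
      define e where "e = j - p"
      have "of_nat (d + e choose e) / fact (d + e) = 1 / (fact e * fact d :: 'a)"
        by (simp add: binomial_fact)
      then have "of_nat (d + e choose e) * (x ^ (d + e) / fact (d + e)) =
          x ^ (d + e) * (1 / (fact e * fact d))"
        by (metis times_divide_eq_right mult.commute)
      then have "of_nat (l choose p) * (of_nat (d + e choose e) * (x ^ (d + e) / fact (d + e))) * y ^ (l - p + d) =
          x ^ e / fact e * (of_nat (l choose p) * y ^ (l - p)) * ((x * y) ^ d / fact d)"
        by (simp add: power_add power_mult_distrib)
      then show ?thesis unfolding e creation_entry_binomial e_def using p
        by (simp add: creation_entry_def mult_ac)
    qed (simp add: creation_entry_binomial binomial_eq_0)
    then show "((\<lambda>d. of_nat (l choose p) * of_nat (d + (j - p) choose (j - p)) *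
        y ^ (l + (d + (j - p)) - j) * (x ^ (d + (j - p)) / fact (d + (j - p)))) has_sum
        (exp (x * y) * (creation_entry x j p * (creation_entry y l p * fact l / fact p)))) UNIV"
      using has_sum_cmult_right[OF exp_has_sum[of "x * y"],
          of "creation_entry x j p * (creation_entry y l p * fact l / fact p)"]
      by (simp only: mult.commute[of "exp (x * y)"])
  qed simp
  have "((\<lambda>d. \<Sum>p\<le>j. of_nat (l choose p) * of_nat (d choose (j - p)) * y ^ (l + d - j) * (x ^ d / fact d))
      has_sum (\<Sum>p\<le>j. exp (x * y) * (creation_entry x j p * (creation_entry y l p * fact l / fact p)))) UNIV"
    by (rule has_sum_sum) (use one in auto)
  moreover have "(\<Sum>p\<le>j. of_nat (l choose p) * of_nat (d choose (j - p)) * y ^ (l + d - j) * (x ^ d / fact d)) =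
      of_nat (l + d choose j) * y ^ (l + d - j) * (x ^ d / fact d)" for d
    by (simp only: vandermonde[symmetric] of_nat_sum of_nat_mult sum_distrib_right)
  ultimately have "((\<lambda>d. of_nat (l + d choose j) * y ^ (l + d - j) * (x ^ d / fact d))
      has_sum (exp (x * y) * mode_entry x y j l)) UNIV"
    by (simp only: mode_entry_def sum_distrib_left)
  then show ?thesis
    unfolding creation_entry_binomial
    by - (rule has_sum_nat_shift[where k=l], simp_all add: creation_entry_def add.commute)
qed

lemma mode_entry_extend:
  assumes "a \<le> N"
  shows "mode_entry x y a b = (\<Sum>j\<le>N. creation_entry x a j * (creation_entry y b j * fact b / fact j))"
  unfolding mode_entry_def
  by (rule sum.mono_neutral_left) (use assms in \<open>auto simp: creation_entry_def\<close>)

lemma mode_entry_extend':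
  assumes "b \<le> N"
  shows "mode_entry x y a b = (\<Sum>j\<le>N. creation_entry x a j * (creation_entry y b j * fact b / fact j))"
proof -
  have "mode_entry x y a b = (\<Sum>j\<le>max a N. creation_entry x a j * (creation_entry y b j * fact b / fact j))"
    by (rule mode_entry_extend) auto
  also have "\<dots> = (\<Sum>j\<le>N. creation_entry x a j * (creation_entry y b j * fact b / fact j))"
    by (rule sum.mono_neutral_right) (use assms in \<open>auto simp: creation_entry_def[of y]\<close>)
  finally show ?thesis .
qed

text \<open>The exponential factor is the Baker--Campbell--Hausdorff cocycle of one oscillator.\<close>

lemma mode_entry_compose:
  fixes x y x' y' :: "'a::{real_normed_field, banach}"
  shows "((\<lambda>b. mode_entry x y a b * mode_entry x' y' b c) has_sum
    (exp (y * x') * mode_entry (x + x') (y + y') a c)) UNIV"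
proof -
  let ?A = "\<lambda>j. creation_entry x a j"
  let ?D = "\<lambda>l. creation_entry y' c l * fact c / fact l"
  have "((\<lambda>b. \<Sum>j\<le>a. \<Sum>l\<le>c. ?A j * ((creation_entry y b j * fact b / fact j) * creation_entry x' b l) * ?D l)
      has_sum (\<Sum>j\<le>a. \<Sum>l\<le>c. ?A j * (exp (x' * y) * mode_entry x' y j l) * ?D l)) UNIV"
    by (intro has_sum_sum has_sum_cmult_left has_sum_cmult_right annihilation_creation_has_sum)
  moreover have "(\<Sum>j\<le>a. \<Sum>l\<le>c. ?A j * ((creation_entry y b j * fact b / fact j) * creation_entry x' b l) * ?D l)
      = mode_entry x y a b * mode_entry x' y' b c" for b
    unfolding mode_entry_def[of x] mode_entry_extend'[OF order_refl, of x'] sum_product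
    by (simp add: mult_ac)
  moreover have "(\<Sum>j\<le>a. \<Sum>l\<le>c. ?A j * (exp (x' * y) * mode_entry x' y j l) * ?D l) =
      exp (y * x') * mode_entry (x + x') (y + y') a c"
  proof -
    \<comment> \<open>A common bound for the index of the inner entry makes its range independent of
      \<open>j\<close>, so that the sums can be interchanged.\<close>
    let ?M = "max a c"
    have "(\<Sum>j\<le>a. \<Sum>l\<le>c. ?A j * (exp (x' * y) * mode_entry x' y j l) * ?D l) =
        (\<Sum>j\<le>a. \<Sum>l\<le>c. \<Sum>p\<le>?M. exp (y * x') * (?A j * creation_entry x' j p *
          (creation_entry y' c l * creation_entry y l p) * (fact c / fact p)))"
      by (intro sum.cong refl, subst mode_entry_extend[of _ ?M])
        (auto simp: sum_distrib_left sum_distrib_right mult_ac intro!: sum.cong)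
    also have "\<dots> = (\<Sum>j\<le>a. \<Sum>p\<le>?M. \<Sum>l\<le>c. exp (y * x') * (?A j * creation_entry x' j p *
          (creation_entry y' c l * creation_entry y l p) * (fact c / fact p)))"
      by (intro sum.cong refl sum.swap)
    also have "\<dots> = (\<Sum>p\<le>?M. \<Sum>j\<le>a. \<Sum>l\<le>c. exp (y * x') * (?A j * creation_entry x' j p *
          (creation_entry y' c l * creation_entry y l p) * (fact c / fact p)))"
      by (rule sum.swap)
    also have "\<dots> = (\<Sum>p\<le>?M. exp (y * x') * ((\<Sum>j\<le>a. ?A j * creation_entry x' j p) *
          (\<Sum>l\<le>c. creation_entry y' c l * creation_entry y l p) * (fact c / fact p)))"
      by (simp only: sum_product sum_distrib_left sum_distrib_right, rule sum.cong[OF refl], rule sum.swap)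
    also have "\<dots> = exp (y * x') * mode_entry (x + x') (y + y') a c"
      unfolding creation_entry_add[OF order_refl]
      by (subst mode_entry_extend[of _ ?M]) (auto simp: sum_distrib_left mult_ac add.commute)
    finally show ?thesis .
  qed
  ultimately show ?thesis by simp
qed

lemma mode_entry_zero: "mode_entry 0 0 a b = (if a = b then 1 else 0)"
proof -
  have "creation_entry (0::'a) = (\<lambda>m j. if j = m then 1 else 0)"
    by (auto simp: creation_entry_def fun_eq_iff)
  then have "mode_entry (0::'a) 0 a b = (\<Sum>j\<le>a. if j = a then (if a = b then 1 else 0) else 0)"
    unfolding mode_entry_def by (intro sum.cong) auto
  then show ?thesis by simp
qed

lemma norm_creation_entry:
  fixes x :: "'a::{real_normed_field, banach}"
  shows "norm (creation_entry x a j) = creation_entry (norm x) a j"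
  by (simp add: creation_entry_def norm_divide norm_power)

text \<open>The majorant has the same shape with real parameters, so its sums need no separate
  estimates.\<close>

lemma norm_mode_entry_le:
  fixes x y :: "'a::{real_normed_field, banach}"
  shows "norm (mode_entry x y a b) \<le> mode_entry (norm x) (norm y) a b"
  unfolding mode_entry_def
  by (rule sum_norm_le) (simp add: norm_mult norm_divide norm_creation_entry)

lemma mode_entry_diag:
  "mode_entry x y a a = (\<Sum>j\<le>a. (x * y) ^ (a - j) / fact (a - j) * of_nat (a choose j))"
  unfolding mode_entry_def creation_entry_binomial
  by (intro sum.cong refl) (simp add: creation_entry_def power_mult_distrib)

text \<open>Write a = j + d, where d counts the factors X that are annihilated and recreated. For
  fixed d the sum over j is a negative binomial series; the remaining sum over d is exponential in x
  y t / (1 - t).\<close>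

lemma mode_entry_trace:
  fixes x y t :: "'a::{real_normed_field, banach}"
  assumes t: "norm t < 1"
  shows "((\<lambda>a. mode_entry x y a a * t ^ a) has_sum (1 / (1 - t) * exp (x * y * t / (1 - t)))) UNIV"
proof -
  define f :: "nat \<times> nat \<Rightarrow> 'a" where
    "f = (\<lambda>(d, j). (x * y * t) ^ d / fact d * (of_nat (j + d choose d) * t ^ j))"
  define h :: "nat \<times> nat \<Rightarrow> real" where
    "h = (\<lambda>(d, j). (norm (x * y * t)) ^ d / fact d * (of_nat (j + d choose d) * norm t ^ j))"
  have expo: "((\<lambda>d. u ^ d / fact d * (1 / (1 - v) ^ Suc d)) has_sum (1 / (1 - v) * exp (u / (1 - v)))) UNIV"
    for u v :: "'b::{real_normed_field, banach}"
    using has_sum_cmult_right[OF exp_has_sum[of "u / (1 - v)"], of "1 / (1 - v)"]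
    by (simp add: power_divide mult_ac)
  have "(f has_sum (1 / (1 - t) * exp (x * y * t / (1 - t)))) (Sigma UNIV (\<lambda>_. UNIV))"
  proof (rule has_sum_Sigma_dominated)
    show "((\<lambda>j. f (d, j)) has_sum ((x * y * t) ^ d / fact d * (1 / (1 - t) ^ Suc d))) UNIV" for d
      unfolding f_def prod.case by (intro has_sum_cmult_right negative_binomial_has_sum t)
    show "((\<lambda>j. h (d, j)) has_sum ((norm (x * y * t)) ^ d / fact d * (1 / (1 - norm t) ^ Suc d))) UNIV" for d
      unfolding h_def prod.case using t by (intro has_sum_cmult_right negative_binomial_has_sum) simp
    show "((\<lambda>d. (x * y * t) ^ d / fact d * (1 / (1 - t) ^ Suc d)) has_sum
        (1 / (1 - t) * exp (x * y * t / (1 - t)))) UNIV"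
      by (rule expo)
    show "(\<lambda>d. (norm (x * y * t)) ^ d / fact d * (1 / (1 - norm t) ^ Suc d)) summable_on UNIV"
      using expo by (rule has_sum_imp_summable)
    show "norm (f (d, j)) \<le> h (d, j)" for d j
      by (simp add: f_def h_def norm_mult norm_divide norm_power)
  qed
  moreover have "f (a - j, j) = (x * y) ^ (a - j) / fact (a - j) * of_nat (a choose j) * t ^ a" if "j \<le> a" for a j
  proof -
    have "t ^ a = t ^ (a - j) * t ^ j" using that by (simp flip: power_add)
    then show ?thesis
      using that binomial_symmetric[OF that] by (simp add: f_def power_mult_distrib)
  qed
  \<comment> \<open>Regrouping by the degree \<open>a\<close> turns the inner sums into the finite
    sums of \<open>mode_entry_diag\<close>.\<close>
  ultimately have "((\<lambda>(a, j). (x * y) ^ (a - j) / fact (a - j) * of_nat (a choose j) * t ^ a) has_sum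
      (1 / (1 - t) * exp (x * y * t / (1 - t)))) (Sigma UNIV (\<lambda>a. {..a}))"
    by (subst has_sum_reindex_bij_witness[where i="\<lambda>(d, j). (j + d, j)" and j="\<lambda>(a, j). (a - j, j)"
        and h=f and T="UNIV \<times> UNIV"]) auto
  from has_sum_SigmaD[OF this, of "\<lambda>a. mode_entry x y a a * t ^ a"] show ?thesis
    by (auto simp: mode_entry_diag sum_distrib_right intro!: has_sum_finiteI)
qed

section \<open>Paths and loops of one oscillator\<close>

definition open_paths :: "nat \<Rightarrow> nat \<Rightarrow> nat \<Rightarrow> (nat \<Rightarrow> nat) set" where
  "open_paths n a b = {c \<in> {0..n} \<rightarrow>\<^sub>E UNIV. c 0 = a \<and> c n = b}"

definition loops :: "nat \<Rightarrow> (nat \<Rightarrow> nat) set" where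
  "loops n = {c \<in> {0..n} \<rightarrow>\<^sub>E UNIV. c 0 = c n}"

definition mode_path :: "nat \<Rightarrow> (nat \<Rightarrow> 'a::field_char_0) \<Rightarrow> (nat \<Rightarrow> 'a) \<Rightarrow> (nat \<Rightarrow> nat) \<Rightarrow> 'a" where
  "mode_path n x y c = (\<Prod>i = 1..n. mode_entry (x i) (y i) (c (i - 1)) (c i))"

lemma norm_mode_path_le:
  fixes x y :: "nat \<Rightarrow> 'a::{real_normed_field, banach}"
  shows "norm (mode_path n x y c) \<le> mode_path n (\<lambda>i. norm (x i)) (\<lambda>i. norm (y i)) c"
  unfolding mode_path_def prod_norm[symmetric]
  by (intro prod_mono conjI norm_ge_zero norm_mode_entry_le)

lemma mode_path_Suc:
  "mode_path (Suc n) x y c = mode_path n x y c * mode_entry (x (Suc n)) (y (Suc n)) (c n) (c (Suc n))"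
  by (simp add: mode_path_def)

lemma mode_path_cong: "(\<And>i. i \<le> n \<Longrightarrow> c i = c' i) \<Longrightarrow> mode_path n x y c = mode_path n x y c'"
  unfolding mode_path_def by (intro prod.cong refl) auto

text \<open>Induction on the number of steps. \<open>V\<close> is the entry of the product in normal
  order: its exponent collects \<open>y i * x j\<close> for each annihilation part \<open>i\<close>
  that is moved past a later creation part \<open>j\<close>. The majorant \<open>W\<close> is
  treated simultaneously because it justifies each exchange of sums.\<close>

lemma open_paths_has_sum:
  fixes x y :: "nat \<Rightarrow> 'a::{real_normed_field, banach}" and a :: nat
  defines "V \<equiv> \<lambda>n b. exp (\<Sum>j = 1..n. \<Sum>i = 1..<j. y i * x j) *
      mode_entry (\<Sum>i = 1..n. x i) (\<Sum>i = 1..n. y i) a b"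
    and "W \<equiv> \<lambda>n b. exp (\<Sum>j = 1..n. \<Sum>i = 1..<j. norm (y i) * norm (x j)) *
      mode_entry (\<Sum>i = 1..n. norm (x i)) (\<Sum>i = 1..n. norm (y i)) a b"
  shows "(mode_path n x y has_sum V n b) (open_paths n a b) \<and>
    (mode_path n (\<lambda>i. norm (x i)) (\<lambda>i. norm (y i)) has_sum W n b) (open_paths n a b)"
proof (induction n arbitrary: b)
  case 0
  have "open_paths 0 a b = (if a = b then {\<lambda>i\<in>{0}. a} else {})"
    by (auto simp: open_paths_def PiE_def extensional_def)
  then show ?case
    by (auto simp: V_def W_def mode_entry_zero mode_path_def intro!: has_sum_finiteI)
next
  case (Suc n)
  \<comment> \<open>A path with one more step is a path to an arbitrary \<open>b'\<close> with the
    endpoint \<open>b\<close> appended.\<close>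
  have bij: "bij_betw (\<lambda>(b', c). c(Suc n := b)) (Sigma UNIV (open_paths n a)) (open_paths (Suc n) a b)"
  proof (rule bij_betwI[where g="\<lambda>c. (c n, restrict c {0..n})"])
    fix c assume c: "c \<in> open_paths (Suc n) a b"
    then have "(restrict c {0..n})(Suc n := b) = c"
      by (auto simp: open_paths_def PiE_def extensional_def fun_eq_iff restrict_def)
    then show "(case (c n, restrict c {0..n}) of (b', c) \<Rightarrow> c(Suc n := b)) = c" by simp
  next
    fix p assume "p \<in> Sigma UNIV (open_paths n a)"
    then obtain b' c where p: "p = (b', c)" "c \<in> open_paths n a b'" by blast
    then have "restrict (c(Suc n := b)) {0..n} = c"
      by (auto simp: open_paths_def PiE_def extensional_def fun_eq_iff restrict_def)
    moreover have "c n = b'" using p by (simp add: open_paths_def)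
    ultimately show "((case p of (b', c) \<Rightarrow> c(Suc n := b)) n,
        restrict (case p of (b', c) \<Rightarrow> c(Suc n := b)) {0..n}) = p"
      using p by simp
  qed (auto simp: open_paths_def PiE_def extensional_def)
  let ?m = "\<lambda>b'. mode_entry (x (Suc n)) (y (Suc n)) b' b"
  let ?M = "\<lambda>b'. mode_entry (norm (x (Suc n))) (norm (y (Suc n))) b' b"
  let ?P = "mode_path n (\<lambda>i. norm (x i)) (\<lambda>i. norm (y i))"
  \<comment> \<open>Summing over the last intermediate state is \<open>mode_entry_compose\<close>;
    its cocycle is the new summand j = Suc n of the exponent.\<close>
  have V: "((\<lambda>b'. V n b' * ?m b') has_sum V (Suc n) b) UNIV"
  proof -
    have "((\<lambda>b'. exp (\<Sum>j = 1..n. \<Sum>i = 1..<j. y i * x j) *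
        (mode_entry (\<Sum>i = 1..n. x i) (\<Sum>i = 1..n. y i) a b' * ?m b')) has_sum
        exp (\<Sum>j = 1..n. \<Sum>i = 1..<j. y i * x j) * (exp ((\<Sum>i = 1..n. y i) * x (Suc n)) *
        mode_entry ((\<Sum>i = 1..n. x i) + x (Suc n)) ((\<Sum>i = 1..n. y i) + y (Suc n)) a b)) UNIV"
      by (intro has_sum_cmult_right mode_entry_compose)
    then show ?thesis
      by (simp add: V_def exp_add sum_distrib_right mult.assoc atLeastLessThanSuc_atLeastAtMost)
  qed
  have W: "((\<lambda>b'. W n b' * ?M b') has_sum W (Suc n) b) UNIV"
  proof -
    have "((\<lambda>b'. exp (\<Sum>j = 1..n. \<Sum>i = 1..<j. norm (y i) * norm (x j)) *
        (mode_entry (\<Sum>i = 1..n. norm (x i)) (\<Sum>i = 1..n. norm (y i)) a b' * ?M b')) has_sum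
        exp (\<Sum>j = 1..n. \<Sum>i = 1..<j. norm (y i) * norm (x j)) *
        (exp ((\<Sum>i = 1..n. norm (y i)) * norm (x (Suc n))) *
        mode_entry ((\<Sum>i = 1..n. norm (x i)) + norm (x (Suc n)))
          ((\<Sum>i = 1..n. norm (y i)) + norm (y (Suc n))) a b)) UNIV"
      by (intro has_sum_cmult_right mode_entry_compose)
    then show ?thesis
      by (simp add: W_def exp_add sum_distrib_right mult.assoc atLeastLessThanSuc_atLeastAtMost)
  qed
  have inner: "((\<lambda>c. mode_path n x y c * ?m b') has_sum (V n b' * ?m b')) (open_paths n a b')"
    "((\<lambda>c. ?P c * ?M b') has_sum (W n b' * ?M b')) (open_paths n a b')" for b'
    using Suc[of b'] by (auto intro: has_sum_cmult_left)
  have nn: "norm (mode_path n x y c * ?m b') \<le> ?P c * ?M b'" for c b'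
    unfolding norm_mult
    by (intro mult_mono norm_mode_path_le norm_mode_entry_le)
      (auto intro: order_trans[OF norm_ge_zero norm_mode_path_le])
  have Pnn: "0 \<le> ?P c * ?M b'" for c b'
    using nn order_trans[OF norm_ge_zero] by blast
  have 1: "((\<lambda>(b', c). mode_path n x y c * ?m b') has_sum V (Suc n) b) (Sigma UNIV (open_paths n a))"
    by (rule has_sum_Sigma_dominated[where h="\<lambda>(b', c). ?P c * ?M b'"])
      (use V has_sum_imp_summable[OF W] inner nn in simp_all)
  have 2: "((\<lambda>(b', c). ?P c * ?M b') has_sum W (Suc n) b) (Sigma UNIV (open_paths n a))"
    by (rule has_sum_Sigma_dominated[where h="\<lambda>(b', c). ?P c * ?M b'"])
      (use W has_sum_imp_summable[OF W] inner Pnn in \<open>simp_all add: abs_of_nonneg\<close>)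
  have step: "mode_path (Suc n) u v ((\<lambda>(b', c). c(Suc n := b)) p) =
      (\<lambda>(b', c). mode_path n u v c * mode_entry (u (Suc n)) (v (Suc n)) b' b) p"
    if p_in: "p \<in> Sigma UNIV (open_paths n a)" for u v :: "nat \<Rightarrow> 'b::field_char_0" and p
  proof -
    obtain b' c where p: "p = (b', c)" "c n = b'" using p_in by (auto simp: open_paths_def)
    have "mode_path n u v (c(Suc n := b)) = mode_path n u v c"
      by (rule mode_path_cong) auto
    then show ?thesis by (simp add: p mode_path_Suc)
  qed
  show ?case
    unfolding has_sum_reindex_bij_betw[OF bij, symmetric]
  proof
    show "((\<lambda>p. mode_path (Suc n) x y (case p of (b', c) \<Rightarrow> c(Suc n := b))) has_sum V (Suc n) b)
        (Sigma UNIV (open_paths n a))"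
      by (rule has_sum_cong[THEN iffD2, OF _ 1]) (erule step)
    show "((\<lambda>p. mode_path (Suc n) (\<lambda>i. norm (x i)) (\<lambda>i. norm (y i)) (case p of (b', c) \<Rightarrow> c(Suc n := b)))
        has_sum W (Suc n) b) (Sigma UNIV (open_paths n a))"
      by (rule has_sum_cong[THEN iffD2, OF _ 2]) (erule step)
  qed
qed

text \<open>Closing the path: a sum over paths from \<open>a\<close> to \<open>a\<close> is the
  cocycle times a diagonal entry, and \<open>mode_entry_trace\<close> sums these with weight
  \<open>t ^ a\<close>.\<close>

lemma loops_has_sum:
  fixes x y :: "nat \<Rightarrow> 'a::{real_normed_field, banach}"
  assumes t: "norm t < 1"
  shows "((\<lambda>c. mode_path n x y c * t ^ c 0) has_sum
      1 / (1 - t) * exp ((\<Sum>j = 1..n. \<Sum>i = 1..<j. y i * x j) +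
        (\<Sum>i = 1..n. x i) * (\<Sum>i = 1..n. y i) * t / (1 - t))) (loops n) \<and>
    ((\<lambda>c. mode_path n (\<lambda>i. norm (x i)) (\<lambda>i. norm (y i)) c * norm t ^ c 0) has_sum
      1 / (1 - norm t) * exp ((\<Sum>j = 1..n. \<Sum>i = 1..<j. norm (y i) * norm (x j)) +
        (\<Sum>i = 1..n. norm (x i)) * (\<Sum>i = 1..n. norm (y i)) * norm t / (1 - norm t))) (loops n)"
proof -
  let ?X = "\<lambda>i. norm (x i)" let ?Y = "\<lambda>i. norm (y i)"
  have bij: "bij_betw snd (Sigma UNIV (\<lambda>a. open_paths n a a)) (loops n)"
    by (rule bij_betwI[where g="\<lambda>c. (c 0, c)"]) (auto simp: open_paths_def loops_def)
  have start: "c 0 = a" if "c \<in> open_paths n a a" for c a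
    using that by (simp add: open_paths_def)
  have trace: "((\<lambda>a. exp E * mode_entry X Y a a * s ^ a) has_sum (1 / (1 - s) * exp (E + X * Y * s / (1 - s)))) UNIV"
    if "norm s < 1" for E X Y s :: "'b::{real_normed_field, banach}"
    using has_sum_cmult_right[OF mode_entry_trace[OF that, of X Y], of "exp E"]
    by (simp add: exp_add mult_ac)
  have nt: "norm (norm t) < 1" using t by simp
  note tr = trace[OF t, of "\<Sum>j = 1..n. \<Sum>i = 1..<j. y i * x j" "\<Sum>i = 1..n. x i" "\<Sum>i = 1..n. y i"]
    trace[OF nt, of "\<Sum>j = 1..n. \<Sum>i = 1..<j. norm (y i) * norm (x j)" "\<Sum>i = 1..n. norm (x i)"
      "\<Sum>i = 1..n. norm (y i)"]
  have inner: "((\<lambda>c. mode_path n x y c * t ^ a) has_sum (exp (\<Sum>j = 1..n. \<Sum>i = 1..<j. y i * x j) *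
      mode_entry (\<Sum>i = 1..n. x i) (\<Sum>i = 1..n. y i) a a * t ^ a)) (open_paths n a a)"
    "((\<lambda>c. mode_path n ?X ?Y c * norm t ^ a) has_sum (exp (\<Sum>j = 1..n. \<Sum>i = 1..<j. norm (y i) * norm (x j)) *
      mode_entry (\<Sum>i = 1..n. ?X i) (\<Sum>i = 1..n. ?Y i) a a * norm t ^ a)) (open_paths n a a)" for a
    using open_paths_has_sum[of n x y a a] by (auto intro: has_sum_cmult_left)
  have nn: "norm (mode_path n x y c * t ^ a) \<le> mode_path n ?X ?Y c * norm t ^ a" for c a
    by (simp add: norm_mult norm_power mult_right_mono norm_mode_path_le)
  have Pnn: "norm (mode_path n ?X ?Y c * norm t ^ a) \<le> mode_path n ?X ?Y c * norm t ^ a" for c a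
    using order_trans[OF norm_ge_zero nn, of c a] by simp
  have 1: "((\<lambda>(a, c). mode_path n x y c * t ^ a) has_sum
      1 / (1 - t) * exp ((\<Sum>j = 1..n. \<Sum>i = 1..<j. y i * x j) +
        (\<Sum>i = 1..n. x i) * (\<Sum>i = 1..n. y i) * t / (1 - t))) (Sigma UNIV (\<lambda>a. open_paths n a a))"
    by (rule has_sum_Sigma_dominated[where h="\<lambda>(a, c). mode_path n ?X ?Y c * norm t ^ a",
          OF _ tr(1) _ has_sum_imp_summable[OF tr(2)]])
      (simp_all only: prod.case inner nn)
  have 2: "((\<lambda>(a, c). mode_path n ?X ?Y c * norm t ^ a) has_sum
      1 / (1 - norm t) * exp ((\<Sum>j = 1..n. \<Sum>i = 1..<j. norm (y i) * norm (x j)) +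
        (\<Sum>i = 1..n. ?X i) * (\<Sum>i = 1..n. ?Y i) * norm t / (1 - norm t))) (Sigma UNIV (\<lambda>a. open_paths n a a))"
    by (rule has_sum_Sigma_dominated[where h="\<lambda>(a, c). mode_path n ?X ?Y c * norm t ^ a",
          OF _ tr(2) _ has_sum_imp_summable[OF tr(2)]])
      (simp_all only: prod.case inner Pnn)
  show ?thesis
    unfolding has_sum_reindex_bij_betw[OF bij, symmetric]
    by (intro conjI; rule has_sum_cong[THEN iffD1, OF _ 1] has_sum_cong[THEN iffD1, OF _ 2])
      (auto simp: start)
qed

section \<open>Independent modes\<close>

text \<open>The distributive law for finitely many absolutely convergent sums, one coordinate split
  off at a time. The sum of the majorants is kept because it later bounds the product over all
  modes.\<close>

lemma has_sum_prod_PiE: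
  fixes f :: "'i \<Rightarrow> 'a \<Rightarrow> 'c::{real_normed_field, banach}" and h :: "'i \<Rightarrow> 'a \<Rightarrow> real"
  assumes "finite I"
    and f: "\<And>k. k \<in> I \<Longrightarrow> (f k has_sum T k) (A k)" and h: "\<And>k. k \<in> I \<Longrightarrow> (h k has_sum H k) (A k)"
    and dom: "\<And>k c. k \<in> I \<Longrightarrow> c \<in> A k \<Longrightarrow> norm (f k c) \<le> h k c"
  shows "((\<lambda>g. \<Prod>k\<in>I. f k (g k)) has_sum (\<Prod>k\<in>I. T k)) (PiE I A) \<and>
    ((\<lambda>g. \<Prod>k\<in>I. h k (g k)) has_sum (\<Prod>k\<in>I. H k)) (PiE I A)"
  using assms
proof (induction I rule: finite_induct)
  case empty
  then show ?case by (auto intro: has_sum_finiteI)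
next
  case (insert i I)
  let ?S = "Sigma (A i) (\<lambda>_. PiE I A)"
  have bij: "bij_betw (\<lambda>(c, g). g(i := c)) ?S (PiE (insert i I) A)"
    unfolding PiE_insert_eq using insert.hyps
    by (auto simp: bij_betw_def intro: inj_combinator)
  have upd: "(\<Prod>k\<in>insert i I. u k ((case p of (c, g) \<Rightarrow> g(i := c)) k)) =
      (\<lambda>(c, g). u i c * (\<Prod>k\<in>I. u k (g k))) p" for u :: "'i \<Rightarrow> 'a \<Rightarrow> 'd::comm_monoid_mult" and p
    using insert.hyps by (cases p) (auto intro!: prod.cong arg_cong2[where f="(*)"])
  have IH: "((\<lambda>g. \<Prod>k\<in>I. f k (g k)) has_sum (\<Prod>k\<in>I. T k)) (PiE I A)"
    "((\<lambda>g. \<Prod>k\<in>I. h k (g k)) has_sum (\<Prod>k\<in>I. H k)) (PiE I A)"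
    using insert by blast+
  have hnn: "0 \<le> h k c" if "k \<in> insert i I" "c \<in> A k" for k c
    using insert.prems(3)[OF that] order_trans[OF norm_ge_zero] by blast
  have nn: "norm (f i c * (\<Prod>k\<in>I. f k (g k))) \<le> h i c * (\<Prod>k\<in>I. h k (g k))"
    if "c \<in> A i" "g \<in> PiE I A" for c g
    unfolding norm_mult prod_norm[symmetric] using that insert.prems(3) hnn
    by (intro mult_mono prod_mono prod_nonneg) (auto simp: PiE_iff)
  have inner: "((\<lambda>g. f i c * (\<Prod>k\<in>I. f k (g k))) has_sum f i c * (\<Prod>k\<in>I. T k)) (PiE I A)"
    "((\<lambda>g. h i c * (\<Prod>k\<in>I. h k (g k))) has_sum h i c * (\<Prod>k\<in>I. H k)) (PiE I A)" for c
    by (intro has_sum_cmult_right IH)+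
  have outer: "((\<lambda>c. f i c * (\<Prod>k\<in>I. T k)) has_sum (T i * (\<Prod>k\<in>I. T k))) (A i)"
    "((\<lambda>c. h i c * (\<Prod>k\<in>I. H k)) has_sum (H i * (\<Prod>k\<in>I. H k))) (A i)"
    by (intro has_sum_cmult_left insert.prems; simp)+
  have "((\<lambda>(c, g). f i c * (\<Prod>k\<in>I. f k (g k))) has_sum (T i * (\<Prod>k\<in>I. T k))) ?S"
    by (rule has_sum_Sigma_dominated[where h="\<lambda>(c, g). h i c * (\<Prod>k\<in>I. h k (g k))",
          OF _ outer(1) _ has_sum_imp_summable[OF outer(2)]]) (simp_all only: prod.case inner nn)
  moreover have "((\<lambda>(c, g). h i c * (\<Prod>k\<in>I. h k (g k))) has_sum (H i * (\<Prod>k\<in>I. H k))) ?S"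
  proof (rule has_sum_Sigma_dominated[where h="\<lambda>(c, g). h i c * (\<Prod>k\<in>I. h k (g k))",
          OF _ outer(2) _ has_sum_imp_summable[OF outer(2)]])
    fix c g assume "c \<in> A i" "g \<in> PiE I A"
    then show "norm (case (c, g) of (c, g) \<Rightarrow> h i c * (\<Prod>k\<in>I. h k (g k))) \<le>
        (case (c, g) of (c, g) \<Rightarrow> h i c * (\<Prod>k\<in>I. h k (g k)))"
      using order_trans[OF norm_ge_zero nn] by simp
  qed (simp_all only: prod.case inner)
  ultimately show ?case
    unfolding has_sum_reindex_bij_betw[OF bij, symmetric] upd using insert.hyps by simp
qed

text \<open>Identifies the value of a sum already known to converge. A finite set that determines
  \<open>S\<close> up to e / 2 lies in some \<open>A' K\<close>; enlarging it inside
  \<open>A' K\<close> brings it near \<open>s K\<close> while it stays near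
  \<open>S\<close>.\<close>

lemma has_sum_exhaustion:
  fixes f :: "'a \<Rightarrow> 'b::real_normed_vector"
  assumes S: "(f has_sum S) A" and s: "\<And>K. (f has_sum s K) (A' K)"
    and mono: "\<And>K L. K \<le> L \<Longrightarrow> A' K \<subseteq> A' L" and cover: "A = (\<Union>K. A' K)"
  shows "s \<longlonglongrightarrow> S"
proof (rule LIMSEQ_I)
  fix e :: real assume "e > 0"
  then have e: "e / 2 > 0" by simp
  obtain X where X: "finite X" "X \<subseteq> A" and
    X': "\<And>Y. finite Y \<Longrightarrow> X \<subseteq> Y \<Longrightarrow> Y \<subseteq> A \<Longrightarrow> dist (sum f Y) S < e / 2"
    using S e unfolding has_sum_def tendsto_iff eventually_finite_subsets_at_top by meson
  have "\<exists>K. X \<subseteq> A' K" using X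
  proof (induction X rule: finite_induct)
    case (insert x X)
    then obtain K L where "X \<subseteq> A' K" "x \<in> A' L" using cover by auto
    then have "insert x X \<subseteq> A' (max K L)" using mono[of K "max K L"] mono[of L "max K L"] by auto
    then show ?case ..
  qed simp
  then obtain K0 where K0: "X \<subseteq> A' K0" ..
  have "norm (s K - S) < e" if "K0 \<le> K" for K
  proof -
    have XK: "X \<subseteq> A' K" using K0 mono[OF that] by blast
    obtain Z where Z: "finite Z" "Z \<subseteq> A' K" and
      Z': "\<And>Y. finite Y \<Longrightarrow> Z \<subseteq> Y \<Longrightarrow> Y \<subseteq> A' K \<Longrightarrow> dist (sum f Y) (s K) < e / 2"
      using s[of K] e unfolding has_sum_def tendsto_iff eventually_finite_subsets_at_top by meson
    have "dist (sum f (X \<union> Z)) S < e / 2" "dist (sum f (X \<union> Z)) (s K) < e / 2"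
      using X X'[of "X \<union> Z"] Z Z'[of "X \<union> Z"] XK cover by auto
    then show ?thesis
      using dist_triangle_half_r[of "sum f (X \<union> Z)" "s K" e S] by (simp add: dist_norm)
  qed
  then show "\<exists>no. \<forall>K\<ge>no. norm (s K - S) < e" by blast
qed

text \<open>This is the passage from finitely many to all modes. A configuration leaves the base
  state \<open>b\<close> in finitely many modes only, and index 0 is frozen at \<open>b\<close>
  because oscillator labels are positive.\<close>

lemma has_sum_finite_support:
  fixes f :: "nat \<Rightarrow> 'a \<Rightarrow> 'c::{real_normed_field, banach}" and h :: "nat \<Rightarrow> 'a \<Rightarrow> real"
  assumes base: "b \<in> A" "\<And>k. k \<ge> 1 \<Longrightarrow> f k b = 1" "\<And>k. k \<ge> 1 \<Longrightarrow> h k b = 1"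
    and f: "\<And>k. k \<ge> 1 \<Longrightarrow> (f k has_sum T k) A" and h: "\<And>k. k \<ge> 1 \<Longrightarrow> (h k has_sum H k) A"
    and dom: "\<And>k c. k \<ge> 1 \<Longrightarrow> c \<in> A \<Longrightarrow> norm (f k c) \<le> h k c"
    and bound: "\<And>K. (\<Prod>k = 1..K. H k) \<le> D"
    and lim: "(\<lambda>K. \<Prod>k = 1..K. T k) \<longlonglongrightarrow> L"
  shows "((\<lambda>g. \<Prod>k | g k \<noteq> b. f k (g k)) has_sum L)
    {g. (\<forall>k. g k \<in> A) \<and> g 0 = b \<and> finite {k. g k \<noteq> b}}"
proof -
  define F where "F = {g :: nat \<Rightarrow> 'a. (\<forall>k. g k \<in> A) \<and> g 0 = b \<and> finite {k. g k \<noteq> b}}"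
  define F' where "F' K = {g \<in> F. \<forall>k>K. g k = b}" for K
  have cover: "F = (\<Union>K. F' K)"
  proof -
    have "\<exists>K. \<forall>k>K. g k = b" if "finite {k. g k \<noteq> b}" for g :: "nat \<Rightarrow> 'a"
      using that finite_nat_set_iff_bounded_le[of "{k. g k \<noteq> b}"] by (auto simp: not_le[symmetric])
    then show ?thesis by (auto simp: F_def F'_def)
  qed
  have mono: "F' K \<subseteq> F' M" if "K \<le> M" for K M
    using that by (auto simp: F'_def)
  \<comment> \<open>With only the modes up to \<open>K\<close> excited the sum factors; base states
    weigh 1, so the product over the support may be taken over all of {1..K}.\<close>
  have ps: "((\<lambda>g. \<Prod>k | g k \<noteq> b. f k (g k)) has_sum (\<Prod>k = 1..K. T k)) (F' K) \<and>
    ((\<lambda>g. \<Prod>k | g k \<noteq> b. h k (g k)) has_sum (\<Prod>k = 1..K. H k)) (F' K)" for K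
  proof -
    have bij: "bij_betw (\<lambda>g k. if k \<in> {1..K} then g k else b) (PiE {1..K} (\<lambda>_. A)) (F' K)"
    proof (rule bij_betwI[where g="\<lambda>g. restrict g {1..K}"])
      show "(\<lambda>g k. if k \<in> {1..K} then g k else b) \<in> PiE {1..K} (\<lambda>_. A) \<rightarrow> F' K"
      proof
        fix g assume g: "g \<in> PiE {1..K} (\<lambda>_. A)"
        have "{k. (if k \<in> {1..K} then g k else b) \<noteq> b} \<subseteq> {1..K}" by auto
        then have "finite {k. (if k \<in> {1..K} then g k else b) \<noteq> b}"
          by (rule finite_subset) simp
        then show "(\<lambda>k. if k \<in> {1..K} then g k else b) \<in> F' K"
          using g base(1) by (auto simp: F'_def F_def PiE_iff)
      qed
      show "(\<lambda>k. if k \<in> {1..K} then restrict g {1..K} k else b) = g" if "g \<in> F' K" for g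
      proof
        fix k show "(if k \<in> {1..K} then restrict g {1..K} k else b) = g k"
          using that by (cases "k = 0") (auto simp: F'_def F_def not_le)
      qed
      show "restrict (\<lambda>k. if k \<in> {1..K} then g k else b) {1..K} = g" if "g \<in> PiE {1..K} (\<lambda>_. A)" for g
        using that by (auto simp: fun_eq_iff PiE_iff extensional_def)
    qed (auto simp: F'_def F_def)
    have eq: "(\<Prod>k | (if k \<in> {1..K} then g k else b) \<noteq> b. u k (if k \<in> {1..K} then g k else b)) =
        (\<Prod>k = 1..K. u k (g k))" if "\<And>k. k \<ge> 1 \<Longrightarrow> u k b = 1"
      for g and u :: "nat \<Rightarrow> 'a \<Rightarrow> 'd::comm_monoid_mult"
      by (rule prod.mono_neutral_cong_left) (use that in auto)
    have "((\<lambda>g. \<Prod>k = 1..K. f k (g k)) has_sum (\<Prod>k = 1..K. T k)) (PiE {1..K} (\<lambda>_. A)) \<and>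
      ((\<lambda>g. \<Prod>k = 1..K. h k (g k)) has_sum (\<Prod>k = 1..K. H k)) (PiE {1..K} (\<lambda>_. A))"
      by (rule has_sum_prod_PiE) (use f h dom in auto)
    then show ?thesis
      using has_sum_reindex_bij_betw[OF bij, of "\<lambda>g. \<Prod>k | g k \<noteq> b. f k (g k)"]
        has_sum_reindex_bij_betw[OF bij, of "\<lambda>g. \<Prod>k | g k \<noteq> b. h k (g k)"]
      by (simp only: eq base)
  qed
  \<comment> \<open>Finitely many configurations excite only modes up to some \<open>K\<close>, so
    their norms add up to at most the K-th product of the \<open>H k\<close>, hence to at most
    \<open>D\<close>.\<close>
  have "(\<lambda>g. norm (\<Prod>k | g k \<noteq> b. f k (g k))) summable_on F"
  proof (rule nonneg_bdd_above_summable_on)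
    show "bdd_above (sum (\<lambda>g. norm (\<Prod>k | g k \<noteq> b. f k (g k))) ` {X. X \<subseteq> F \<and> finite X})"
    proof (rule bdd_aboveI2)
      fix X assume "X \<in> {X. X \<subseteq> F \<and> finite X}"
      then have X: "X \<subseteq> F" "finite X" by auto
      from X(2,1) have "\<exists>K. X \<subseteq> F' K"
      proof (induction X rule: finite_induct)
        case (insert x X)
        then obtain K M where "X \<subseteq> F' K" "x \<in> F' M" using cover by auto
        then have "insert x X \<subseteq> F' (max K M)" using mono[of K "max K M"] mono[of M "max K M"] by auto
        then show ?case ..
      qed simp
      then obtain K where K: "X \<subseteq> F' K" ..
      have k1: "k \<ge> 1" if "g \<in> F" "g k \<noteq> b" for g k
        using that by (cases k) (auto simp: F_def)
      have hnn: "0 \<le> h k c" if "k \<ge> 1" "c \<in> A" for k c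
        using dom[OF that] order_trans[OF norm_ge_zero] by blast
      have gA: "g k \<in> A" if "g \<in> F" for g k using that by (simp add: F_def)
      have "(\<Sum>g\<in>X. norm (\<Prod>k | g k \<noteq> b. f k (g k))) \<le> (\<Sum>g\<in>X. \<Prod>k | g k \<noteq> b. h k (g k))"
        unfolding prod_norm[symmetric] using X(1) k1 gA
        by (intro sum_mono prod_mono conjI norm_ge_zero dom) blast+
      also have "\<dots> \<le> (\<Prod>k = 1..K. H k)"
      proof (rule finite_sum_le_has_sum[OF _ X(2) K])
        show "0 \<le> (\<Prod>k | g k \<noteq> b. h k (g k))" if "g \<in> F' K - X" for g
          using that k1 gA hnn by (intro prod_nonneg) (auto simp: F'_def)
      qed (use ps in blast)
      also have "\<dots> \<le> D" by (rule bound)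
      finally show "(\<Sum>g\<in>X. norm (\<Prod>k | g k \<noteq> b. f k (g k))) \<le> D" .
    qed
  qed simp
  then have "(\<lambda>g. \<Prod>k | g k \<noteq> b. f k (g k)) summable_on F"
    by (rule abs_summable_summable)
  then obtain S where S: "((\<lambda>g. \<Prod>k | g k \<noteq> b. f k (g k)) has_sum S) F"
    by (auto simp: summable_on_def)
  have "(\<lambda>K. \<Prod>k = 1..K. T k) \<longlonglongrightarrow> S"
    by (rule has_sum_exhaustion[OF S _ mono cover]) (use ps in blast)
  then have "S = L" using lim LIMSEQ_unique by blast
  with S show ?thesis by (simp add: F_def)
qed

section \<open>Matrix entries of the intertwining operators\<close>

text \<open>The coefficient of the monomial \<open>\<mu>\<close> in exp (x_1 X_1 + x_2 X_2 +
  ...).\<close>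

definition mset_weight :: "(nat \<Rightarrow> complex) \<Rightarrow> nat multiset \<Rightarrow> complex" where
  "mset_weight x \<mu> = (\<Prod>k\<in>set_mset \<mu>. x k ^ count \<mu> k / fact (count \<mu> k))"

text \<open>The multivariable analogue of the factorials in \<open>mode_entry\<close>: the
  annihilation exponential from \<open>\<nu>\<close> to \<open>\<mu>\<close> carries the quotient
  \<open>mset_fact \<nu> / mset_fact \<mu>\<close>.\<close>

definition mset_fact :: "nat multiset \<Rightarrow> complex" where
  "mset_fact \<mu> = (\<Prod>k\<in>set_mset \<mu>. fact (count \<mu> k))"

lemma mset_weight_superset:
  "finite S \<Longrightarrow> set_mset \<mu> \<subseteq> S \<Longrightarrow> mset_weight x \<mu> = (\<Prod>k\<in>S. x k ^ count \<mu> k / fact (count \<mu> k))"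
  unfolding mset_weight_def by (rule prod.mono_neutral_left) (auto simp: not_in_iff)

lemma mset_fact_superset:
  "finite S \<Longrightarrow> set_mset \<mu> \<subseteq> S \<Longrightarrow> mset_fact \<mu> = (\<Prod>k\<in>S. fact (count \<mu> k))"
  unfolding mset_fact_def by (rule prod.mono_neutral_left) (auto simp: not_in_iff)

lemma mset_fact_nonzero: "mset_fact \<mu> \<noteq> 0"
  by (simp add: mset_fact_def)

lemma mset_fact_add: "mset_fact (add_mset k \<mu>) = of_nat (count \<mu> k + 1) * mset_fact \<mu>"
proof -
  let ?S = "insert k (set_mset \<mu>)"
  have "mset_fact (add_mset k \<mu>) = fact (count \<mu> k + 1) * (\<Prod>j\<in>?S - {k}. fact (count \<mu> j))"
    by (subst mset_fact_superset[of ?S]) (auto simp: prod.remove[of ?S k] intro!: prod.cong)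
  moreover have "mset_fact \<mu> = fact (count \<mu> k) * (\<Prod>j\<in>?S - {k}. fact (count \<mu> j))"
    by (subst mset_fact_superset[of ?S]) (auto simp: prod.remove[of ?S k])
  ultimately show ?thesis by simp
qed

lemma mset_weight_add: "x k * mset_weight x \<mu> = of_nat (count \<mu> k + 1) * mset_weight x (add_mset k \<mu>)"
proof -
  let ?S = "insert k (set_mset \<mu>)"
  let ?P = "\<Prod>j\<in>?S - {k}. x j ^ count \<mu> j / fact (count \<mu> j)"
  have "mset_weight x (add_mset k \<mu>) = x k ^ (count \<mu> k + 1) / fact (count \<mu> k + 1) * ?P"
    by (subst mset_weight_superset[of ?S]) (auto simp: prod.remove[of ?S k] intro!: prod.cong)
  moreover have "mset_weight x \<mu> = x k ^ count \<mu> k / fact (count \<mu> k) * ?P"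
    by (subst mset_weight_superset[of ?S]) (auto simp: prod.remove[of ?S k])
  moreover have "of_nat (Suc c) * (u ^ Suc c / fact (Suc c)) = u * (u ^ c / fact c)" for c and u :: complex
  proof -
    have "of_nat (Suc c) \<noteq> (0 :: complex)" by (rule of_nat_neq_0)
    then show ?thesis unfolding fact_Suc by (simp del: of_nat_Suc add: field_simps)
  qed
  ultimately show ?thesis by (simp only: Suc_eq_plus1[symmetric] mult.assoc[symmetric])
qed

text \<open>
  Euler's identity for the homogeneous degree; by induction it evaluates the powers of a sum of
  commuting modes.
\<close>

lemma mset_weight_derivation:
  "(\<Sum>k\<in>set_mset \<mu>. x k * mset_weight x (\<mu> - {#k#})) = of_nat (size \<mu>) * mset_weight x \<mu>"
proof -
  have "x k * mset_weight x (\<mu> - {#k#}) = of_nat (count \<mu> k) * mset_weight x \<mu>" if "k \<in># \<mu>" for k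
    using mset_weight_add[of x k "\<mu> - {#k#}"] that by (simp add: insert_DiffM)
  then show ?thesis
    by (simp add: size_multiset_overloaded_eq sum_distrib_right)
qed

section \<open>Exponentials of operators in coordinates\<close>

lemma op_exp_diagonal:
  assumes "\<And>f. A f s = c * f s"
  shows "op_exp A f s = exp c * f s"
proof -
  have pow: "(A ^^ k) f s = c ^ k * f s" for k
    by (induction k) (simp_all add: assms)
  have "((\<lambda>k. c ^ k / fact k * f s) has_sum (exp (c) * f s)) UNIV"
    by (intro has_sum_cmult_left exp_has_sum)
  then show ?thesis
    unfolding op_exp_def pow by (intro infsumI) simp
qed

text \<open>Meant for an operator that shifts the degree by one, applied to a basis vector: a given
  coordinate is then reached by a single power.\<close>

lemma op_exp_single:
  assumes "\<And>k. k \<noteq> m \<Longrightarrow> (A ^^ k) f s = 0"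
  shows "op_exp A f s = (A ^^ m) f s / fact m"
  unfolding op_exp_def
  by (rule infsumI, rule has_sum_finite_neutralI[where B="{m}"]) (use assms in auto)

lemma sum_mset_count:
  "finite S \<Longrightarrow> set_mset \<mu> \<subseteq> S \<Longrightarrow> sum_mset \<mu> = (\<Sum>k\<in>S. k * count \<mu> k)" for \<mu> :: "nat multiset"
proof (induction \<mu>)
  case (add a \<mu>)
  have "(\<Sum>k\<in>S. k * count (add_mset a \<mu>) k) = (\<Sum>k\<in>S. k * count \<mu> k + (if k = a then a else 0))"
    by (intro sum.cong) auto
  also have "\<dots> = (\<Sum>k\<in>S. k * count \<mu> k) + a"
    using add.prems by (simp add: sum.distrib)
  finally show ?case using add by simp
qed simp

text \<open>Normal ordering makes the terms m and -m equal, which cancels the factor 1/2 and leaves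
  the degree; the term a(0)^2 remains halved.\<close>

lemma virasoro_0: "virasoro 0 f (\<gamma>, \<mu>) = (\<gamma>\<^sup>2 / 2 + of_nat (sum_mset \<mu>)) * f (\<gamma>, \<mu>)"
proof -
  let ?F = "\<lambda>m::int. heis (min m (0 - m)) (heis (max m (0 - m)) f) (\<gamma>, \<mu>)"
  let ?t = "\<lambda>k. of_nat k * of_nat (count \<mu> k) * f (\<gamma>, \<mu>)"
  \<comment> \<open>An arbitrary multiset may contain the label 0. Removing it keeps the positive
    and the negative range apart from m = 0 and does not change the degree.\<close>
  let ?D = "set_mset \<mu> - {0}"
  have pos: "?F (int k) = ?t k" and neg: "?F (- int k) = ?t k" if "k > 0" for k
  proof -
    have "heis (- int k) (heis (int k) f) (\<gamma>, \<mu>) = ?t k"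
      using that by (auto simp: heis_def insert_DiffM not_in_iff)
    then show "?F (int k) = ?t k" "?F (- int k) = ?t k" using that by (simp_all add: min_def max_def)
  qed
  have F0: "?F 0 = \<gamma>\<^sup>2 * f (\<gamma>, \<mu>)" by (simp add: heis_def power2_eq_square)
  let ?B = "insert 0 (int ` ?D \<union> (\<lambda>k. - int k) ` ?D)"
  have "(?F has_sum (\<Sum>m\<in>?B. ?F m)) UNIV"
  proof (rule has_sum_finite_neutralI)
    fix m :: int assume m: "m \<in> UNIV - ?B"
    obtain k where k: "m = int k \<or> m = - int k" by (metis int_cases2)
    with m have "k > 0" "k \<notin># \<mu>" by (auto simp: image_iff intro: gr0I)
    then show "?F m = 0" using k pos[of k] neg[of k] by (auto simp: not_in_iff)
  qed auto
  moreover have "(\<Sum>m\<in>?B. ?F m) = ?F 0 + ((\<Sum>m\<in>int ` ?D. ?F m) + (\<Sum>m\<in>(\<lambda>k. - int k) ` ?D. ?F m))"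
    by (subst sum.insert, simp, force, subst sum.union_disjoint) auto
  moreover have "(\<Sum>m\<in>int ` ?D. ?F m) = (\<Sum>k\<in>?D. ?t k)"
    by (subst sum.reindex, simp, unfold o_def, rule sum.cong[OF refl], rule pos) auto
  moreover have "(\<Sum>m\<in>(\<lambda>k. - int k) ` ?D. ?F m) = (\<Sum>k\<in>?D. ?t k)"
    by (subst sum.reindex, simp add: inj_on_def, unfold o_def, rule sum.cong[OF refl], rule neg) auto
  moreover have "(\<Sum>k\<in>?D. ?t k) = of_nat (sum_mset \<mu>) * f (\<gamma>, \<mu>)"
  proof -
    have "sum_mset \<mu> = (\<Sum>k\<in>set_mset \<mu>. k * count \<mu> k)"
      by (rule sum_mset_count) auto
    also have "\<dots> = (\<Sum>k\<in>?D. k * count \<mu> k)"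
      by (rule sum.mono_neutral_right) auto
    finally show ?thesis by (simp add: sum_distrib_right)
  qed
  ultimately have "(?F has_sum (\<gamma>\<^sup>2 * f (\<gamma>, \<mu>) + 2 * (of_nat (sum_mset \<mu>) * f (\<gamma>, \<mu>)))) UNIV"
    using F0 by simp
  then have "infsum ?F UNIV = \<gamma>\<^sup>2 * f (\<gamma>, \<mu>) + 2 * (of_nat (sum_mset \<mu>) * f (\<gamma>, \<mu>))"
    by (rule infsumI)
  then show ?thesis unfolding virasoro_def by (simp add: algebra_simps)
qed

lemma creation_sum:
  "\<alpha> * (\<Sum>\<^sub>\<infinity>n\<in>{1 :: nat..}. heis (- int n) f (\<gamma>, \<mu>) / of_nat n * z powi int n) =
    (\<Sum>k\<in>set_mset \<mu>. \<alpha> * z ^ k / of_nat k * f (\<gamma>, \<mu> - {#k#}))"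
proof -
  let ?t = "\<lambda>n. heis (- int n) f (\<gamma>, \<mu>) / of_nat n * z powi int n"
  have "(?t has_sum (\<Sum>n\<in>set_mset \<mu> - {0}. ?t n)) {1..}"
  proof (rule has_sum_finite_neutralI)
    show "?t n = 0" if "n \<in> {1..} - (set_mset \<mu> - {0})" for n
      using that by (auto simp: heis_def)
  qed auto
  then have "(\<Sum>\<^sub>\<infinity>n\<in>{1..}. ?t n) = (\<Sum>n\<in>set_mset \<mu> - {0}. ?t n)"
    by (rule infsumI)
  then have "\<alpha> * (\<Sum>\<^sub>\<infinity>n\<in>{1..}. ?t n) = (\<Sum>n\<in>set_mset \<mu> - {0}. \<alpha> * ?t n)"
    by (simp add: sum_distrib_left)
  \<comment> \<open>A label 0 may be added to the range: its coefficient has denominator 0 and so is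
    0.\<close>
  also have "\<dots> = (\<Sum>k\<in>set_mset \<mu>. \<alpha> * z ^ k / of_nat k * f (\<gamma>, \<mu> - {#k#}))"
    by (rule sum.mono_neutral_cong_left) (auto simp: heis_def)
  finally show ?thesis .
qed

lemma finite_submultisets: "finite {\<rho>. \<rho> \<subseteq># (\<mu> :: 'a multiset)}"
proof (induction \<mu>)
  case (add k \<mu>)
  have "{\<rho>. \<rho> \<subseteq># add_mset k \<mu>} \<subseteq> {\<rho>. \<rho> \<subseteq># \<mu>} \<union> add_mset k ` {\<rho>. \<rho> \<subseteq># \<mu>}"
  proof
    fix \<rho> assume "\<rho> \<in> {\<rho>. \<rho> \<subseteq># add_mset k \<mu>}"
    then have r: "\<rho> \<subseteq># add_mset k \<mu>" by simp
    show "\<rho> \<in> {\<rho>. \<rho> \<subseteq># \<mu>} \<union> add_mset k ` {\<rho>. \<rho> \<subseteq># \<mu>}"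
    proof (cases "k \<in># \<rho>")
      case True
      then obtain \<sigma> where "\<rho> = add_mset k \<sigma>" by (meson multi_member_split)
      with r show ?thesis by auto
    next
      case False
      have "\<rho> \<subseteq># \<mu>"
      proof (rule mset_subset_eqI)
        fix a show "count \<rho> a \<le> count \<mu> a"
          using mset_subset_eq_count[OF r, of a] False by (cases "a = k") (auto simp: not_in_iff)
      qed
      then show ?thesis by auto
    qed
  qed
  then show ?case using add finite_subset by blast
qed simp

text \<open>The m-th power of the exponent removes m labels from \<open>\<mu>\<close> one after the
  other. Euler's identity counts the orders of removal, and the division by m! leaves one weight for
  each remaining submultiset.\<close>

lemma Y_minus_apply:
  "Y_minus \<alpha> z f (\<gamma>, \<mu>) =
    (\<Sum>\<rho> | \<rho> \<subseteq># \<mu>. mset_weight (\<lambda>k. \<alpha> * z ^ k / of_nat k) (\<mu> - \<rho>) * f (\<gamma>, \<rho>))"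
proof -
  define x where "x = (\<lambda>k. \<alpha> * z ^ k / of_nat k)"
  define A where "A = (\<lambda>f s. \<alpha> * (\<Sum>\<^sub>\<infinity>n\<in>{1 :: nat..}. heis (- int n) f s / of_nat n * z powi int n))"
  have A: "A f (\<gamma>, \<mu>) = (\<Sum>k\<in>set_mset \<mu>. x k * f (\<gamma>, \<mu> - {#k#}))" for f \<gamma> \<mu>
    unfolding A_def x_def by (rule creation_sum)
  have pow: "(A ^^ m) f (\<gamma>, \<mu>) = fact m * (\<Sum>\<rho> | \<rho> \<subseteq># \<mu> \<and> size (\<mu> - \<rho>) = m. mset_weight x (\<mu> - \<rho>) * f (\<gamma>, \<rho>))"
    for m \<mu>
  proof (induction m arbitrary: \<mu>)
    case 0
    have "{\<rho>. \<rho> \<subseteq># \<mu> \<and> size (\<mu> - \<rho>) = 0} = {\<mu>}"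
      by (auto simp: Diff_eq_empty_iff_mset intro: subset_mset.antisym)
    then show ?case by (simp add: mset_weight_def)
  next
    case (Suc m)
    let ?R = "\<lambda>\<mu> m. {\<rho>. \<rho> \<subseteq># \<mu> \<and> size (\<mu> - \<rho>) = m}"
    have fin: "finite (?R \<mu> m)" for \<mu> m
      by (rule finite_subset[OF _ finite_submultisets[of \<mu>]]) auto
    have rm: "k \<in># \<mu> \<and> \<rho> \<subseteq># \<mu> - {#k#} \<and> size (\<mu> - {#k#} - \<rho>) = m \<longleftrightarrow>
        \<rho> \<subseteq># \<mu> \<and> size (\<mu> - \<rho>) = Suc m \<and> k \<in># \<mu> - \<rho>" for k \<rho>
    proof
      assume L: "k \<in># \<mu> \<and> \<rho> \<subseteq># \<mu> - {#k#} \<and> size (\<mu> - {#k#} - \<rho>) = m"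
      then obtain \<nu> where \<nu>: "\<mu> = add_mset k \<nu>" by (meson multi_member_split)
      with L have "\<rho> \<subseteq># \<nu>" "size (\<nu> - \<rho>) = m" by auto
      moreover from this have "add_mset k \<nu> - \<rho> = add_mset k (\<nu> - \<rho>)"
        by (intro multiset_eqI) (auto simp: subseteq_mset_def Suc_diff_le)
      ultimately show "\<rho> \<subseteq># \<mu> \<and> size (\<mu> - \<rho>) = Suc m \<and> k \<in># \<mu> - \<rho>"
        using \<nu> by (auto intro: subset_mset.order_trans)
    next
      assume R: "\<rho> \<subseteq># \<mu> \<and> size (\<mu> - \<rho>) = Suc m \<and> k \<in># \<mu> - \<rho>"
      then obtain \<sigma> where \<sigma>: "\<mu> - \<rho> = add_mset k \<sigma>" by (meson multi_member_split)
      with R have "\<mu> = add_mset k \<sigma> + \<rho>" by (metis subset_mset.diff_add)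
      with R \<sigma> show "k \<in># \<mu> \<and> \<rho> \<subseteq># \<mu> - {#k#} \<and> size (\<mu> - {#k#} - \<rho>) = m" by auto
    qed
    \<comment> \<open>Removing \<open>k\<close> first and then descending to \<open>\<rho>\<close>,
      or fixing \<open>\<rho>\<close> first and then choosing \<open>k\<close> from the rest, gives
      the same pairs.\<close>
    have swap: "(k, \<rho>) \<in> Sigma (set_mset \<mu>) (\<lambda>k. ?R (\<mu> - {#k#}) m) \<longleftrightarrow>
        (\<rho>, k) \<in> Sigma (?R \<mu> (Suc m)) (\<lambda>\<rho>. set_mset (\<mu> - \<rho>))" for k \<rho>
      unfolding mem_Sigma_iff mem_Collect_eq using rm[of k \<rho>] by argo
    have "(A ^^ Suc m) f (\<gamma>, \<mu>) = (\<Sum>k\<in>set_mset \<mu>. x k * (fact m *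
        (\<Sum>\<rho>\<in>?R (\<mu> - {#k#}) m. mset_weight x (\<mu> - {#k#} - \<rho>) * f (\<gamma>, \<rho>))))"
      by (simp add: A Suc.IH)
    also have "\<dots> = fact m * (\<Sum>k\<in>set_mset \<mu>. \<Sum>\<rho>\<in>?R (\<mu> - {#k#}) m.
        x k * mset_weight x (\<mu> - \<rho> - {#k#}) * f (\<gamma>, \<rho>))"
      by (simp add: sum_distrib_left mult_ac diff_diff_add_mset add.commute)
    also have "(\<Sum>k\<in>set_mset \<mu>. \<Sum>\<rho>\<in>?R (\<mu> - {#k#}) m. x k * mset_weight x (\<mu> - \<rho> - {#k#}) * f (\<gamma>, \<rho>)) =
        (\<Sum>(k, \<rho>)\<in>Sigma (set_mset \<mu>) (\<lambda>k. ?R (\<mu> - {#k#}) m). x k * mset_weight x (\<mu> - \<rho> - {#k#}) * f (\<gamma>, \<rho>))"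
      by (rule sum.Sigma) (simp, intro ballI fin)
    also have "\<dots> = (\<Sum>(\<rho>, k)\<in>Sigma (?R \<mu> (Suc m)) (\<lambda>\<rho>. set_mset (\<mu> - \<rho>)). x k * mset_weight x (\<mu> - \<rho> - {#k#}) * f (\<gamma>, \<rho>))"
      by (rule sum.reindex_bij_witness[where i="\<lambda>(\<rho>, k). (k, \<rho>)" and j="\<lambda>(k, \<rho>). (\<rho>, k)"])
        (simp_all only: split_paired_all prod.case swap)
    also have "\<dots> = (\<Sum>\<rho>\<in>?R \<mu> (Suc m). \<Sum>k\<in>set_mset (\<mu> - \<rho>). x k * mset_weight x (\<mu> - \<rho> - {#k#}) * f (\<gamma>, \<rho>))"
      by (rule sum.Sigma[symmetric]) (rule fin, simp)
    \<comment> \<open>Euler's identity for \<open>\<mu> - \<rho>\<close>, of size Suc m; this factor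
      completes \<open>fact m\<close> to \<open>fact (Suc m)\<close>.\<close>
    also have "\<dots> = (\<Sum>\<rho>\<in>?R \<mu> (Suc m). of_nat (Suc m) * (mset_weight x (\<mu> - \<rho>) * f (\<gamma>, \<rho>)))"
      by (rule sum.cong[OF refl])
        (simp only: sum_distrib_right[symmetric] mset_weight_derivation mem_Collect_eq, simp only: mult.assoc)
    also have "fact m * \<dots> = fact (Suc m) * (\<Sum>\<rho>\<in>?R \<mu> (Suc m). mset_weight x (\<mu> - \<rho>) * f (\<gamma>, \<rho>))"
      by (simp only: sum_distrib_left[symmetric] fact_Suc of_nat_mult of_nat_fact, simp only: mult_ac)
    finally show ?case .
  qed
  let ?T = "\<lambda>\<rho>. mset_weight x (\<mu> - \<rho>) * f (\<gamma>, \<rho>)"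
  have "((\<lambda>m. (A ^^ m) f (\<gamma>, \<mu>) / fact m) has_sum
      (\<Sum>m\<le>size \<mu>. (A ^^ m) f (\<gamma>, \<mu>) / fact m)) UNIV"
  proof (rule has_sum_finite_neutralI)
    fix m assume "m \<in> UNIV - {..size \<mu>}"
    moreover have "size (\<mu> - \<rho>) \<le> size \<mu>" for \<rho> by (rule size_mset_mono) simp
    ultimately have "{\<rho>. \<rho> \<subseteq># \<mu> \<and> size (\<mu> - \<rho>) = m} = {}" by fastforce
    then show "(A ^^ m) f (\<gamma>, \<mu>) / fact m = 0"
      by (simp only: pow sum.empty mult_zero_right div_0)
  qed auto
  also have "(\<Sum>m\<le>size \<mu>. (A ^^ m) f (\<gamma>, \<mu>) / fact m) =
      (\<Sum>m\<le>size \<mu>. \<Sum>\<rho> | \<rho> \<in> {\<rho>. \<rho> \<subseteq># \<mu>} \<and> size (\<mu> - \<rho>) = m. ?T \<rho>)"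
    by (simp add: pow)
  also have "\<dots> = (\<Sum>\<rho> | \<rho> \<subseteq># \<mu>. ?T \<rho>)"
    by (rule sum.group) (auto simp: finite_submultisets intro: size_mset_mono)
  finally show ?thesis
    unfolding Y_minus_def op_exp_def A_def[symmetric] x_def[symmetric] by (rule infsumI)
qed

text \<open>The factor n of a(n) = n d/dX_n cancels the 1/n of the exponent, so only creation
  parameters keep a denominator.\<close>

lemma annihilation_sum:
  "- \<alpha> * (\<Sum>\<^sub>\<infinity>n\<in>{1 :: nat..}. heis (int n) f (\<gamma>, \<mu>) / of_nat n * z powi (- int n)) =
    (\<Sum>\<^sub>\<infinity>n\<in>{1..}. - \<alpha> / z ^ n * of_nat (count \<mu> n + 1) * f (\<gamma>, add_mset n \<mu>))"
proof -
  have "- \<alpha> * (\<Sum>\<^sub>\<infinity>n\<in>{1 :: nat..}. heis (int n) f (\<gamma>, \<mu>) / of_nat n * z powi (- int n)) =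
    (\<Sum>\<^sub>\<infinity>n\<in>{1 :: nat..}. - \<alpha> * (heis (int n) f (\<gamma>, \<mu>) / of_nat n * z powi (- int n)))"
    by (rule infsum_cmult_right'[symmetric])
  also have "\<dots> = (\<Sum>\<^sub>\<infinity>n\<in>{1..}. - \<alpha> / z ^ n * of_nat (count \<mu> n + 1) * f (\<gamma>, add_mset n \<mu>))"
  proof (rule infsum_cong)
    fix n :: nat assume "n \<in> {1..}"
    then have h: "heis (int n) f (\<gamma>, \<mu>) = of_nat n * (of_nat (count \<mu> n + 1) * f (\<gamma>, add_mset n \<mu>))"
      and "n > 0" by (auto simp: heis_def)
    then show "- \<alpha> * (heis (int n) f (\<gamma>, \<mu>) / of_nat n * z powi (- int n)) =
        - \<alpha> / z ^ n * of_nat (count \<mu> n + 1) * f (\<gamma>, add_mset n \<mu>)"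
      unfolding h by (simp add: power_int_minus divide_inverse mult_ac del: of_nat_add of_nat_Suc)
  qed
  finally show ?thesis .
qed

text \<open>On a multiple of a basis vector the infinite sum over modes is finite: only labels of
  \<open>\<nu> - \<mu>\<close> can still be annihilated, and they lie in the range n >= 1 of the
  exponent because \<open>\<nu>\<close> has no label 0. The constant \<open>C\<close> makes room for
  the zero mode factor.\<close>

lemma Y_plus_ket:
  assumes "0 \<notin># \<nu>"
  shows "Y_plus \<alpha> z (\<lambda>t. C * ket (\<gamma>, \<nu>) t) (\<gamma>', \<mu>) =
    (if \<gamma>' = \<gamma> \<and> \<mu> \<subseteq># \<nu> then C * mset_weight (\<lambda>k. - \<alpha> / z ^ k) (\<nu> - \<mu>) * mset_fact \<nu> / mset_fact \<mu> else 0)"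
proof -
  define y where "y = (\<lambda>k. - \<alpha> / z ^ k)"
  define A where "A = (\<lambda>f s. - \<alpha> * (\<Sum>\<^sub>\<infinity>n\<in>{1 :: nat..}. heis (int n) f s / of_nat n * z powi (- int n)))"
  define W where "W \<mu> = C * mset_weight y (\<nu> - \<mu>) * mset_fact \<nu> / mset_fact \<mu>" for \<mu>
  let ?f = "\<lambda>t. C * ket (\<gamma>, \<nu>) t"
  have A: "A f (\<gamma>', \<mu>) = (\<Sum>\<^sub>\<infinity>n\<in>{1..}. y n * of_nat (count \<mu> n + 1) * f (\<gamma>', add_mset n \<mu>))" for f \<gamma>' \<mu>
    unfolding A_def y_def by (rule annihilation_sum)
  have pow: "(A ^^ m) ?f (\<gamma>', \<mu>) = (if \<gamma>' = \<gamma> \<and> \<mu> \<subseteq># \<nu> \<and> size (\<nu> - \<mu>) = m then fact m * W \<mu> else 0)"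
    for m \<mu>
  proof (induction m arbitrary: \<mu>)
    case 0
    have "\<mu> \<subseteq># \<nu> \<and> size (\<nu> - \<mu>) = 0 \<longleftrightarrow> \<mu> = \<nu>"
      by (auto simp: Diff_eq_empty_iff_mset intro: subset_mset.antisym)
    then show ?case
      by (auto simp: ket_def W_def mset_weight_def mset_fact_nonzero)
  next
    case (Suc m)
    have rm: "add_mset n \<mu> \<subseteq># \<nu> \<and> size (\<nu> - add_mset n \<mu>) = m \<longleftrightarrow>
        \<mu> \<subseteq># \<nu> \<and> size (\<nu> - \<mu>) = Suc m \<and> n \<in># \<nu> - \<mu>" for n
    proof
      assume L: "add_mset n \<mu> \<subseteq># \<nu> \<and> size (\<nu> - add_mset n \<mu>) = m"
      then obtain \<sigma> where "\<nu> = add_mset n \<mu> + \<sigma>" by (metis subset_mset.less_eqE)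
      then show "\<mu> \<subseteq># \<nu> \<and> size (\<nu> - \<mu>) = Suc m \<and> n \<in># \<nu> - \<mu>" using L by auto
    next
      assume R: "\<mu> \<subseteq># \<nu> \<and> size (\<nu> - \<mu>) = Suc m \<and> n \<in># \<nu> - \<mu>"
      then obtain \<sigma> where \<sigma>: "\<nu> - \<mu> = add_mset n \<sigma>" by (meson multi_member_split)
      with R have "\<nu> = add_mset n \<sigma> + \<mu>" by (metis subset_mset.diff_add)
      with R \<sigma> show "add_mset n \<mu> \<subseteq># \<nu> \<and> size (\<nu> - add_mset n \<mu>) = m" by auto
    qed
    let ?t = "\<lambda>n. y n * of_nat (count \<mu> n + 1) * (A ^^ m) ?f (\<gamma>', add_mset n \<mu>)"
    show ?case
    proof (cases "\<gamma>' = \<gamma> \<and> \<mu> \<subseteq># \<nu> \<and> size (\<nu> - \<mu>) = Suc m")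
      case False
      then have "?t n = 0" for n using rm[of n] by (auto simp: Suc.IH)
      then have "infsum ?t {1..} = 0" by (intro infsum_0)
      then show ?thesis using False by (auto simp only: funpow.simps o_def A if_False)
    next
      case True
      have t: "?t n = (if n \<in># \<nu> - \<mu> then fact m * (C * mset_fact \<nu> / mset_fact \<mu>) *
          (y n * mset_weight y (\<nu> - \<mu> - {#n#})) else 0)" for n
      proof (cases "n \<in># \<nu> - \<mu>")
        case n: True
        then have "(A ^^ m) ?f (\<gamma>', add_mset n \<mu>) = fact m * W (add_mset n \<mu>)"
          unfolding Suc.IH using True rm[of n] by simp
        moreover have "of_nat (count \<mu> n + 1) \<noteq> (0 :: complex)"
          by (metis Suc_eq_plus1 of_nat_neq_0)
        moreover have "u * c * (F * (C * w * N / (c * M))) = F * (C * N / M) * (u * w)"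
          if "c \<noteq> 0" "M \<noteq> 0" for u c F w N M :: complex
          using that by (simp add: field_simps)
        ultimately show ?thesis using n mset_fact_nonzero[of \<mu>]
          by (simp only: W_def mset_fact_add diff_diff_add_mset[symmetric] if_True
              not_False_eq_True) simp
      qed (use rm[of n] in \<open>auto simp: Suc.IH\<close>)
      have "(?t has_sum (\<Sum>n\<in>set_mset (\<nu> - \<mu>). ?t n)) {1..}"
      proof (rule has_sum_finite_neutralI)
        show "set_mset (\<nu> - \<mu>) \<subseteq> {1..}"
        proof
          fix k assume "k \<in># \<nu> - \<mu>"
          then have "k \<noteq> 0" using assms by (metis in_diffD)
          then show "k \<in> {1..}" by simp
        qed
        show "?t n = 0" if "n \<in> {1..} - set_mset (\<nu> - \<mu>)" for n
          using that unfolding t by simp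
      qed auto
      then have "(A ^^ Suc m) ?f (\<gamma>', \<mu>) = (\<Sum>n\<in>set_mset (\<nu> - \<mu>). ?t n)"
        by (simp only: funpow.simps o_def A infsumI)
      also have "\<dots> = (\<Sum>n\<in>set_mset (\<nu> - \<mu>). fact m * (C * mset_fact \<nu> / mset_fact \<mu>) *
          (y n * mset_weight y (\<nu> - \<mu> - {#n#})))"
        unfolding t by (rule sum.cong[OF refl]) (simp only: if_True)
      also have "\<dots> = fact m * (C * mset_fact \<nu> / mset_fact \<mu>) * (of_nat (Suc m) * mset_weight y (\<nu> - \<mu>))"
        using True by (simp only: sum_distrib_left[symmetric] mset_weight_derivation)
      also have "\<dots> = fact (Suc m) * W \<mu>"
        by (simp add: W_def field_simps)
      finally show ?thesis using True by simp
    qed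
  qed
  have Y: "Y_plus \<alpha> z ?f (\<gamma>', \<mu>) = op_exp A ?f (\<gamma>', \<mu>)"
    by (simp only: Y_plus_def A_def)
  show ?thesis
  proof (cases "\<gamma>' = \<gamma> \<and> \<mu> \<subseteq># \<nu>")
    case True
    have "op_exp A ?f (\<gamma>', \<mu>) = (A ^^ size (\<nu> - \<mu>)) ?f (\<gamma>', \<mu>) / fact (size (\<nu> - \<mu>))"
      by (rule op_exp_single) (auto simp: pow)
    then show ?thesis
      using True unfolding Y pow W_def y_def by simp
  next
    case False
    then have "op_exp A ?f (\<gamma>', \<mu>) = (A ^^ 0) ?f (\<gamma>', \<mu>) / fact 0"
      by (intro op_exp_single) (simp only: pow, auto)
    then show ?thesis
      using False unfolding Y pow by auto
  qed
qed

text \<open>A submultiset of \<open>\<mu>\<close> is a choice of one multiplicity per label, so the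
  sum over submultisets is an expanded product. \<open>S\<close> may be any finite set containing
  both supports, so that later one \<open>S\<close> serves all steps of a path.\<close>

lemma mode_factorization:
  assumes S: "finite S" "set_mset \<mu> \<subseteq> S" "set_mset \<nu> \<subseteq> S"
  shows "(\<Sum>\<rho> | \<rho> \<subseteq># \<mu>. mset_weight x (\<mu> - \<rho>) *
      (if \<rho> \<subseteq># \<nu> then mset_weight y (\<nu> - \<rho>) * mset_fact \<nu> / mset_fact \<rho> else 0)) =
    (\<Prod>k\<in>S. mode_entry (x k) (y k) (count \<mu> k) (count \<nu> k))"
proof -
  let ?e = "\<lambda>k j. creation_entry (x k) (count \<mu> k) j *
      (creation_entry (y k) (count \<nu> k) j * fact (count \<nu> k) / fact j)"
  let ?P = "PiE S (\<lambda>k. {..count \<mu> k})"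
  have "(\<Prod>k\<in>S. mode_entry (x k) (y k) (count \<mu> k) (count \<nu> k)) = (\<Sum>p\<in>?P. \<Prod>k\<in>S. ?e k (p k))"
    unfolding mode_entry_def by (rule prod_sum_PiE) (use S in auto)
  also have "\<dots> = (\<Sum>\<rho> | \<rho> \<subseteq># \<mu>. \<Prod>k\<in>S. ?e k (count \<rho> k))"
  proof (rule sum.reindex_bij_witness[where j="\<lambda>p. Abs_multiset (\<lambda>k. if k \<in> S then p k else 0)"
        and i="\<lambda>\<rho>. restrict (count \<rho>) S"])
    fix p assume p: "p \<in> ?P"
    have "finite {k. (if k \<in> S then p k else 0) > 0}"
      by (rule finite_subset[OF _ S(1)]) auto
    then have c: "count (Abs_multiset (\<lambda>k. if k \<in> S then p k else 0)) = (\<lambda>k. if k \<in> S then p k else 0)"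
      by (rule count_Abs_multiset)
    show "restrict (count (Abs_multiset (\<lambda>k. if k \<in> S then p k else 0))) S = p"
      using p unfolding c by (auto simp: PiE_iff extensional_def fun_eq_iff)
    show "Abs_multiset (\<lambda>k. if k \<in> S then p k else 0) \<in> {\<rho>. \<rho> \<subseteq># \<mu>}"
      using p by (auto simp: subseteq_mset_def c PiE_iff)
    show "(\<Prod>k\<in>S. ?e k (count (Abs_multiset (\<lambda>k. if k \<in> S then p k else 0)) k)) = (\<Prod>k\<in>S. ?e k (p k))"
      unfolding c by (rule prod.cong) auto
  next
    fix \<rho> assume "\<rho> \<in> {\<rho>. \<rho> \<subseteq># \<mu>}"
    then have r: "\<And>k. count \<rho> k \<le> count \<mu> k" by (simp add: subseteq_mset_def)
    then show "restrict (count \<rho>) S \<in> ?P" by auto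
    have "count \<rho> k = 0" if "k \<notin> S" for k
      using r[of k] that S(2) by (metis le_zero_eq not_in_iff subsetD)
    then have "(\<lambda>k. if k \<in> S then restrict (count \<rho>) S k else 0) = count \<rho>" by auto
    then show "Abs_multiset (\<lambda>k. if k \<in> S then restrict (count \<rho>) S k else 0) = \<rho>"
      by (simp only: count_inverse)
  qed
  also have "\<dots> = (\<Sum>\<rho> | \<rho> \<subseteq># \<mu>. mset_weight x (\<mu> - \<rho>) *
      (if \<rho> \<subseteq># \<nu> then mset_weight y (\<nu> - \<rho>) * mset_fact \<nu> / mset_fact \<rho> else 0))"
  proof (rule sum.cong[OF refl])
    fix \<rho> assume "\<rho> \<in> {\<rho>. \<rho> \<subseteq># \<mu>}"
    then have r: "\<rho> \<subseteq># \<mu>" by simp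
    then have rk: "count \<rho> k \<le> count \<mu> k" for k by (simp add: subseteq_mset_def)
    have rS: "set_mset \<rho> \<subseteq> S" using r S(2) set_mset_mono by blast
    have wx: "mset_weight x (\<mu> - \<rho>) = (\<Prod>k\<in>S. creation_entry (x k) (count \<mu> k) (count \<rho> k))"
      using S rk by (subst mset_weight_superset[of S]) (auto simp: creation_entry_def dest: in_diffD)
    show "(\<Prod>k\<in>S. ?e k (count \<rho> k)) = mset_weight x (\<mu> - \<rho>) *
        (if \<rho> \<subseteq># \<nu> then mset_weight y (\<nu> - \<rho>) * mset_fact \<nu> / mset_fact \<rho> else 0)"
    proof (cases "\<rho> \<subseteq># \<nu>")
      case True
      then have rn: "count \<rho> k \<le> count \<nu> k" for k by (simp add: subseteq_mset_def)
      have "mset_weight y (\<nu> - \<rho>) = (\<Prod>k\<in>S. creation_entry (y k) (count \<nu> k) (count \<rho> k))"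
        using S rn by (subst mset_weight_superset[of S]) (auto simp: creation_entry_def dest: in_diffD)
      then show ?thesis
        using True S rS by (simp add: wx mset_fact_superset[of S] prod.distrib prod_dividef)
    next
      \<comment> \<open>If \<open>\<rho>\<close> exceeds \<open>\<nu>\<close> at some label, the
        annihilation entry of that label vanishes.\<close>
      case False
      then obtain k where k: "count \<nu> k < count \<rho> k" by (auto simp: subseteq_mset_def not_le)
      then have "k \<in> S" using rS by (metis count_eq_zero_iff not_less_zero subsetD)
      moreover have "?e k (count \<rho> k) = 0" using k by (simp add: creation_entry_def)
      ultimately have "(\<Prod>k\<in>S. ?e k (count \<rho> k)) = 0" using S(1) by (meson prod_zero)
      then show ?thesis using False by simp
    qed
  qed
  finally show ?thesis by simp
qed

text \<open>The factor exp (z \<beta>^2 / 2) comes from the conformal weight \<beta>^2 / 2 of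
  e^\<beta>, and exp (\<beta> z \<gamma>) from the zero mode acting on charge \<gamma>.\<close>

lemma intertwiner_entry:
  assumes "0 \<notin># \<nu>" and S: "finite S" "set_mset \<mu> \<subseteq> S" "set_mset \<nu> \<subseteq> S"
  shows "intertwiner (op_exp (\<lambda>f s. z * virasoro 0 f s) (e_vec \<beta>)) z (ket (\<gamma>, \<nu>)) (\<gamma>', \<mu>) =
    (if \<gamma>' = \<gamma> + \<beta> then exp (z * \<beta>\<^sup>2 / 2) * exp (\<beta> * z * \<gamma>) *
      (\<Prod>k\<in>S. mode_entry (\<beta> * exp z ^ k / of_nat k) (- \<beta> / exp z ^ k) (count \<mu> k) (count \<nu> k)) else 0)"
proof -
  define w where "w = exp z"
  let ?v = "op_exp (\<lambda>f s. z * virasoro 0 f s) (e_vec \<beta>)"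
  have v: "?v (\<alpha>, \<rho>) = exp (z * (\<alpha>\<^sup>2 / 2 + of_nat (sum_mset \<rho>))) * e_vec \<beta> (\<alpha>, \<rho>)" for \<alpha> \<rho>
    by (rule op_exp_diagonal) (simp add: virasoro_0)
  have v': "?v (\<alpha>, \<rho>) = (if \<alpha> = \<beta> \<and> \<rho> = {#} then exp (z * \<beta>\<^sup>2 / 2) else 0)" for \<alpha> \<rho>
    unfolding v by (simp add: e_vec_def ket_def)
  have charge: "op_exp (\<lambda>g t. \<alpha> * z * heis 0 g t) (ket (\<gamma>, \<nu>)) = (\<lambda>t. exp (\<alpha> * z * \<gamma>) * ket (\<gamma>, \<nu>) t)" for \<alpha>
  proof
    fix t :: state
    have "op_exp (\<lambda>g t. \<alpha> * z * heis 0 g t) (ket (\<gamma>, \<nu>)) t = exp (\<alpha> * z * fst t) * ket (\<gamma>, \<nu>) t"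
      by (rule op_exp_diagonal) (cases t, simp add: heis_def)
    then show "op_exp (\<lambda>g t. \<alpha> * z * heis 0 g t) (ket (\<gamma>, \<nu>)) t = exp (\<alpha> * z * \<gamma>) * ket (\<gamma>, \<nu>) t"
      by (simp add: ket_def)
  qed
  let ?x = "\<lambda>k. \<beta> * w ^ k / of_nat k" and ?y = "\<lambda>k. - \<beta> / w ^ k"
  let ?t = "\<lambda>(\<alpha>, \<rho>). ?v (\<alpha>, \<rho>) * charge_shift \<alpha> (Y_minus \<alpha> w (vertex_monomial w (sorted_list_of_multiset \<rho>)
      (Y_plus \<alpha> w (op_exp (\<lambda>g t. \<alpha> * z * heis 0 g t) (ket (\<gamma>, \<nu>)))))) (\<gamma>', \<mu>)"
  \<comment> \<open>\<open>L(0)\<close> is diagonal, so the vector inserted is still a multiple of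
    \<open>e_vec \<beta>\<close>; its oscillator list is empty and \<open>vertex_monomial\<close> is
    the identity.\<close>
  have "infsum ?t fock_basis = ?t (\<beta>, {#})"
    by (rule infsumI, rule has_sum_finite_neutralI[where B="{(\<beta>, {#})}"])
      (auto simp: fock_basis_def v' split: if_splits)
  also have "\<dots> = exp (z * \<beta>\<^sup>2 / 2) *
      (\<Sum>\<rho> | \<rho> \<subseteq># \<mu>. mset_weight ?x (\<mu> - \<rho>) *
        Y_plus \<beta> w (\<lambda>t. exp (\<beta> * z * \<gamma>) * ket (\<gamma>, \<nu>) t) (\<gamma>' - \<beta>, \<rho>))"
    by (simp add: v' charge_shift_def Y_minus_apply charge)
  also have "\<dots> = (if \<gamma>' = \<gamma> + \<beta> then exp (z * \<beta>\<^sup>2 / 2) * exp (\<beta> * z * \<gamma>) *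
      (\<Prod>k\<in>S. mode_entry (?x k) (?y k) (count \<mu> k) (count \<nu> k)) else 0)"
  proof (cases "\<gamma>' = \<gamma> + \<beta>")
    case True
    then show ?thesis
      unfolding Y_plus_ket[OF assms(1)] mode_factorization[OF S, symmetric]
      by (auto simp: sum_distrib_left intro!: sum.cong)
  next
    case False
    then have "\<gamma>' - \<beta> \<noteq> \<gamma>" by auto
    then show ?thesis using False by (simp add: Y_plus_ket[OF assms(1)])
  qed
  finally show ?thesis by (simp only: intertwiner_def w_def)
qed

lemma grading_entry:
  "op_exp (\<lambda>f s. c * (virasoro 0 f s - f s / 24)) (ket s) (\<gamma>, \<mu>) =
    exp (c * (\<gamma>\<^sup>2 / 2 - 1 / 24)) * exp c ^ sum_mset \<mu> * ket s (\<gamma>, \<mu>)"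
proof -
  have "op_exp (\<lambda>f s. c * (virasoro 0 f s - f s / 24)) (ket s) (\<gamma>, \<mu>) =
      exp (c * (\<gamma>\<^sup>2 / 2 - 1 / 24) + of_nat (sum_mset \<mu>) * c) * ket s (\<gamma>, \<mu>)"
    by (rule op_exp_diagonal) (simp add: virasoro_0 algebra_simps)
  then show ?thesis by (simp only: exp_add exp_of_nat_mult)
qed

section \<open>The Jacobi triple product\<close>

text \<open>
  A logarithm of \<open>(1 - x) (1 - q x) (1 - q\<^sup>2 x) \<cdots>\<close>.  The summand for \<open>n = 0\<close> is \<open>0\<close> because
  \<open>1 / 0 = 0\<close>.
\<close>

definition qlog :: "complex \<Rightarrow> complex \<Rightarrow> complex" where
  "qlog q x = (\<Sum>n. - 1 / (of_nat n * (1 - q ^ n)) * x ^ n)"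

context
  fixes q :: complex
  assumes q: "norm q < 1"
begin

lemma norm_one_minus_power_ge: "1 - norm q \<le> norm (1 - q ^ n)" if "n > 0"
proof -
  have "norm (q ^ n) \<le> norm q ^ 1"
    unfolding norm_power using q that by (intro power_decreasing) auto
  then show ?thesis using norm_triangle_ineq2[of 1 "q ^ n"] by simp
qed

lemma one_minus_power_nonzero: "1 - q ^ n \<noteq> 0" if "n > 0"
  using norm_one_minus_power_ge[OF that] q by auto

lemma norm_qlog_coeff_le: "norm (- 1 / (of_nat n * (1 - q ^ n)) * x ^ n) \<le> norm x ^ n / (1 - norm q)"
proof (cases "n = 0")
  case False
  have "norm (- 1 / (of_nat n * (1 - q ^ n)) * x ^ n) = norm x ^ n / (of_nat n * norm (1 - q ^ n))"
    by (simp add: norm_mult norm_divide norm_power)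
  also have "\<dots> \<le> norm x ^ n / (1 * (1 - norm q))"
    using q False norm_one_minus_power_ge[of n] by (intro divide_left_mono mult_mono mult_pos_pos) auto
  finally show ?thesis by simp
qed (use q in simp)

lemma qlog_summable_norm:
  assumes "norm x < 1"
  shows "summable (\<lambda>n. norm (- 1 / (of_nat n * (1 - q ^ n)) * x ^ n))"
proof (rule summable_comparison_test')
  show "summable (\<lambda>n. norm x ^ n / (1 - norm q))"
    using assms by (intro summable_divide summable_geometric) simp
  show "norm (norm (- 1 / (of_nat n * (1 - q ^ n)) * x ^ n)) \<le> norm x ^ n / (1 - norm q)" for n
    using norm_qlog_coeff_le by simp
qed

lemma qlog_sums:
  "norm x < 1 \<Longrightarrow> (\<lambda>n. - 1 / (of_nat n * (1 - q ^ n)) * x ^ n) sums qlog q x"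
  unfolding qlog_def by (intro summable_sums summable_norm_cancel[OF qlog_summable_norm])

lemma isCont_qlog:
  assumes "norm x < 1"
  shows "isCont (qlog q) x"
proof -
  obtain r where r: "norm x < r" "r < 1" using assms dense by blast
  have "summable (\<lambda>n. - 1 / (of_nat n * (1 - q ^ n)) * (of_real r :: complex) ^ n)"
    using r order_le_less_trans[OF norm_ge_zero r(1)] by (intro summable_norm_cancel[OF qlog_summable_norm]) simp
  then have "isCont (\<lambda>x. \<Sum>n. - 1 / (of_nat n * (1 - q ^ n)) * x ^ n) x"
    by (rule isCont_powser) (use r norm_ge_zero[of x] in simp)
  then show ?thesis by (simp add: qlog_def[abs_def])
qed

lemma qlog_0: "qlog q 0 = 0"
proof -
  have "(\<lambda>n. - 1 / (of_nat n * (1 - q ^ n)) * 0 ^ n) = (\<lambda>n. 0 :: complex)"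
  proof
    fix n show "- 1 / (of_nat n * (1 - q ^ n)) * 0 ^ n = (0 :: complex)" by (cases "n = 0") auto
  qed
  then show ?thesis by (simp add: qlog_def)
qed

text \<open>Passing from x to q x multiplies the n-th coefficient by q^n; the difference 1 - q^n
  cancels the denominator and leaves the series of Ln (1 - x).\<close>

lemma qlog_shift:
  assumes "norm x < 1"
  shows "qlog q x = Ln (1 - x) + qlog q (q * x)"
proof -
  have qx: "norm (q * x) < 1"
    unfolding norm_mult using q assms by (metis mult_strict_mono' norm_ge_zero mult_1)
  have "(\<lambda>n. - 1 / (of_nat n * (1 - q ^ n)) * x ^ n - - 1 / (of_nat n * (1 - q ^ n)) * (q * x) ^ n)
      sums (qlog q x - qlog q (q * x))"
    by (intro sums_diff qlog_sums assms qx)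
  moreover have "- 1 / (of_nat n * (1 - q ^ n)) * x ^ n - - 1 / (of_nat n * (1 - q ^ n)) * (q * x) ^ n =
      - ((- (- x)) ^ n) / of_nat n" for n
  proof (cases "n = 0")
    case False
    have "- 1 / (c * d) * X - - 1 / (c * d) * ((1 - d) * X) = - X / c"
      if "d \<noteq> 0" for c d X :: complex
      using that by (cases "c = 0") (auto simp: field_simps)
    from this[OF one_minus_power_nonzero[of n], of "of_nat n" "x ^ n"] False show ?thesis
      by (simp add: power_mult_distrib)
  qed simp
  ultimately have "(\<lambda>n. - ((- (- x)) ^ n) / of_nat n) sums (qlog q x - qlog q (q * x))" by simp
  moreover have "(\<lambda>n. - ((- (- x)) ^ n) / of_nat n) sums Ln (1 + - x)"
    using assms by (intro Ln_series') simp
  ultimately have "qlog q x - qlog q (q * x) = Ln (1 - x)" by (metis sums_unique2 uminus_add_conv_diff add.commute)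
  then show ?thesis by (simp add: algebra_simps)
qed

lemma exp_qlog:
  assumes "norm x < 1"
  shows "exp (qlog q x) = (1 - x) * exp (qlog q (q * x))"
proof -
  have "1 - x \<noteq> 0" using assms by auto
  then show ?thesis by (simp add: qlog_shift[OF assms] exp_add)
qed

text \<open>Iterating \<open>exp_qlog\<close> M times leaves the remainder exp (qlog q (q^M x)),
  which tends to 1 by continuity at 0.\<close>

lemma qlog_product_tendsto:
  assumes x: "norm x < 1"
  shows "(\<lambda>M. \<Prod>m<M. 1 - q ^ m * x) \<longlonglongrightarrow> exp (qlog q x)"
proof -
  have small: "norm (q ^ m * x) < 1" for m
  proof -
    have "norm (q ^ m * x) \<le> 1 * norm x"
      unfolding norm_mult norm_power using q by (intro mult_right_mono power_le_one) auto
    then show ?thesis using x by simp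
  qed
  have prod: "exp (qlog q x) = (\<Prod>m<M. 1 - q ^ m * x) * exp (qlog q (q ^ M * x))" for M
  proof (induction M)
    case (Suc M)
    then show ?case using exp_qlog[OF small[of M]] by (simp add: mult_ac)
  qed simp
  have "(\<lambda>M. q ^ M * x) \<longlonglongrightarrow> 0 * x"
    by (intro tendsto_mult tendsto_const LIMSEQ_power_zero q)
  then have "(\<lambda>M. qlog q (q ^ M * x)) \<longlonglongrightarrow> qlog q 0"
    using isCont_qlog[of 0] by (intro isCont_tendsto_compose[of _ "qlog q"]) auto
  then have "(\<lambda>M. exp (qlog q x) / exp (qlog q (q ^ M * x))) \<longlonglongrightarrow> exp (qlog q x) / exp (qlog q 0)"
    by (intro tendsto_intros) auto
  moreover have "exp (qlog q x) / exp (qlog q (q ^ M * x)) = (\<Prod>m<M. 1 - q ^ m * x)" for M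
    by (subst prod[of M]) simp
  ultimately show ?thesis by (simp add: qlog_0)
qed

lemma euler_product_tendsto: "(\<lambda>M. \<Prod>m = 1..M. 1 - q ^ m) \<longlonglongrightarrow> exp (qlog q q)"
proof -
  have "(\<Prod>m<M. 1 - q ^ m * q) = (\<Prod>m = 1..M. 1 - q ^ m)" for M
    by (rule prod.reindex_bij_witness[where i="\<lambda>m. m - 1" and j=Suc]) (auto simp: power_eq_if mult.commute)
  then show ?thesis using qlog_product_tendsto[OF q] by simp
qed

text \<open>
  \<open>qbin a b\<close> is the Gaussian binomial coefficient of \<open>a + b\<close> over \<open>a\<close>, extended by zero to all
  integers so that the Pascal rules need no boundary cases.
\<close>

definition qpoch :: "nat \<Rightarrow> complex" where
  "qpoch n = (\<Prod>m = 1..n. 1 - q ^ m)"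

definition qbin :: "int \<Rightarrow> int \<Rightarrow> complex" where
  "qbin a b = (if a \<ge> 0 \<and> b \<ge> 0 then qpoch (nat (a + b)) / (qpoch (nat a) * qpoch (nat b)) else 0)"

lemma qpoch_nonzero: "qpoch n \<noteq> 0"
  using one_minus_power_nonzero by (auto simp: qpoch_def)

lemma qpoch_Suc: "qpoch (Suc n) = qpoch n * (1 - q ^ Suc n)"
  by (simp add: qpoch_def)

lemma qbin_swap: "qbin a b = qbin b a"
  by (simp add: qbin_def add.commute mult.commute)

text \<open>Positivity of a + b excludes a = b = 0, where the left side is 1 and both terms on the
  right are 0.\<close>

lemma qbin_pascal:
  assumes "a + b > 0"
  shows "qbin a b = qbin (a - 1) b + q powi a * qbin a (b - 1)"
proof -
  consider "a < 0 \<or> b < 0" | "a = 0" "b \<ge> 1" | "a \<ge> 1" "b = 0" | "a \<ge> 1" "b \<ge> 1"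
    using assms by linarith
  then show ?thesis
  proof cases
    case 4
    then have "a = int (Suc (nat (a - 1)))" "b = int (Suc (nat (b - 1)))" by simp_all
    then obtain m n where ab: "a = int (Suc m)" "b = int (Suc n)" by blast
    have nn: "qpoch m \<noteq> 0" "qpoch n \<noteq> 0" "1 - q ^ Suc m \<noteq> 0" "1 - q ^ Suc n \<noteq> 0"
      using qpoch_nonzero one_minus_power_nonzero by blast+
    have e: "nat (a + b) = Suc (m + Suc n)" "nat a = Suc m" "nat b = Suc n" "nat (a - 1 + b) = m + Suc n"
      "nat (a + (b - 1)) = m + Suc n" "nat (a - 1) = m" "nat (b - 1) = n"
      using ab by auto
    have p: "q powi a = q ^ Suc m" using ab by (simp only: power_int_of_nat)
    have *: "1 - q ^ Suc (m + Suc n) = (1 - q ^ Suc m) + q ^ Suc m * (1 - q ^ Suc n)"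
      by (simp add: power_add algebra_simps)
    have "X * (A + P * B) / (C * A * (D * B)) = X / (C * (D * B)) + P * (X / (C * A * D))"
      if "C \<noteq> 0" "D \<noteq> 0" "A \<noteq> 0" "B \<noteq> 0" for X A B C D P :: complex
      using that by (simp add: field_simps)
    from this[OF nn, of "qpoch (m + Suc n)" "q ^ Suc m"] show ?thesis
      using 4 unfolding qbin_def e p by (simp only: qpoch_Suc[of "m + Suc n"] qpoch_Suc[of m] qpoch_Suc[of n] *) simp
  qed (auto simp: qbin_def qpoch_nonzero qpoch_def[of 0])
qed

lemma qbin_pascal':
  assumes "a + b > 0"
  shows "qbin a b = q powi b * qbin (a - 1) b + qbin a (b - 1)"
  using qbin_pascal[of b a] assms by (simp add: qbin_swap add.commute)

text \<open>Three Pascal steps combined raise both arguments at once, as the step from N to N + 1 in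
  the finite triple product demands.\<close>

lemma qbin_two_step:
  assumes ab: "a + b = 2 * int N" and q0: "q \<noteq> 0"
  shows "qbin (a + 1) (b + 1) = (1 + q ^ (2 * N + 1)) * qbin a b + q powi (b + 1) * qbin (a - 1) (b + 1) +
    q powi (a + 1) * qbin (a + 1) (b - 1)"
proof -
  have "q powi (a + 1) * q powi b = q powi int (2 * N + 1)"
    using q0 ab by (simp add: power_int_add[symmetric] algebra_simps)
  then have "q powi (a + 1) * q powi b = q ^ (2 * N + 1)" by (simp only: power_int_of_nat)
  moreover have "qbin (a + 1) (b + 1) = qbin a (b + 1) + q powi (a + 1) * qbin (a + 1) b"
    using qbin_pascal[of "a + 1" "b + 1"] ab by simp
  moreover have "qbin a (b + 1) = q powi (b + 1) * qbin (a - 1) (b + 1) + qbin a b"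
    using qbin_pascal'[of a "b + 1"] ab by simp
  moreover have "qbin (a + 1) b = q powi b * qbin a b + qbin (a + 1) (b - 1)"
    using qbin_pascal'[of "a + 1" b] ab by simp
  ultimately show ?thesis by (simp add: algebra_simps)
qed

section \<open>From the finite triple product to the infinite one\<close>

definition theta_term :: "complex \<Rightarrow> int \<Rightarrow> complex" where
  "theta_term x k = (- 1) powi k * q powi (k * (k + 1) div 2) * x powi k"

lemma theta_term_Suc:
  assumes "q \<noteq> 0" "x \<noteq> 0"
  shows "theta_term x (k + 1) = - x * q powi (k + 1) * theta_term x k"
proof -
  have "(k + 1) * (k + 1 + 1) div 2 = k * (k + 1) div 2 + (k + 1)"
    by (simp add: algebra_simps)
  then show ?thesis using assms by (simp add: theta_term_def power_int_add mult_ac)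
qed

text \<open>The new factor is (1 - x q^(N+1)) (1 - q^N / x) = 1 + q^(2N+1) - x q^(N+1) - q^N / x.
  The last two terms shift the index k by one in either direction, and the powers of q produced by
  the shifts are those of \<open>qbin_two_step\<close>.\<close>

lemma jacobi_triple_finite:
  assumes q0: "q \<noteq> 0" and x0: "x \<noteq> 0"
  shows "((\<lambda>k. qbin (int N + k) (int N - k) * theta_term x k) has_sum
    (\<Prod>m = 1..N. (1 - x * q ^ m) * (1 - q ^ (m - 1) / x))) UNIV"
proof (induction N)
  case 0
  have "qbin k (- k) * theta_term x k = 0" if "k \<noteq> 0" for k
    using that by (auto simp: qbin_def)
  then show ?case
    by (intro has_sum_finite_neutralI[where B="{0}"]) (auto simp: qbin_def qpoch_def theta_term_def)
next
  case (Suc N)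
  let ?P = "\<Prod>m = 1..N. (1 - x * q ^ m) * (1 - q ^ (m - 1) / x)"
  let ?c = "\<lambda>k. qbin (int N + k) (int N - k)"
  \<comment> \<open>Since \<open>qbin\<close> is extended by zero, the sum runs over all integers
    and is invariant under shifts of the index.\<close>
  have up: "((\<lambda>k. ?c (k + 1) * theta_term x (k + 1)) has_sum ?P) UNIV"
    using Suc by (subst has_sum_reindex_bij_witness[where i="\<lambda>k. k - 1" and j="\<lambda>k. k + 1" and T=UNIV
          and h="\<lambda>k. ?c k * theta_term x k" and s'="?P"]) auto
  have down: "((\<lambda>k. ?c (k - 1) * theta_term x (k - 1)) has_sum ?P) UNIV"
    using Suc by (subst has_sum_reindex_bij_witness[where i="\<lambda>k. k + 1" and j="\<lambda>k. k - 1" and T=UNIV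
          and h="\<lambda>k. ?c k * theta_term x k" and s'="?P"]) auto
  have "((\<lambda>k. (1 + q ^ (2 * N + 1)) * (?c k * theta_term x k)
        + (- x * q ^ (N + 1)) * (?c (k - 1) * theta_term x (k - 1))
        + (- (q ^ N / x)) * (?c (k + 1) * theta_term x (k + 1)))
      has_sum (1 + q ^ (2 * N + 1)) * ?P + (- x * q ^ (N + 1)) * ?P + (- (q ^ N / x)) * ?P) UNIV"
    by (intro has_sum_add has_sum_cmult_right Suc up down)
  also have "(1 + q ^ (2 * N + 1)) * ?P + (- x * q ^ (N + 1)) * ?P + (- (q ^ N / x)) * ?P =
      (\<Prod>m = 1..Suc N. (1 - x * q ^ m) * (1 - q ^ (m - 1) / x))"
  proof -
    have "(1 + Q * Q * q) * P + (- x * (Q * q)) * P + (- (Q / x)) * P = P * ((1 - x * (Q * q)) * (1 - Q / x))" for P Q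
      using x0 by (simp add: field_simps)
    from this[of "q ^ N" ?P] have "(1 + q ^ (2 * N + 1)) * ?P + (- x * q ^ (N + 1)) * ?P + (- (q ^ N / x)) * ?P =
        ?P * ((1 - x * q ^ (N + 1)) * (1 - q ^ N / x))"
      by (simp only: mult_2 power_add power_one_right)
    then show ?thesis by simp
  qed
  also have "(\<lambda>k. (1 + q ^ (2 * N + 1)) * (?c k * theta_term x k)
        + (- x * q ^ (N + 1)) * (?c (k - 1) * theta_term x (k - 1))
        + (- (q ^ N / x)) * (?c (k + 1) * theta_term x (k + 1))) =
      (\<lambda>k. qbin (int (Suc N) + k) (int (Suc N) - k) * theta_term x k)"
  proof
    fix k :: int
    have swap: "u * (c * v) = p * c * w" if "u * v = p * w" for u v c p w :: complex
      using that by (simp only: mult.left_commute[of u c] mult_ac)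
    have "(- x * q ^ (N + 1)) * theta_term x (k - 1) = q powi (int N - k + 1) * theta_term x k"
      using theta_term_Suc[OF q0 x0, of "k - 1"] q0
      by (simp add: power_int_add power_int_diff power_int_minus field_simps)
    then have 1: "(- x * q ^ (N + 1)) * (?c (k - 1) * theta_term x (k - 1)) =
        q powi (int N - k + 1) * ?c (k - 1) * theta_term x k"
      by (rule swap)
    have "(- (q ^ N / x)) * theta_term x (k + 1) = q powi (int N + k + 1) * theta_term x k"
      using theta_term_Suc[OF q0 x0, of k] q0 x0
      by (simp add: power_int_add field_simps)
    then have 2: "(- (q ^ N / x)) * (?c (k + 1) * theta_term x (k + 1)) =
        q powi (int N + k + 1) * ?c (k + 1) * theta_term x k"
      by (rule swap)
    have 3: "qbin (int (Suc N) + k) (int (Suc N) - k) = (1 + q ^ (2 * N + 1)) * ?c k +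
        q powi (int N - k + 1) * ?c (k - 1) + q powi (int N + k + 1) * ?c (k + 1)"
      using qbin_two_step[of "int N + k" "int N - k" N] q0 by (simp add: algebra_simps)
    show "(1 + q ^ (2 * N + 1)) * (?c k * theta_term x k)
        + (- x * q ^ (N + 1)) * (?c (k - 1) * theta_term x (k - 1))
        + (- (q ^ N / x)) * (?c (k + 1) * theta_term x (k + 1)) =
      qbin (int (Suc N) + k) (int (Suc N) - k) * theta_term x k"
      unfolding 1 2 3 by (simp only: distrib_right mult.assoc)
  qed
  finally show ?case .
qed

text \<open>Tannery's theorem for sums over the integers, transported along an enumeration; absolute
  summability makes the order of enumeration irrelevant.\<close>

lemma has_sum_int_dominated:
  fixes f :: "nat \<Rightarrow> int \<Rightarrow> complex"
  assumes f: "\<And>N. (f N has_sum s N) UNIV" and lim: "\<And>k. (\<lambda>N. f N k) \<longlonglongrightarrow> g k"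
    and dom: "\<And>N k. norm (f N k) \<le> h k" and h: "h summable_on UNIV"
    and s: "s \<longlonglongrightarrow> S"
  shows "(g has_sum S) UNIV"
proof -
  have bij: "bij_betw int_decode UNIV UNIV" by (rule bij_int_decode)
  have fs: "(\<lambda>n. f N (int_decode n)) sums s N" for N
    by (rule has_sum_imp_sums, rule iffD2[OF has_sum_reindex_bij_betw[OF bij, of "f N"] f])
  have hs: "summable (\<lambda>n. h (int_decode n))"
    by (rule summable_on_imp_summable, rule iffD2[OF summable_on_reindex_bij_betw[OF bij, of h] h])
  have ev: "eventually (\<lambda>(n, N). norm (f N (int_decode n)) \<le> h (int_decode n)) (at_top \<times>\<^sub>F sequentially)"
    using dom by (intro always_eventually) auto
  have tannery: "(\<forall>\<^sub>F N in sequentially. summable (\<lambda>n. norm (f N (int_decode n)))) \<and>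
      summable (\<lambda>n. norm (g (int_decode n))) \<and>
      (\<lambda>N. \<Sum>n. f N (int_decode n)) \<longlonglongrightarrow> (\<Sum>n. g (int_decode n))"
    by (rule tannerys_theorem[of "\<lambda>n N. f N (int_decode n)"]) (rule lim ev hs sequentially_bot)+
  have "(\<lambda>N. \<Sum>n. f N (int_decode n)) = s"
    by (rule ext, rule sums_unique[OF fs, symmetric])
  then have "s \<longlonglongrightarrow> (\<Sum>n. g (int_decode n))"
    using conjunct2[OF conjunct2[OF tannery]] by simp
  then have S: "(\<Sum>n. g (int_decode n)) = S" using s by (rule LIMSEQ_unique)
  have gn: "summable (\<lambda>n. norm (g (int_decode n)))" by (rule conjunct1[OF conjunct2[OF tannery]])
  then have "(\<lambda>n. g (int_decode n)) sums S"
    unfolding S[symmetric] by (rule summable_sums[OF summable_norm_cancel])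
  with gn have "((\<lambda>n. g (int_decode n)) has_sum S) UNIV"
    by (rule norm_summable_imp_has_sum)
  then show ?thesis by (rule iffD1[OF has_sum_reindex_bij_betw[OF bij, of g]])
qed

text \<open>For k >= 0 the exponent k (k + 1) / 2 is at least k, and it is unchanged under k -> - k
  - 1. So the two halves are dominated by geometric series with ratios |q x| and |q / x|.\<close>

lemma theta_term_summable:
  assumes q0: "q \<noteq> 0" and x0: "x \<noteq> 0" and qx: "norm (q * x) < 1" "norm (q / x) < 1"
  shows "(\<lambda>k. norm (theta_term x k)) summable_on UNIV"
proof -
  have nt: "norm (theta_term x k) = norm q powi (k * (k + 1) div 2) * norm x powi k" for k
    by (simp add: theta_term_def norm_mult norm_power_int)
  have tri: "norm q powi (int j * (int j + 1) div 2) \<le> norm q ^ j" for j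
  proof -
    have "j * 2 \<le> j * (j + 1)" by (cases j) auto
    then have "j \<le> j * (j + 1) div 2" by (simp add: less_eq_div_iff_mult_less_eq)
    then have "norm q ^ (j * (j + 1) div 2) \<le> norm q ^ j"
      using q by (intro power_decreasing) auto
    moreover have "int j * (int j + 1) div 2 = int (j * (j + 1) div 2)" by (simp add: zdiv_int algebra_simps)
    ultimately show ?thesis by (simp only: power_int_of_nat)
  qed
  have geo: "(\<lambda>j. norm (u j)) summable_on UNIV" if "\<And>j. norm (u j) \<le> r ^ j / C" "0 \<le> r" "r < 1"
    for u :: "nat \<Rightarrow> complex" and r C
  proof (rule summable_nonneg_imp_summable_on)
    show "summable (\<lambda>j. norm (u j))"
    proof (rule summable_comparison_test')
      show "summable (\<lambda>j. r ^ j / C)" using that by (intro summable_divide summable_geometric) simp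
      show "norm (norm (u j)) \<le> r ^ j / C" for j using that(1) by simp
    qed
  qed simp
  have "norm (theta_term x (int j)) \<le> norm (q * x) ^ j" for j
    unfolding nt norm_mult power_mult_distrib power_int_of_nat by (intro mult_right_mono tri) simp
  then have 1: "(\<lambda>j. norm (theta_term x (int j))) summable_on UNIV"
    by (intro geo[where r="norm (q * x)" and C=1]) (use qx in simp_all)
  have "norm (theta_term x (- int j - 1)) \<le> norm (q / x) ^ j / norm x" for j
  proof -
    have "(- int j - 1) * (- int j - 1 + 1) div 2 = int j * (int j + 1) div 2"
      by (simp add: algebra_simps)
    moreover have "norm x powi (- int j - 1) = 1 / (norm x ^ j * norm x)"
      using x0 by (simp add: power_int_diff power_int_minus divide_simps)
    ultimately have "norm (theta_term x (- int j - 1)) =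
        norm q powi (int j * (int j + 1) div 2) * (1 / (norm x ^ j * norm x))"
      unfolding nt by (simp only:)
    also have "\<dots> \<le> norm q ^ j * (1 / (norm x ^ j * norm x))"
      by (intro mult_right_mono tri) simp
    finally show ?thesis by (simp add: norm_divide power_divide)
  qed
  then have 2: "(\<lambda>j. norm (theta_term x (- int j - 1))) summable_on UNIV"
    by (intro geo[where r="norm (q / x)" and C="norm x"]) (use qx in simp_all)
  have bij1: "bij_betw int UNIV {0..}" by (rule bij_betwI[where g=nat]) auto
  have bij2: "bij_betw (\<lambda>j. - int j - 1) UNIV {..-1}" by (rule bij_betwI[where g="\<lambda>k. nat (- k - 1)"]) auto
  have "(\<lambda>k. norm (theta_term x k)) summable_on ({0..} \<union> {..-1})"
  proof (rule summable_on_union)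
    show "(\<lambda>k. norm (theta_term x k)) summable_on {0..}"
      using 1 summable_on_reindex_bij_betw[OF bij1, of "\<lambda>k. norm (theta_term x k)"] by simp
    show "(\<lambda>k. norm (theta_term x k)) summable_on {..-1}"
      using 2 summable_on_reindex_bij_betw[OF bij2, of "\<lambda>k. norm (theta_term x k)"] by simp
  qed
  moreover have "{0..} \<union> {..-1} = (UNIV :: int set)" by auto
  ultimately show ?thesis by simp
qed

text \<open>The limit of the finite identity: for fixed k the Gaussian coefficients tend to the
  inverse of the Euler product, and they are bounded uniformly in N and k, which gives the
  domination.\<close>

theorem jacobi_triple_product:
  assumes q0: "q \<noteq> 0" and x0: "x \<noteq> 0" and qx: "norm (q * x) < 1" "norm (q / x) < 1"
  shows "(theta_term x has_sum
    exp (qlog q q) * ((1 - 1 / x) * exp (qlog q (q * x)) * exp (qlog q (q / x)))) UNIV"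
proof -
  let ?phi = "exp (qlog q q)"
  have lim: "qpoch \<longlonglongrightarrow> ?phi"
    using euler_product_tendsto by (simp add: qpoch_def[abs_def])
  then have "convergent qpoch" "convergent (\<lambda>n. inverse (qpoch n))"
    using tendsto_inverse[OF lim] by (auto simp: convergent_def)
  then obtain B B' where B: "\<And>n. norm (qpoch n) \<le> B" and B': "\<And>n. norm (inverse (qpoch n)) \<le> B'"
    by (meson Bseq_def convergent_imp_Bseq)
  have B0: "0 \<le> B" "0 \<le> B'" using B[of 0] B'[of 0] norm_ge_zero order_trans by blast+
  have bound: "norm (qbin a b) \<le> B * (B' * B')" for a b
    using B B' B0 by (auto simp: qbin_def divide_inverse norm_mult intro!: mult_mono)
  have phi: "(\<lambda>N. qbin (int N + k) (int N - k)) \<longlonglongrightarrow> ?phi / (?phi * ?phi)" for k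
  proof (rule Lim_transform_eventually)
    have at: "filterlim (\<lambda>N. nat (int N + j)) at_top sequentially" for j
      unfolding filterlim_at_top eventually_sequentially
    proof
      fix Z show "\<exists>N. \<forall>n\<ge>N. Z \<le> nat (int n + j)" by (rule exI[of _ "Z + nat \<bar>j\<bar>"]) auto
    qed
    have at2: "filterlim (\<lambda>N::nat. 2 * N) at_top sequentially"
      by (rule filterlim_subseq) (auto simp: strict_mono_def)
    have c: "(\<lambda>N. qpoch (u N)) \<longlonglongrightarrow> ?phi" if "filterlim u at_top sequentially" for u
      using filterlim_compose[OF lim that] by simp
    show "(\<lambda>N. qpoch (2 * N) / (qpoch (nat (int N + k)) * qpoch (nat (int N + - k)))) \<longlonglongrightarrow> ?phi / (?phi * ?phi)"
      by (intro tendsto_divide tendsto_mult c at at2) simp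
    show "\<forall>\<^sub>F N in sequentially. qpoch (2 * N) / (qpoch (nat (int N + k)) * qpoch (nat (int N + - k))) =
        qbin (int N + k) (int N - k)"
      using eventually_ge_at_top[of "nat \<bar>k\<bar>"]
    proof eventually_elim
      case (elim N)
      have "nat (int N + k + (int N - k)) = 2 * N" by simp
      then show ?case using elim by (auto simp: qbin_def)
    qed
  qed
  have prods: "(\<lambda>N. \<Prod>m = 1..N. (1 - x * q ^ m) * (1 - q ^ (m - 1) / x)) \<longlonglongrightarrow>
      (1 - 1 / x) * exp (qlog q (q * x)) * exp (qlog q (q / x))"
  \<comment> \<open>Only q / x, not 1 / x, is known to have norm below 1; so the first factor 1 - 1
    / x is split off, which shifts the index of this product by one.\<close>
  proof (rule LIMSEQ_imp_Suc)
    have 1: "(\<Prod>m = 1..N. 1 - y * q ^ m) = (\<Prod>m<N. 1 - q ^ m * (q * y))" for N y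
      by (rule prod.reindex_bij_witness[where i=Suc and j="\<lambda>m. m - 1"]) (auto simp: power_eq_if)
    have 2: "(\<Prod>m = 1..Suc N. 1 - q ^ (m - 1) / x) = (1 - 1 / x) * (\<Prod>m = 1..N. 1 - 1 / x * q ^ m)" for N
    proof (induction N)
      case (Suc N)
      then show ?case by (subst prod.cl_ivl_Suc) simp
    qed simp
    have eq: "(\<Prod>m = 1..Suc N. (1 - x * q ^ m) * (1 - q ^ (m - 1) / x)) =
        (\<Prod>m<Suc N. 1 - q ^ m * (q * x)) * ((1 - 1 / x) * (\<Prod>m<N. 1 - q ^ m * (q * (1 / x))))" for N
      unfolding prod.distrib 1 2 by (rule refl)
    have "(\<lambda>N. (\<Prod>m<Suc N. 1 - q ^ m * (q * x)) * ((1 - 1 / x) * (\<Prod>m<N. 1 - q ^ m * (q * (1 / x))))) \<longlonglongrightarrow>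
        exp (qlog q (q * x)) * ((1 - 1 / x) * exp (qlog q (q * (1 / x))))"
      by (intro tendsto_mult tendsto_const LIMSEQ_Suc qlog_product_tendsto) (use qx in auto)
    then show "(\<lambda>N. \<Prod>m = 1..Suc N. (1 - x * q ^ m) * (1 - q ^ (m - 1) / x)) \<longlonglongrightarrow>
        (1 - 1 / x) * exp (qlog q (q * x)) * exp (qlog q (q / x))"
      unfolding eq by (simp add: mult_ac)
  qed
  have "((\<lambda>k. ?phi / (?phi * ?phi) * theta_term x k) has_sum
      (1 - 1 / x) * exp (qlog q (q * x)) * exp (qlog q (q / x))) UNIV"
  proof (rule has_sum_int_dominated[OF jacobi_triple_finite[OF q0 x0] _ _ _ prods])
    show "(\<lambda>N. qbin (int N + k) (int N - k) * theta_term x k) \<longlonglongrightarrow> ?phi / (?phi * ?phi) * theta_term x k" for k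
      by (intro tendsto_mult tendsto_const phi)
    show "norm (qbin (int N + k) (int N - k) * theta_term x k) \<le> B * (B' * B') * norm (theta_term x k)" for N k
      unfolding norm_mult by (intro mult_right_mono bound) simp
    show "(\<lambda>k. B * (B' * B') * norm (theta_term x k)) summable_on UNIV"
      by (intro summable_on_cmult_right theta_term_summable q0 x0 qx)
  qed
  then have "((\<lambda>k. ?phi * (?phi / (?phi * ?phi) * theta_term x k)) has_sum
      ?phi * ((1 - 1 / x) * exp (qlog q (q * x)) * exp (qlog q (q / x)))) UNIV"
    by (rule has_sum_cmult_right)
  then show ?thesis by simp
qed

end

section \<open>The prime form\<close>

definition nome :: "complex \<Rightarrow> complex" where
  "nome \<tau> = exp (2 * pi * \<i> * \<tau>)"

lemma nome_nonzero: "nome \<tau> \<noteq> 0"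
  by (simp add: nome_def)

lemma norm_nome: "norm (nome \<tau>) = exp (- (2 * pi * Im \<tau>))"
  by (simp add: nome_def norm_exp_eq_Re)

lemma norm_nome_less_1: "Im \<tau> > 0 \<Longrightarrow> norm (nome \<tau>) < 1"
  by (simp add: norm_nome)

lemma dedekind_eta_qlog:
  assumes "Im \<tau> > 0"
  shows "dedekind_eta \<tau> = exp (2 * pi * \<i> * \<tau> / 24) * exp (qlog (nome \<tau>) (nome \<tau>))"
proof -
  have "(\<Prod>i\<le>n. 1 - nome \<tau> ^ Suc i) = (\<Prod>m = 1..Suc n. 1 - nome \<tau> ^ m)" for n
    by (rule prod.reindex_bij_witness[where i="\<lambda>m. m - 1" and j=Suc]) auto
  then have "(\<lambda>n. \<Prod>i\<le>n. 1 - nome \<tau> ^ Suc i) \<longlonglongrightarrow> exp (qlog (nome \<tau>) (nome \<tau>))"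
    using LIMSEQ_Suc[OF euler_product_tendsto[OF norm_nome_less_1[OF assms]]] by simp
  then have "(\<lambda>n. 1 - nome \<tau> ^ Suc n) has_prod exp (qlog (nome \<tau>) (nome \<tau>))"
    by (simp add: has_prod_def raw_has_prod_def)
  then have "(\<Prod>n. 1 - nome \<tau> ^ Suc n) = exp (qlog (nome \<tau>) (nome \<tau>))"
    by (rule has_prod_unique[symmetric])
  then show ?thesis by (simp only: dedekind_eta_def nome_def[symmetric])
qed

text \<open>From (n + 1/2)^2 = n (n + 1) + 1/4 each summand is a term of Jacobi's series at x = exp
  z, up to a constant; the constant i is exp (i pi / 2). The bound on Re z says that q exp z and q
  exp (- z) have norm below 1.\<close>

lemma theta1_product:
  assumes tau: "Im \<tau> > 0" and z: "\<bar>Re z\<bar> < 2 * pi * Im \<tau>"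
  shows "theta1 z \<tau> = \<i> * exp (\<i> * pi * \<tau> / 4) * exp (qlog (nome \<tau>) (nome \<tau>)) *
    (exp (z / 2) * (1 - exp (- z))) *
    (exp (qlog (nome \<tau>) (nome \<tau> * exp z)) * exp (qlog (nome \<tau>) (nome \<tau> * exp (- z))))"
proof -
  let ?q = "nome \<tau>" and ?x = "exp z"
  let ?c = "\<i> * exp (\<i> * pi * \<tau> / 4) * exp (z / 2)"
  have "norm (?q * ?x) < 1" "norm (?q / ?x) < 1"
    using z by (simp_all add: norm_mult norm_divide norm_nome norm_exp_eq_Re flip: exp_add exp_diff)
  then have jtp: "(theta_term ?q ?x has_sum
      exp (qlog ?q ?q) * ((1 - 1 / ?x) * exp (qlog ?q (?q * ?x)) * exp (qlog ?q (?q / ?x)))) UNIV"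
    by (intro jacobi_triple_product norm_nome_less_1 tau nome_nonzero) simp_all
  have summand: "exp (\<i> * pi * (of_int n + 1 / 2)\<^sup>2 * \<tau> + (of_int n + 1 / 2) * (z + pi * \<i>)) = ?c * theta_term ?q ?x n" for n :: int
  proof -
    have "even (n * (n + 1))" by simp
    then obtain k where k: "n * (n + 1) = 2 * k" by blast
    then have kd: "n * (n + 1) div 2 = k" by simp
    have "(of_int n * (of_int n + 1) :: complex) = 2 * of_int k"
      by (metis k of_int_1 of_int_add of_int_mult of_int_numeral)
    then have e: "\<i> * pi * (of_int n + 1 / 2)\<^sup>2 * \<tau> + (of_int n + 1 / 2) * (z + pi * \<i>) =
        \<i> * pi / 2 + \<i> * pi * \<tau> / 4 + z / 2 + of_int n * (\<i> * pi) + of_int k * (2 * pi * \<i> * \<tau>) + of_int n * z"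
      by (simp add: power2_eq_square algebra_simps)
    have i: "exp (\<i> * pi / 2) = \<i>" using cis_pi_half by (simp add: cis_conv_exp)
    have m: "(- 1) powi n = exp (of_int n * (\<i> * pi))" 
      unfolding exp_power_int[symmetric] by simp
    show ?thesis
      unfolding theta_term_def[OF norm_nome_less_1[OF tau]]
      unfolding e exp_add i m nome_def exp_power_int kd by (simp only: mult_ac)
  qed
  have "theta1 z \<tau> = ?c * (exp (qlog ?q ?q) * ((1 - 1 / ?x) * exp (qlog ?q (?q * ?x)) * exp (qlog ?q (?q / ?x))))"
    unfolding theta1_def summand by (rule infsumI) (rule has_sum_cmult_right[OF jtp])
  moreover have "exp (- z) = 1 / ?x" by (simp add: exp_minus divide_inverse)
  moreover have "?q * exp (- z) = ?q / ?x" by (simp add: exp_minus divide_inverse)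
  ultimately show ?thesis by (simp only: mult_ac)
qed

lemma norm_nome_exp:
  assumes "\<bar>Re z\<bar> < 2 * pi * Im \<tau>"
  shows "norm (nome \<tau> * exp z) < 1" "norm (nome \<tau> * exp (- z)) < 1"
  using assms by (simp_all add: norm_mult norm_nome norm_exp_eq_Re flip: exp_add)

lemma isCont_qlog_compose:
  "norm q < 1 \<Longrightarrow> isCont f a \<Longrightarrow> norm (f a) < 1 \<Longrightarrow> isCont (\<lambda>x. qlog q (f x)) a"
  by (rule isCont_o2[OF _ isCont_qlog])

text \<open>At a zero of \<open>g\<close> the product rule needs only continuity of
  \<open>E\<close>, so the derivative of \<theta>_1 at 0 is found without differentiating
  \<open>qlog\<close>.\<close>

lemma has_field_derivative_mult_isCont:
  assumes g: "(g has_field_derivative D) (at a)" and E: "isCont E a" and g0: "g a = 0"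
  shows "((\<lambda>z. g z * E z) has_field_derivative D * E a) (at a)"
proof -
  have "((\<lambda>z. (g z - g a) / (z - a) * E z) \<longlongrightarrow> D * E a) (at a)"
    using g E by (intro tendsto_mult) (auto simp: has_field_derivative_iff isCont_def)
  then show ?thesis using g0 by (simp add: has_field_derivative_iff)
qed

text \<open>The factor exp (z / 2) (1 - exp (- z)) has derivative 1 at its zero z = 0. Hence the
  derivative of \<theta>_1 at 0 is the remaining product there, and \<open>?E 0\<close> is the
  square of the Euler product.\<close>

lemma prime_form_product:
  assumes tau: "Im \<tau> > 0" and z: "\<bar>Re z\<bar> < 2 * pi * Im \<tau>"
  shows "prime_form z \<tau> = exp (z / 2) * (1 - exp (- z)) *
    exp (qlog (nome \<tau>) (nome \<tau> * exp z) + qlog (nome \<tau>) (nome \<tau> * exp (- z)) - 2 * qlog (nome \<tau>) (nome \<tau>))"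
proof -
  let ?q = "nome \<tau>"
  let ?C = "\<i> * exp (\<i> * pi * \<tau> / 4) * exp (qlog ?q ?q)"
  let ?E = "\<lambda>z. exp (qlog ?q (?q * exp z)) * exp (qlog ?q (?q * exp (- z)))"
  let ?U = "{z. \<bar>Re z\<bar> < 2 * pi * Im \<tau>}"
  have q: "norm ?q < 1" by (rule norm_nome_less_1[OF tau])
  have "((\<lambda>z. exp (z / 2) * (1 - exp (- z))) has_field_derivative (1 :: complex)) (at 0)"
    by (auto intro!: derivative_eq_intros)
  from DERIV_cmult[OF this, of ?C]
  have "((\<lambda>z. ?C * (exp (z / 2) * (1 - exp (- z)))) has_field_derivative ?C) (at 0)"
    by simp
  moreover have "isCont ?E 0"
    by (intro continuous_intros isCont_qlog_compose[OF q]) (use q in auto)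
  ultimately have "((\<lambda>z. ?C * (exp (z / 2) * (1 - exp (- z))) * ?E z) has_field_derivative ?C * ?E 0) (at 0)"
    by (rule has_field_derivative_mult_isCont) simp
  moreover have "open ?U" by (intro open_Collect_less continuous_intros)
  ultimately have "((\<lambda>w. theta1 w \<tau>) has_field_derivative ?C * ?E 0) (at 0)"
  proof (rule has_field_derivative_transform_within_open)
    show "0 \<in> ?U" using tau by simp
    fix w assume "w \<in> ?U"
    then show "?C * (exp (w / 2) * (1 - exp (- w))) * ?E w = theta1 w \<tau>"
      unfolding mem_Collect_eq by (rule theta1_product[OF tau, symmetric])
  qed
  then have "deriv (\<lambda>w. theta1 w \<tau>) 0 = ?C * ?E 0" by (rule DERIV_imp_deriv)
  then have "prime_form z \<tau> = (?C * (exp (z / 2) * (1 - exp (- z))) * ?E z) / (?C * ?E 0)"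
    using theta1_product[OF tau z] by (simp only: prime_form_def)
  also have "\<dots> = exp (z / 2) * (1 - exp (- z)) * (?E z / ?E 0)"
  proof -
    have "C * H * A / (C * B) = H * (A / B)" if "C \<noteq> 0" for A B C H :: complex
      using that by simp
    then show ?thesis by simp
  qed
  also have "?E z / ?E 0 = exp (qlog ?q (?q * exp z) + qlog ?q (?q * exp (- z)) - 2 * qlog ?q ?q)"
    by (simp add: exp_add exp_diff exp_double power2_eq_square)
  finally show ?thesis .
qed

text \<open>Two logarithms of the same function differ by a multiple of 2 pi i. Distinct multiples
  are at least 1 apart, so on the connected interval the continuous difference is constant.\<close>

lemma continuous_log_unique:
  fixes g h :: "real \<Rightarrow> complex"
  assumes g: "continuous_on {0..1} g" and h: "continuous_on {0..1} h" and start: "g 0 = h 0"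
    and eq: "\<And>t. t \<in> {0..1} \<Longrightarrow> exp (g t) = exp (h t)"
  shows "g 1 = h 1"
proof -
  have "(\<lambda>t. g t - h t) constant_on {0..1}"
  proof (rule continuous_discrete_range_constant)
    show "continuous_on {0..1} (\<lambda>t. g t - h t)" by (intro continuous_intros g h)
    fix t :: real assume t: "t \<in> {0..1}"
    have "1 \<le> norm ((g s - h s) - (g t - h t))" if s: "s \<in> {0..1}" "g s - h s \<noteq> g t - h t" for s
    proof -
      let ?d = "(g s - h s) - (g t - h t)"
      have "exp ?d = 1" using eq[OF t] eq[OF s(1)] by (simp add: exp_diff)
      then obtain m :: int where m: "Re ?d = 0" "Im ?d = of_int (2 * m) * pi"
        unfolding exp_eq_1 by blast
      have "m \<noteq> 0"
      proof
        assume "m = 0"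
        then have "?d = 0" using m by (simp only: complex_eq_iff) simp
        then show False using s(2) by simp
      qed
      then have "1 \<le> \<bar>real_of_int m\<bar>" by linarith
      moreover have "1 \<le> 2 * pi" using pi_ge_two by simp
      ultimately have "1 * 1 \<le> \<bar>real_of_int m\<bar> * (2 * pi)" by (intro mult_mono) auto
      also have "\<dots> = \<bar>Im ?d\<bar>" using m(2) by (simp add: abs_mult)
      also have "\<dots> \<le> norm ?d" by (rule abs_Im_le_cmod)
      finally show ?thesis by simp
    qed
    then show "\<exists>e>0. \<forall>s. s \<in> {0..1} \<and> g s - h s \<noteq> g t - h t \<longrightarrow> e \<le> norm ((g s - h s) - (g t - h t))"
      by (intro exI[of _ 1]) auto
  qed simp
  then obtain c where "\<And>t. t \<in> {0..1} \<Longrightarrow> g t - h t = c" by (auto simp: constant_on_def)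
  from this[of 0] this[of 1] start show ?thesis by simp
qed

text \<open>The prescribed power combines a principal power of z with a continued logarithm of K(z)
  / z. Both are made explicit, and their sum is matched with the series that the modes
  produce.\<close>

lemma prime_form_power_qlog:
  assumes tau: "Im \<tau> > 0" and z: "0 < Re z" "Re z < 2 * pi * Im \<tau>"
  shows "prime_form_power z \<tau> c = exp (c * (z / 2 + qlog (nome \<tau>) (exp (- z)) +
    qlog (nome \<tau>) (nome \<tau> * exp z) - 2 * qlog (nome \<tau>) (nome \<tau>)))"
proof -
  let ?q = "nome \<tau>"
  have q: "norm ?q < 1" by (rule norm_nome_less_1[OF tau])
  define S where "S u = qlog ?q (?q * exp u) + qlog ?q (?q * exp (- u)) - 2 * qlog ?q ?q" for u
  define r where "r u = (if u = 0 then 1 else (1 - exp (- u)) / u)" for u :: complex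
  \<comment> \<open>Along the segment K(u) / u = exp (u / 2) (r u) exp (S u). Each factor gets a
    continuous logarithm with value 0 at u = 0; by uniqueness their sum is the continued
    one.\<close>
  define g where "g t = of_real t * z / 2 + Ln (r (of_real t * z)) + S (of_real t * z)" for t :: real
  have Re1: "Re (1 - exp (- u)) > 0" if "Re u > 0" for u
  proof -
    have "norm (exp (- u)) < 1" using that by (simp add: norm_exp_eq_Re)
    then show ?thesis using complex_Re_le_cmod[of "exp (- u)"] by (simp del: norm_exp_eq_Re)
  qed
  \<comment> \<open>If (1 - exp (- u)) / u were a nonpositive real, then 1 - exp (- u) would have
    nonpositive real part. So the principal logarithm of \<open>r\<close> meets no branch
    cut.\<close>
  have r_nonpos: "r u \<notin> \<real>\<^sub>\<le>\<^sub>0" if "u = 0 \<or> Re u > 0" for u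
  proof (cases "u = 0")
    case False
    show ?thesis
    proof
      assume "r u \<in> \<real>\<^sub>\<le>\<^sub>0"
      then obtain x where x: "x \<le> 0" "r u = of_real x" by (auto elim: nonpos_Reals_cases)
      then have "1 - exp (- u) = of_real x * u" using False by (simp add: r_def field_simps)
      then have "Re (1 - exp (- u)) = x * Re u" by simp
      then show False using Re1[of u] x(1) that False mult_nonpos_nonneg[of x "Re u"] by auto
    qed
  qed (simp add: r_def)
  have r_cont: "isCont r u" for u
  proof (cases "u = 0")
    case True
    have "((\<lambda>u. 1 - exp (- u)) has_field_derivative 1) (at (0::complex))"
      by (auto intro!: derivative_eq_intros)
    then have "((\<lambda>u. (1 - exp (- u)) / u) \<longlongrightarrow> 1) (at (0::complex))"
      by (simp add: has_field_derivative_iff)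
    then have "(r \<longlongrightarrow> 1) (at 0)"
      by (rule Lim_transform_eventually) (auto simp: r_def eventually_at_filter)
    then show ?thesis using True by (simp add: isCont_def r_def)
  next
    case False
    have ev: "\<forall>\<^sub>F v in nhds u. (1 - exp (- v)) / v = r v"
      using False t1_space_nhds[of u 0] by (auto simp: r_def elim!: eventually_mono)
    have "isCont (\<lambda>v. (1 - exp (- v)) / v) u" using False by (intro continuous_intros) auto
    then show ?thesis by (rule iffD1[OF isCont_cong[OF ev]])
  qed
  have dom: "\<bar>Re (of_real t * z)\<bar> < 2 * pi * Im \<tau>" "of_real t * z = 0 \<or> Re (of_real t * z) > 0"
    if "t \<in> {0..1}" for t
  proof -
    have "t * Re z \<le> 1 * Re z" using that z(1) by (intro mult_right_mono) auto
    moreover have "0 \<le> t * Re z" "Re (of_real t * z) = t * Re z" using that z(1) by simp_all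
    ultimately show "\<bar>Re (of_real t * z)\<bar> < 2 * pi * Im \<tau>" using z by linarith
    show "of_real t * z = 0 \<or> Re (of_real t * z) > 0" using that z(1) by (cases "t = 0") auto
  qed
  have S_cont: "isCont S u" if "\<bar>Re u\<bar> < 2 * pi * Im \<tau>" for u
    unfolding S_def by (intro continuous_intros isCont_qlog_compose[OF q] norm_nome_exp that)
  have g_cont: "continuous_on {0..1} g"
  proof (intro continuous_at_imp_continuous_on ballI)
    fix t :: real assume t: "t \<in> {0..1}"
    have line: "isCont (\<lambda>t. of_real t * z) t" by (intro continuous_intros)
    show "isCont g t"
      unfolding g_def
      by (intro continuous_intros isCont_o2[OF line, of S] isCont_o2[OF line, of r] S_cont r_cont r_nonpos dom t) simp
  qed
  have g0: "g 0 = 0" by (simp add: g_def r_def S_def)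
  have ratio: "exp (u / 2 + Ln (r u) + S u) = prime_form_ratio u \<tau>"
    if "\<bar>Re u\<bar> < 2 * pi * Im \<tau>" "u = 0 \<or> Re u > 0" for u
  proof (cases "u = 0")
    case False
    have "r u \<noteq> 0" using r_nonpos[OF that(2)] by auto
    then have "exp (u / 2 + Ln (r u) + S u) = exp (u / 2) * r u * exp (S u)" by (simp add: exp_add)
    also have "\<dots> = prime_form u \<tau> / u"
      using False by (simp add: prime_form_product[OF tau that(1)] S_def r_def)
    finally show ?thesis using False by (simp add: prime_form_ratio_def)
  qed (simp add: prime_form_ratio_def r_def S_def)
  have "log_prime_form_ratio z \<tau> = g 1"
    unfolding log_prime_form_ratio_def
  proof (rule the_equality)
    have g_ratio: "exp (g t) = prime_form_ratio (of_real t * z) \<tau>" if "t \<in> {0..1}" for t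
      unfolding g_def by (rule ratio) (use dom[OF that] in blast)+
    then show "\<exists>g'. continuous_on {0..1 :: real} g' \<and> g' 0 = 0 \<and> g' 1 = g 1 \<and>
        (\<forall>t\<in>{0..1}. exp (g' t) = prime_form_ratio (of_real t * z) \<tau>)"
      using g_cont g0 by blast
    show "l = g 1" if "\<exists>g. continuous_on {0..1 :: real} g \<and> g 0 = 0 \<and> g 1 = l \<and>
        (\<forall>t\<in>{0..1}. exp (g t) = prime_form_ratio (of_real t * z) \<tau>)" for l
      using that continuous_log_unique[OF _ g_cont] g0 g_ratio by metis
  qed
  then have "log_prime_form_ratio z \<tau> = z / 2 + Ln (r z) + S z" by (simp add: g_def)
  \<comment> \<open>Both numbers lie in the right half plane, so the difference of their logarithms
    stays in the principal strip.\<close>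
  moreover have "Ln (r z) = Ln (1 - exp (- z)) - Ln z"
  proof -
    have z0: "z \<noteq> 0" "1 - exp (- z) \<noteq> 0" using z(1) Re1[OF z(1)] by auto
    have "\<bar>Im (Ln z)\<bar> < pi / 2" "\<bar>Im (Ln (1 - exp (- z)))\<bar> < pi / 2"
      by (intro Re_Ln_pos_lt_imp Re1 z(1))+
    then have "Ln (exp (Ln (1 - exp (- z)) - Ln z)) = Ln (1 - exp (- z)) - Ln z"
      by (intro Ln_exp) auto
    then show ?thesis using z0 by (simp add: exp_diff r_def)
  qed
  \<comment> \<open>This merges 1 - exp (- z) with the factors 1 - q^m exp (- z), m >= 1, into one
    \<open>qlog\<close>.\<close>
  moreover have "qlog ?q (exp (- z)) = Ln (1 - exp (- z)) + qlog ?q (?q * exp (- z))"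
    using z(1) by (intro qlog_shift[OF q]) (simp add: norm_exp_eq_Re)
  ultimately have "Ln z + log_prime_form_ratio z \<tau> =
      z / 2 + qlog ?q (exp (- z)) + qlog ?q (?q * exp z) - 2 * qlog ?q ?q"
    by (simp add: S_def)
  moreover have "z \<noteq> 0" using z(1) by auto
  then have "prime_form_power z \<tau> c = exp (c * (Ln z + log_prime_form_ratio z \<tau>))"
    by (simp add: prime_form_power_def powr_def distrib_left exp_add)
  ultimately show ?thesis by simp
qed

section \<open>Closed paths and occupation numbers\<close>

text \<open>Operator i has row i - 1 and column i, so it raises the charge from position i to
  position i - 1; along the path the charge goes down.\<close>

definition charge_at :: "complex \<Rightarrow> (nat \<Rightarrow> complex) \<Rightarrow> nat \<Rightarrow> complex" where
  "charge_at \<alpha> \<beta> i = \<alpha> - (\<Sum>j = 1..i. \<beta> j)"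

text \<open>
  The closed paths of nonzero weight: the charge drops by \<open>\<beta>\<^sub>i\<close> at step \<open>i\<close>, and the grading
  operator at the last step is diagonal.
\<close>

definition charged_loops :: "complex \<Rightarrow> (nat \<Rightarrow> complex) \<Rightarrow> nat \<Rightarrow> (nat \<Rightarrow> state) set" where
  "charged_loops \<alpha> \<beta> n =
    {s \<in> closed_paths \<alpha> (Suc n). (\<forall>i\<le>n. fst (s i) = charge_at \<alpha> \<beta> i) \<and> s n = s (Suc n)}"

text \<open>Transposes a path of multisets into a sequence of multiplicities for each mode. Position
  Suc n is dropped because on a charged loop it repeats position n.\<close>

definition occupation :: "nat \<Rightarrow> (nat \<Rightarrow> state) \<Rightarrow> nat \<Rightarrow> nat \<Rightarrow> nat" where
  "occupation n s k = (\<lambda>i\<in>{0..n}. count (snd (s i)) k)"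

definition vacuum_loop :: "nat \<Rightarrow> nat \<Rightarrow> nat" where
  "vacuum_loop n = (\<lambda>i\<in>{0..n}. 0)"

definition finite_occupations :: "nat \<Rightarrow> (nat \<Rightarrow> nat \<Rightarrow> nat) set" where
  "finite_occupations n =
    {g. (\<forall>k. g k \<in> loops n) \<and> g 0 = vacuum_loop n \<and> finite {k. g k \<noteq> vacuum_loop n}}"

lemma vacuum_loop_in_loops: "vacuum_loop n \<in> loops n"
  by (simp add: vacuum_loop_def loops_def)

lemma occupation_support:
  "{k. occupation n s k \<noteq> vacuum_loop n} = (\<Union>i\<in>{0..n}. set_mset (snd (s i)))"
  by (auto simp: occupation_def vacuum_loop_def fun_eq_iff restrict_def)

lemma charge_at_neutral: "(\<Sum>i = 1..n. \<beta> i) = 0 \<Longrightarrow> charge_at \<alpha> \<beta> n = \<alpha>"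
  by (simp add: charge_at_def)

lemma charge_at_Suc: "charge_at \<alpha> \<beta> i = charge_at \<alpha> \<beta> (Suc i) + \<beta> (Suc i)"
  by (simp add: charge_at_def)

text \<open>The charges of a charged loop are forced, so the multiplicities determine it. Neutrality
  brings the charge back to \<alpha> at position n, so that every family of loops does close to a
  path of states.\<close>

lemma bij_betw_occupation:
  assumes neutral: "(\<Sum>i = 1..n. \<beta> i) = 0"
  shows "bij_betw (occupation n) (charged_loops \<alpha> \<beta> n) (finite_occupations n)"
proof -
  define state_at where "state_at g i = (charge_at \<alpha> \<beta> i, Abs_multiset (\<lambda>k. g k i))" for g :: "nat \<Rightarrow> nat \<Rightarrow> nat" and i
  \<comment> \<open>Position Suc n, absent from the occupation numbers, copies position 0.\<close>
  define path_of where "path_of g = (\<lambda>i\<in>{0..Suc n}. state_at g (if i \<le> n then i else 0))" for g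
  have maps: "occupation n s \<in> finite_occupations n" if s: "s \<in> charged_loops \<alpha> \<beta> n" for s
  proof -
    have fock: "\<And>i. i \<le> n \<Longrightarrow> s i \<in> fock_basis" and closed: "s 0 = s n"
      using s by (auto simp: charged_loops_def closed_paths_def PiE_iff)
    have "occupation n s k \<in> loops n" for k
      using closed by (simp add: occupation_def loops_def)
    moreover have "occupation n s 0 = vacuum_loop n"
    proof
      fix i show "occupation n s 0 i = vacuum_loop n i"
        using fock[of i] by (simp add: occupation_def vacuum_loop_def fock_basis_def restrict_def not_in_iff)
    qed
    moreover have "finite {k. occupation n s k \<noteq> vacuum_loop n}"
      unfolding occupation_support by simp
    ultimately show ?thesis by (simp add: finite_occupations_def)
  qed
  have path: "path_of (occupation n s) = s" if s: "s \<in> charged_loops \<alpha> \<beta> n" for s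
  proof
    fix i
    have eq: "state_at (occupation n s) j = s j" if "j \<le> n" for j
    proof (rule prod_eqI)
      show "fst (state_at (occupation n s) j) = fst (s j)"
        using s that by (simp add: charged_loops_def state_at_def)
      show "snd (state_at (occupation n s) j) = snd (s j)"
        using that by (simp add: occupation_def count_inverse state_at_def)
    qed
    have last: "s (Suc n) = s 0" and ext: "i > Suc n \<Longrightarrow> s i = undefined"
      using s by (auto simp: charged_loops_def closed_paths_def PiE_iff extensional_def)
    consider "i \<le> n" | "i = Suc n" | "i > Suc n" by linarith
    then show "path_of (occupation n s) i = s i"
      by cases (simp_all add: path_of_def eq last ext)
  qed
  have inv: "occupation n (path_of g) = g \<and> path_of g \<in> charged_loops \<alpha> \<beta> n"
    if g: "g \<in> finite_occupations n" for g
  proof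
    have c: "count (snd (state_at g j)) = (\<lambda>k. g k j)" if "j \<le> n" for j
      unfolding state_at_def snd_conv
    proof (rule count_Abs_multiset)
      have "{k. 0 < g k j} \<subseteq> {k. g k \<noteq> vacuum_loop n}" using that by (auto simp: vacuum_loop_def)
      then show "finite {k. 0 < g k j}"
        using g finite_subset by (auto simp: finite_occupations_def)
    qed
    have loop: "g k n = g k 0" "i > n \<Longrightarrow> g k i = undefined" for k i
      using g by (auto simp: finite_occupations_def loops_def PiE_iff extensional_def)
    show "occupation n (path_of g) = g"
    proof (intro ext)
      fix k i show "occupation n (path_of g) k i = g k i"
        by (cases "i \<le> n") (simp_all add: occupation_def path_of_def c loop)
    qed
    have g0: "g 0 j = 0" if "j \<le> n" for j
      using g that by (simp add: finite_occupations_def vacuum_loop_def)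
    have "state_at g j \<in> fock_basis" if "j \<le> n" for j
      using c[OF that] g0[OF that] by (simp add: fock_basis_def not_in_iff)
    then have "path_of g \<in> closed_paths \<alpha> (Suc n)"
      by (simp add: closed_paths_def path_of_def) (simp add: state_at_def charge_at_def)
    moreover have "path_of g n = path_of g (Suc n)"
      using charge_at_neutral[OF neutral, of \<alpha>]
      by (simp add: path_of_def state_at_def loop) (simp add: charge_at_def)
    ultimately show "path_of g \<in> charged_loops \<alpha> \<beta> n"
      by (simp add: charged_loops_def path_of_def) (simp add: state_at_def)
  qed
  show ?thesis
    by (rule bij_betwI[where g=path_of]) (use maps path inv in auto)
qed

lemma torus_ops_intertwiner:
  "i \<le> n \<Longrightarrow> torus_ops n (\<lambda>i. e_vec (\<beta> i)) z \<tau> i =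
    intertwiner (op_exp (\<lambda>f s. z i * virasoro 0 f s) (e_vec (\<beta> i))) (z i)"
  by (simp add: torus_ops_def)

lemma torus_ops_grading:
  "torus_ops n v z \<tau> (Suc n) = op_exp (\<lambda>f s. 2 * pi * \<i> * \<tau> * (virasoro 0 f s - f s / 24))"
  by (simp add: torus_ops_def)

text \<open>If no factor vanished, the charge rule of the intertwiners and the diagonal grading
  operator would make the path a charged loop.\<close>

lemma path_weight_uncharged:
  assumes s: "s \<in> closed_paths \<alpha> (Suc n) - charged_loops \<alpha> \<beta> n"
  shows "path_weight (Suc n) (torus_ops n (\<lambda>i. e_vec (\<beta> i)) z \<tau>) s = 0"
proof -
  let ?A = "torus_ops n (\<lambda>i. e_vec (\<beta> i)) z \<tau>"
  have fock: "s i \<in> fock_basis" if "i \<le> Suc n" for i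
    using s that by (auto simp: closed_paths_def PiE_iff)
  have "\<exists>i\<in>{1..Suc n}. ?A i (ket (s i)) (s (i - 1)) = 0"
  proof (rule ccontr)
    assume "\<not> ?thesis"
    then have nz: "?A i (ket (s i)) (s (i - 1)) \<noteq> 0" if "i \<in> {1..Suc n}" for i using that by blast
    have step: "fst (s i) = fst (s (Suc i)) + \<beta> (Suc i)" if "Suc i \<le> n" for i
    proof (rule ccontr)
      assume ne: "\<not> ?thesis"
      obtain \<gamma> \<nu> where \<nu>: "s (Suc i) = (\<gamma>, \<nu>)" by (cases "s (Suc i)")
      obtain \<gamma>' \<mu> where \<mu>: "s i = (\<gamma>', \<mu>)" by (cases "s i")
      have "0 \<notin># \<nu>" using fock[of "Suc i"] that \<nu> by (simp add: fock_basis_def)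
      from intertwiner_entry[OF this, of "set_mset \<mu> \<union> set_mset \<nu>" \<mu> "z (Suc i)" "\<beta> (Suc i)" \<gamma> \<gamma>']
      have "?A (Suc i) (ket (s (Suc i))) (s i) = 0"
        using ne \<nu> \<mu> that by (simp add: torus_ops_intertwiner)
      then show False using nz[of "Suc i"] that by simp
    qed
    have "fst (s i) = charge_at \<alpha> \<beta> i" if "i \<le> n" for i
      using that
    proof (induction i)
      case 0
      then show ?case using s by (auto simp: closed_paths_def charge_at_def)
    next
      case (Suc i)
      then show ?case using step[of i] charge_at_Suc[of \<alpha> \<beta> i] by simp
    qed
    moreover have "s n = s (Suc n)"
    proof (rule ccontr)
      assume ne: "s n \<noteq> s (Suc n)"
      obtain \<gamma>' \<mu> where \<mu>: "s n = (\<gamma>', \<mu>)" by (cases "s n")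
      have "?A (Suc n) (ket (s (Suc n))) (s n) = 0"
        using ne unfolding torus_ops_grading \<mu> grading_entry by (simp add: ket_def)
      then show False using nz[of "Suc n"] by simp
    qed
    ultimately show False using s by (auto simp: charged_loops_def)
  qed
  then show ?thesis unfolding path_weight_def by (intro prod_zero) auto
qed

text \<open>One finite label set \<open>S\<close> serves all steps, so the products over steps and
  over modes can be exchanged; \<open>S\<close> is also the set of modes that leave the vacuum loop.
  The grading factor splits because q^degree is the product of the (q^k)^multiplicity.\<close>

lemma path_weight_charged:
  assumes s: "s \<in> charged_loops \<alpha> \<beta> n" and neutral: "(\<Sum>i = 1..n. \<beta> i) = 0"
  shows "path_weight (Suc n) (torus_ops n (\<lambda>i. e_vec (\<beta> i)) z \<tau>) s =
    (\<Prod>i = 1..n. exp (z i * (\<beta> i)\<^sup>2 / 2) * exp (\<beta> i * z i * charge_at \<alpha> \<beta> i)) *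
    exp (2 * pi * \<i> * \<tau> * (\<alpha>\<^sup>2 / 2 - 1 / 24)) *
    (\<Prod>k | occupation n s k \<noteq> vacuum_loop n.
      mode_path n (\<lambda>i. \<beta> i * exp (z i) ^ k / of_nat k) (\<lambda>i. - \<beta> i / exp (z i) ^ k) (occupation n s k) *
      (exp (2 * pi * \<i> * \<tau>) ^ k) ^ occupation n s k 0)"
proof -
  let ?A = "torus_ops n (\<lambda>i. e_vec (\<beta> i)) z \<tau>"
  let ?q = "exp (2 * pi * \<i> * \<tau>)"
  let ?x = "\<lambda>k i. \<beta> i * exp (z i) ^ k / of_nat k" and ?y = "\<lambda>k i. - \<beta> i / exp (z i) ^ k"
  define S where "S = (\<Union>i\<in>{0..n}. set_mset (snd (s i)))"
  have finS: "finite S" by (simp add: S_def)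
  have sub: "set_mset (snd (s i)) \<subseteq> S" if "i \<le> n" for i using that by (auto simp: S_def)
  have fock: "s i \<in> fock_basis" if "i \<le> Suc n" for i
    using s that by (auto simp: charged_loops_def closed_paths_def PiE_iff)
  have ch: "fst (s i) = charge_at \<alpha> \<beta> i" if "i \<le> n" for i
    using s that by (simp add: charged_loops_def)
  have closed: "s n = s (Suc n)" "s 0 = s n"
    using s by (auto simp: charged_loops_def closed_paths_def)
  have factor: "?A i (ket (s i)) (s (i - 1)) = exp (z i * (\<beta> i)\<^sup>2 / 2) * exp (\<beta> i * z i * charge_at \<alpha> \<beta> i) *
      (\<Prod>k\<in>S. mode_entry (?x k i) (?y k i) (occupation n s k (i - 1)) (occupation n s k i))"
    if i: "i \<in> {1..n}" for i
  proof -
    obtain \<nu> where \<nu>: "s i = (charge_at \<alpha> \<beta> i, \<nu>)" using ch[of i] i by (cases "s i") auto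
    have "fst (s (i - 1)) = charge_at \<alpha> \<beta> (i - 1)" using i by (intro ch) auto
    moreover have "charge_at \<alpha> \<beta> (i - 1) = charge_at \<alpha> \<beta> i + \<beta> i"
      using charge_at_Suc[of \<alpha> \<beta> "i - 1"] i by simp
    ultimately obtain \<mu> where \<mu>: "s (i - 1) = (charge_at \<alpha> \<beta> i + \<beta> i, \<mu>)"
      by (cases "s (i - 1)") auto
    have in_fock: "0 \<notin># \<nu>" using fock[of i] i \<nu> by (simp add: fock_basis_def)
    have "i - 1 \<le> n" "i \<le> n" using i by auto
    then have sets: "set_mset \<mu> \<subseteq> S" "set_mset \<nu> \<subseteq> S" using sub[of "i - 1"] sub[of i] \<mu> \<nu> by auto
    have T: "?A i = intertwiner (op_exp (\<lambda>f s. z i * virasoro 0 f s) (e_vec (\<beta> i))) (z i)"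
      using i by (intro torus_ops_intertwiner) simp
    have "?A i (ket (s i)) (s (i - 1)) = exp (z i * (\<beta> i)\<^sup>2 / 2) * exp (\<beta> i * z i * charge_at \<alpha> \<beta> i) *
        (\<Prod>k\<in>S. mode_entry (?x k i) (?y k i) (count \<mu> k) (count \<nu> k))"
      unfolding T \<mu> \<nu> intertwiner_entry[OF in_fock finS sets] by simp
    moreover have "occupation n s k (i - 1) = count \<mu> k" "occupation n s k i = count \<nu> k" for k
      using i \<mu> \<nu> by (auto simp: occupation_def)
    ultimately show ?thesis by simp
  qed
  have last: "?A (Suc n) (ket (s (Suc n))) (s n) =
      exp (2 * pi * \<i> * \<tau> * (\<alpha>\<^sup>2 / 2 - 1 / 24)) * (\<Prod>k\<in>S. (?q ^ k) ^ occupation n s k 0)"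
  proof -
    have sn: "s n = (\<alpha>, snd (s 0))"
      using ch[of n] charge_at_neutral[OF neutral, of \<alpha>] closed by (auto simp: prod_eq_iff)
    have "?q ^ sum_mset (snd (s 0)) = (\<Prod>k\<in>S. (?q ^ k) ^ occupation n s k 0)"
      using sum_mset_count[OF finS sub[of 0]]
      by (simp add: power_sum power_mult occupation_def)
    then show ?thesis
      unfolding torus_ops_grading closed(1)[symmetric] sn grading_entry by (simp add: ket_def)
  qed
  have "path_weight (Suc n) ?A s = (\<Prod>i = 1..n. ?A i (ket (s i)) (s (i - 1))) * ?A (Suc n) (ket (s (Suc n))) (s n)"
    by (simp add: path_weight_def)
  also have "(\<Prod>i = 1..n. ?A i (ket (s i)) (s (i - 1))) =
      (\<Prod>i = 1..n. exp (z i * (\<beta> i)\<^sup>2 / 2) * exp (\<beta> i * z i * charge_at \<alpha> \<beta> i)) *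
      (\<Prod>k\<in>S. mode_path n (?x k) (?y k) (occupation n s k))"
  proof -
    have swap: "(\<Prod>k\<in>S. mode_path n (?x k) (?y k) (occupation n s k)) =
        (\<Prod>i = 1..n. \<Prod>k\<in>S. mode_entry (?x k i) (?y k i) (occupation n s k (i - 1)) (occupation n s k i))"
      unfolding mode_path_def by (rule prod.swap)
    show ?thesis unfolding swap prod.distrib[symmetric] by (rule prod.cong[OF refl factor])
  qed
  finally show ?thesis
    unfolding last occupation_support S_def[symmetric] prod.distrib by (simp only: mult_ac)
qed

section \<open>The torus function\<close>

lemma double_sum_split:
  fixes F :: "nat \<Rightarrow> nat \<Rightarrow> 'a::comm_monoid_add"
  shows "(\<Sum>i = 1..n. \<Sum>j = 1..n. F i j) =
    (\<Sum>i = 1..n. F i i) + (\<Sum>j = 1..n. \<Sum>i = 1..<j. F i j + F j i)"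
proof (induction n)
  case (Suc n)
  have "(\<Sum>i = 1..Suc n. \<Sum>j = 1..Suc n. F i j) =
      (\<Sum>i = 1..n. \<Sum>j = 1..n. F i j) + (\<Sum>i = 1..n. F i (Suc n)) + ((\<Sum>j = 1..n. F (Suc n) j) + F (Suc n) (Suc n))"
    by (simp add: sum.distrib add_ac)
  then show ?case
    using Suc by (simp add: sum.distrib atLeastLessThanSuc_atLeastAtMost add_ac)
qed simp

text \<open>Expand 0 = (sum of \<beta>_i) (sum of \<beta>_j c_j) and separate the diagonal: this
  trades squares for pair products.\<close>

lemma neutral_cross_terms:
  fixes \<beta> c :: "nat \<Rightarrow> complex"
  assumes "(\<Sum>i = 1..n. \<beta> i) = 0"
  shows "(\<Sum>i = 1..n. \<beta> i * \<beta> i * c i) = - (\<Sum>j = 1..n. \<Sum>i = 1..<j. \<beta> i * \<beta> j * (c i + c j))"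
proof -
  have "0 = (\<Sum>i = 1..n. \<Sum>j = 1..n. \<beta> i * (\<beta> j * c j))"
    unfolding sum_product[symmetric] assms by simp
  also have "\<dots> = (\<Sum>i = 1..n. \<beta> i * (\<beta> i * c i)) + (\<Sum>j = 1..n. \<Sum>i = 1..<j. \<beta> i * (\<beta> j * c j) + \<beta> j * (\<beta> i * c i))"
    by (rule double_sum_split)
  also have "(\<Sum>j = 1..n. \<Sum>i = 1..<j. \<beta> i * (\<beta> j * c j) + \<beta> j * (\<beta> i * c i)) =
      (\<Sum>j = 1..n. \<Sum>i = 1..<j. \<beta> i * \<beta> j * (c i + c j))"
    by (intro sum.cong refl) (simp add: algebra_simps)
  finally have "(\<Sum>i = 1..n. \<beta> i * (\<beta> i * c i)) + (\<Sum>j = 1..n. \<Sum>i = 1..<j. \<beta> i * \<beta> j * (c i + c j)) = 0" by simp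
  then show ?thesis by (simp add: eq_neg_iff_add_eq_0 mult.assoc)
qed

text \<open>The coefficient of \<beta>_i^2 z_i is 1/2 from the conformal weight minus 1 from the
  charge. Neutrality turns -1/2 into (z_i + z_j) / 2 for each pair; subtracting the remaining z_j
  leaves the half difference that the prime form needs.\<close>

lemma charge_exponent:
  fixes \<beta> z :: "nat \<Rightarrow> complex"
  assumes neutral: "(\<Sum>i = 1..n. \<beta> i) = 0"
  shows "(\<Prod>i = 1..n. exp (z i * (\<beta> i)\<^sup>2 / 2) * exp (\<beta> i * z i * charge_at \<alpha> \<beta> i)) =
    exp (\<alpha> * (\<Sum>i = 1..n. \<beta> i * z i)) * exp (\<Sum>j = 1..n. \<Sum>i = 1..<j. \<beta> i * \<beta> j * ((z i - z j) / 2))"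
proof -
  have partial: "(\<Sum>j = 1..i. \<beta> j) = (\<Sum>j = 1..<i. \<beta> j) + \<beta> i" if "i \<in> {1..n}" for i
    using that by (cases i) (simp_all add: atLeastLessThanSuc_atLeastAtMost)
  have "(\<Sum>i = 1..n. z i * (\<beta> i)\<^sup>2 / 2 + \<beta> i * z i * charge_at \<alpha> \<beta> i) =
      (\<Sum>i = 1..n. \<alpha> * (\<beta> i * z i) + (- 1 / 2) * (\<beta> i * \<beta> i * z i) - (\<Sum>j = 1..<i. \<beta> j * \<beta> i * z i))"
    unfolding charge_at_def
  proof (rule sum.cong[OF refl])
    fix i assume i: "i \<in> {1..n}"
    have "(\<Sum>j = 1..<i. \<beta> j * \<beta> i * z i) = (\<Sum>j = 1..<i. \<beta> j) * \<beta> i * z i"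
      by (simp add: sum_distrib_right)
    then show "z i * (\<beta> i)\<^sup>2 / 2 + \<beta> i * z i * (\<alpha> - (\<Sum>j = 1..i. \<beta> j)) =
        \<alpha> * (\<beta> i * z i) + (- 1 / 2) * (\<beta> i * \<beta> i * z i) - (\<Sum>j = 1..<i. \<beta> j * \<beta> i * z i)"
      unfolding partial[OF i] by (simp only: power2_eq_square) (simp add: algebra_simps)
  qed
  also have "\<dots> = \<alpha> * (\<Sum>i = 1..n. \<beta> i * z i) + (- 1 / 2) * (\<Sum>i = 1..n. \<beta> i * \<beta> i * z i) -
      (\<Sum>j = 1..n. \<Sum>i = 1..<j. \<beta> i * \<beta> j * z j)"
    by (simp only: sum.distrib sum_subtractf sum_distrib_left)
  also have "\<dots> = \<alpha> * (\<Sum>i = 1..n. \<beta> i * z i) +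
      (\<Sum>j = 1..n. \<Sum>i = 1..<j. (1 / 2) * (\<beta> i * \<beta> j * (z i + z j)) - \<beta> i * \<beta> j * z j)"
    unfolding neutral_cross_terms[OF neutral]
    by (simp only: sum_subtractf sum_distrib_left[symmetric]) simp
  also have "(\<Sum>j = 1..n. \<Sum>i = 1..<j. (1 / 2) * (\<beta> i * \<beta> j * (z i + z j)) - \<beta> i * \<beta> j * z j) =
      (\<Sum>j = 1..n. \<Sum>i = 1..<j. \<beta> i * \<beta> j * ((z i - z j) / 2))"
    by (intro sum.cong refl) (simp add: field_simps)
  finally show ?thesis
    by (simp only: exp_add[symmetric] exp_sum[OF finite_atLeastAtMost, symmetric])
qed

text \<open>The first sum is the reordering cocycle, the second the trace term. Its diagonal does
  not depend on the points, so neutrality turns it into the constant -2 in each pair.\<close>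

lemma mode_exponent:
  fixes \<beta> w :: "nat \<Rightarrow> complex" and t :: complex
  assumes neutral: "(\<Sum>i = 1..n. \<beta> i) = 0" and w: "\<And>i. w i \<noteq> 0" and t: "1 - t ^ k \<noteq> 0"
  shows "(\<Sum>j = 1..n. \<Sum>i = 1..<j. - \<beta> i / w i ^ k * (\<beta> j * w j ^ k / of_nat k)) +
      (\<Sum>i = 1..n. \<beta> i * w i ^ k / of_nat k) * (\<Sum>i = 1..n. - \<beta> i / w i ^ k) * t ^ k / (1 - t ^ k) =
    (\<Sum>j = 1..n. \<Sum>i = 1..<j. \<beta> i * \<beta> j * (- 1 / (of_nat k * (1 - t ^ k)) * (w j / w i) ^ k +
      - 1 / (of_nat k * (1 - t ^ k)) * (t * (w i / w j)) ^ k - 2 * (- 1 / (of_nat k * (1 - t ^ k)) * t ^ k)))"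
proof -
  let ?K = "of_nat k :: complex" and ?T = "t ^ k"
  let ?u = "\<lambda>i j. (w j / w i) ^ k"
  have entry: "\<beta> j * w j ^ k / ?K * (- \<beta> i / w i ^ k) = - \<beta> i * \<beta> j * ?u i j / ?K" for i j
    using w by (simp add: power_divide mult_ac)
  have "(\<Sum>i = 1..n. \<beta> i * w i ^ k / ?K) * (\<Sum>i = 1..n. - \<beta> i / w i ^ k) =
      (\<Sum>j = 1..n. \<Sum>i = 1..n. - \<beta> i * \<beta> j * ?u i j / ?K)"
    unfolding sum_product entry by (rule refl)
  also have "\<dots> = (\<Sum>i = 1..n. - \<beta> i * \<beta> i * ?u i i / ?K) +
      (\<Sum>j = 1..n. \<Sum>i = 1..<j. - \<beta> j * \<beta> i * ?u j i / ?K + - \<beta> i * \<beta> j * ?u i j / ?K)"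
    by (rule double_sum_split)
  also have "(\<Sum>i = 1..n. - \<beta> i * \<beta> i * ?u i i / ?K) = (\<Sum>i = 1..n. \<beta> i * \<beta> i * (- 1 / ?K))"
    using w by (intro sum.cong refl) (simp add: field_simps)
  also have "\<dots> = - (\<Sum>j = 1..n. \<Sum>i = 1..<j. \<beta> i * \<beta> j * (- 1 / ?K + - 1 / ?K))"
    by (rule neutral_cross_terms[OF neutral])
  finally have XY: "(\<Sum>i = 1..n. \<beta> i * w i ^ k / ?K) * (\<Sum>i = 1..n. - \<beta> i / w i ^ k) =
      (\<Sum>j = 1..n. \<Sum>i = 1..<j. - \<beta> i * \<beta> j / ?K * (?u j i + ?u i j - 2))"
    by (simp only: sum_negf[symmetric] sum.distrib[symmetric])
      (auto intro!: sum.cong simp: diff_divide_distrib add_divide_distrib algebra_simps)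
  have elt: "- \<beta> i / w i ^ k * (\<beta> j * w j ^ k / ?K) + - \<beta> i * \<beta> j / ?K * (?u j i + ?u i j - 2) * ?T / (1 - ?T) =
      \<beta> i * \<beta> j * (- 1 / (?K * (1 - ?T)) * ?u i j + - 1 / (?K * (1 - ?T)) * (t * (w i / w j)) ^ k
        - 2 * (- 1 / (?K * (1 - ?T)) * ?T))" for i j
  proof -
    \<comment> \<open>The cocycle U / K and the trace term U T / (K (1 - T)) add up to U / (K (1 -
      T)).\<close>
    have main: "- b * U / K + - b / K * (V + U - 2) * T / (1 - T) =
        b * (- 1 / (K * (1 - T)) * U + - 1 / (K * (1 - T)) * (T * V) - 2 * (- 1 / (K * (1 - T)) * T))"
      if "1 - T \<noteq> 0" for b K U V T :: complex
    proof (cases "K = 0")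
      case False
      then show ?thesis using that by (simp add: divide_simps) (simp add: algebra_simps)
    qed simp
    have "- \<beta> i / w i ^ k * (\<beta> j * w j ^ k / ?K) = - (\<beta> i * \<beta> j) * ?u i j / ?K"
      using entry[of j i] by (simp add: mult_ac)
    moreover have "(t * (w i / w j)) ^ k = ?T * ?u j i" by (rule power_mult_distrib)
    ultimately show ?thesis using main[OF t, of "\<beta> i * \<beta> j" "?u i j" ?K "?u j i"] by simp
  qed
  show ?thesis
    unfolding XY unfolding sum_distrib_right sum_divide_distrib sum.distrib[symmetric] elt by (rule refl)
qed

lemma mode_path_vacuum_loop: "mode_path n x y (vacuum_loop n) = 1"
proof -
  have "vacuum_loop n i = 0" if "i \<le> n" for i using that by (simp add: vacuum_loop_def)
  then show ?thesis
    unfolding mode_path_def by (intro prod.neutral) (auto simp: mode_entry_def creation_entry_def)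
qed

text \<open>Each factor is at most exp (G k) with \<open>G\<close> a finite sum of geometric series.
  The partition function contributes the ratio |q|, the cocycles |w_j / w_i| for i < j, and the
  trace |q w_j / w_i| for all i and j, because closing the path lets every pair meet in both
  orders.\<close>

lemma loop_sums_bounded:
  fixes \<beta> w :: "nat \<Rightarrow> complex" and q :: complex
  assumes q: "norm q < 1"
    and u: "\<And>i j. 1 \<le> i \<Longrightarrow> i < j \<Longrightarrow> j \<le> n \<Longrightarrow> norm (w j / w i) < 1"
    and qu: "\<And>i j. i \<in> {1..n} \<Longrightarrow> j \<in> {1..n} \<Longrightarrow> norm (q * (w j / w i)) < 1"
  defines "X \<equiv> \<lambda>k i. norm (\<beta> i * w i ^ k / of_nat k)" and "Y \<equiv> \<lambda>k i. norm (- \<beta> i / w i ^ k)"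
  shows "\<exists>D. \<forall>K. (\<Prod>k = 1..K. 1 / (1 - norm (q ^ k)) * exp ((\<Sum>j = 1..n. \<Sum>i = 1..<j. Y k i * X k j) +
    (\<Sum>i = 1..n. X k i) * (\<Sum>i = 1..n. Y k i) * norm (q ^ k) / (1 - norm (q ^ k)))) \<le> D"
proof -
  define R where "R = norm q"
  have R: "0 \<le> R" "R < 1" using q by (auto simp: R_def)
  define b where "b i j = norm (\<beta> i) * norm (\<beta> j)" for i j
  define G where "G k = R ^ k / (1 - R) + ((\<Sum>j = 1..n. \<Sum>i = 1..<j. b i j * norm (w j / w i) ^ k) +
    (\<Sum>j = 1..n. \<Sum>i = 1..n. b i j * norm (q * (w j / w i)) ^ k / (1 - R)))" for k
  have b0: "0 \<le> b i j" for i j by (simp add: b_def)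
  have YX: "Y k i * X k j \<le> b i j * norm (w j / w i) ^ k" for k i j
  proof -
    have "Y k i * X k j = b i j * norm (w j / w i) ^ k / of_nat k"
      by (simp add: X_def Y_def b_def norm_divide norm_mult norm_power power_divide mult_ac)
    also have "\<dots> \<le> b i j * norm (w j / w i) ^ k"
    proof (cases "k = 0")
      case False
      then have "b i j * norm (w j / w i) ^ k / of_nat k \<le> b i j * norm (w j / w i) ^ k / 1"
        by (intro divide_left_mono mult_nonneg_nonneg b0) auto
      then show ?thesis by simp
    qed (simp add: b0)
    finally show ?thesis .
  qed
  have bound: "1 / (1 - norm (q ^ k)) * exp ((\<Sum>j = 1..n. \<Sum>i = 1..<j. Y k i * X k j) +
    (\<Sum>i = 1..n. X k i) * (\<Sum>i = 1..n. Y k i) * norm (q ^ k) / (1 - norm (q ^ k))) \<le> exp (G k)"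
    if k: "k \<ge> 1" for k
  proof -
    define r where "r = R ^ k"
    have "R ^ k \<le> R ^ 1" using R k by (intro power_decreasing) auto
    then have r: "0 \<le> r" "r \<le> R" using R by (auto simp: r_def)
    have frac: "r / (1 - r) \<le> r / (1 - R)"
      using r R by (intro divide_left_mono mult_pos_pos) auto
    have "1 / (1 - r) = 1 + r / (1 - r)" using r R by (simp add: field_simps)
    also have "\<dots> \<le> exp (r / (1 - r))" by (rule exp_ge_add_one_self)
    also have "\<dots> \<le> exp (r / (1 - R))" using frac by simp
    finally have 1: "1 / (1 - r) \<le> exp (r / (1 - R))" .
    have 2: "(\<Sum>j = 1..n. \<Sum>i = 1..<j. Y k i * X k j) \<le> (\<Sum>j = 1..n. \<Sum>i = 1..<j. b i j * norm (w j / w i) ^ k)"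
      by (intro sum_mono YX)
    have "(\<Sum>i = 1..n. X k i) * (\<Sum>i = 1..n. Y k i) * r / (1 - r) =
        (\<Sum>j = 1..n. \<Sum>i = 1..n. Y k i * X k j) * (r / (1 - r))"
      by (simp add: sum_product mult_ac)
    also have "\<dots> \<le> (\<Sum>j = 1..n. \<Sum>i = 1..n. b i j * norm (w j / w i) ^ k) * (r / (1 - R))"
      using r R by (intro mult_mono sum_mono YX frac sum_nonneg mult_nonneg_nonneg b0) auto
    also have "\<dots> = (\<Sum>j = 1..n. \<Sum>i = 1..n. b i j * norm (q * (w j / w i)) ^ k / (1 - R))"
      unfolding sum_distrib_right
      by (intro sum.cong refl)
        (simp only: norm_mult[of q] power_mult_distrib, simp only: r_def R_def times_divide_eq_right mult_ac)
    finally have 3: "(\<Sum>i = 1..n. X k i) * (\<Sum>i = 1..n. Y k i) * r / (1 - r) \<le>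
        (\<Sum>j = 1..n. \<Sum>i = 1..n. b i j * norm (q * (w j / w i)) ^ k / (1 - R))" .
    have "norm (q ^ k) = r" by (simp add: r_def R_def norm_power)
    moreover have "exp (G k) = exp (r / (1 - R)) *
        exp ((\<Sum>j = 1..n. \<Sum>i = 1..<j. b i j * norm (w j / w i) ^ k) +
          (\<Sum>j = 1..n. \<Sum>i = 1..n. b i j * norm (q * (w j / w i)) ^ k / (1 - R)))"
      unfolding G_def r_def by (rule exp_add)
    moreover have "1 / (1 - r) * exp E \<le> exp (r / (1 - R)) * exp E'" if "E \<le> E'" for E E'
      using that 1 by (intro mult_mono) auto
    ultimately show ?thesis using add_mono[OF 2 3] by (simp only:)
  qed
  have G0: "0 \<le> G k" for k
    unfolding G_def using R by (intro add_nonneg_nonneg sum_nonneg divide_nonneg_nonneg mult_nonneg_nonneg b0) auto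
  have "summable G"
    unfolding G_def using R u qu
    by (intro summable_add summable_sum summable_divide summable_mult summable_geometric) auto
  have "(\<Prod>k = 1..K. 1 / (1 - norm (q ^ k)) * exp ((\<Sum>j = 1..n. \<Sum>i = 1..<j. Y k i * X k j) +
      (\<Sum>i = 1..n. X k i) * (\<Sum>i = 1..n. Y k i) * norm (q ^ k) / (1 - norm (q ^ k)))) \<le> exp (suminf G)" for K
  proof -
    have nonneg: "0 \<le> 1 / (1 - norm (q ^ k)) * exp E" for k and E :: real
      using R power_le_one[of R k] by (simp add: norm_power R_def)
    have "(\<Prod>k = 1..K. 1 / (1 - norm (q ^ k)) * exp ((\<Sum>j = 1..n. \<Sum>i = 1..<j. Y k i * X k j) +
      (\<Sum>i = 1..n. X k i) * (\<Sum>i = 1..n. Y k i) * norm (q ^ k) / (1 - norm (q ^ k)))) \<le> (\<Prod>k = 1..K. exp (G k))"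
      by (intro prod_mono conjI nonneg bound) simp
    also have "\<dots> = exp (\<Sum>k = 1..K. G k)" by (simp add: exp_sum)
    also have "\<dots> \<le> exp (suminf G)"
      using \<open>summable G\<close> G0 by (auto intro: sum_le_suminf)
    finally show ?thesis .
  qed
  then show ?thesis by blast
qed

text \<open>The hypothesis \<open>ordering\<close> places all points in one annulus, |q_1| > ... >
  |q_n| > |q q_1|, where the products and the trace converge absolutely. For a pair it says 0 < Re
  (z_r - z_s) < 2 pi Im \<tau>, which is also the strip where the continued logarithm is
  determined.\<close>

theorem proposition4p1:
  fixes \<alpha> \<tau> :: complex and n :: nat and \<beta> z :: "nat \<Rightarrow> complex"
  assumes tau: "Im \<tau> > 0"
    and neutral: "(\<Sum>i = 1..n. \<beta> i) = 0"
    and ordering: "\<And>r s. 1 \<le> r \<Longrightarrow> r < s \<Longrightarrow> s \<le> n \<Longrightarrow>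
      norm (exp (z s)) < norm (exp (z r)) \<and>
      norm (exp (2 * pi * \<i> * \<tau>) * exp (z r)) < norm (exp (z s))"
  shows "torus_converges \<alpha> n (\<lambda>i. e_vec (\<beta> i)) z \<tau> \<and>
    torus_function \<alpha> n (\<lambda>i. e_vec (\<beta> i)) z \<tau> =
      exp (2 * pi * \<i> * \<tau> * (\<alpha>\<^sup>2 / 2)) / dedekind_eta \<tau> *
      exp (\<alpha> * (\<Sum>i = 1..n. \<beta> i * z i)) *
      (\<Prod>(r, s)\<in>{(r, s). 1 \<le> r \<and> r < s \<and> s \<le> n}.
         prime_form_power (z r - z s) \<tau> (\<beta> r * \<beta> s))"
proof -
  let ?A = "torus_ops n (\<lambda>i. e_vec (\<beta> i)) z \<tau>"
  define q where "q = nome \<tau>"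
  define w where "w i = exp (z i)" for i
  have q: "norm q < 1" "q \<noteq> 0" by (simp_all add: q_def norm_nome_less_1 tau nome_nonzero)
  have w0: "w i \<noteq> 0" for i by (simp add: w_def)
  have w_ratio: "w j / w i = exp (- (z i - z j))" "w i / w j = exp (z i - z j)" for i j
    by (simp_all add: w_def exp_diff exp_minus)
  have strip: "0 < Re (z r - z s)" "Re (z r - z s) < 2 * pi * Im \<tau>" if "1 \<le> r" "r < s" "s \<le> n" for r s
    using ordering[OF that] by (simp_all add: norm_mult norm_exp_eq_Re flip: exp_add)
  have qpow: "norm (q ^ k) < 1" if "k \<ge> 1" for k
    using q that by (simp add: norm_power power_less_one_iff)
  define f where "f k c = mode_path n (\<lambda>i. \<beta> i * w i ^ k / of_nat k) (\<lambda>i. - \<beta> i / w i ^ k) c * (q ^ k) ^ c 0" for k c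
  define h where "h k c = mode_path n (\<lambda>i. norm (\<beta> i * w i ^ k / of_nat k)) (\<lambda>i. norm (- \<beta> i / w i ^ k)) c *
    norm (q ^ k) ^ c 0" for k c
  define H where "H k = 1 / (1 - norm (q ^ k)) *
    exp ((\<Sum>j = 1..n. \<Sum>i = 1..<j. norm (- \<beta> i / w i ^ k) * norm (\<beta> j * w j ^ k / of_nat k)) +
      (\<Sum>i = 1..n. norm (\<beta> i * w i ^ k / of_nat k)) * (\<Sum>i = 1..n. norm (- \<beta> i / w i ^ k)) *
        norm (q ^ k) / (1 - norm (q ^ k)))" for k
  \<comment> \<open>The contribution of mode \<open>k\<close> to the coefficient of \<beta>_i
    \<beta>_j; summed over \<open>k\<close> its three parts are the \<open>qlog\<close> series of
    \<open>L i j\<close>.\<close>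
  define a where "a i j k = - 1 / (of_nat k * (1 - q ^ k)) * (exp (- (z i - z j))) ^ k +
      - 1 / (of_nat k * (1 - q ^ k)) * (q * exp (z i - z j)) ^ k -
      2 * (- 1 / (of_nat k * (1 - q ^ k)) * q ^ k)" for i j k
  define T where "T k = 1 / (1 - q ^ k) * exp (\<Sum>j = 1..n. \<Sum>i = 1..<j. \<beta> i * \<beta> j * a i j k)" for k
  define L where "L i j = qlog q (exp (- (z i - z j))) + qlog q (q * exp (z i - z j)) - 2 * qlog q q" for i j
  have sums: "(f k has_sum T k) (loops n)" "(h k has_sum H k) (loops n)" if k: "k \<ge> 1" for k
  proof -
    have "1 - q ^ k \<noteq> 0" using qpow[OF k] by auto
    note exponent = mode_exponent[where k=k and w=w and t=q, OF neutral w0 this]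
    show "(f k has_sum T k) (loops n)"
      using conjunct1[OF loops_has_sum[OF qpow[OF k], of n "\<lambda>i. \<beta> i * w i ^ k / of_nat k" "\<lambda>i. - \<beta> i / w i ^ k"]]
      unfolding exponent unfolding f_def T_def a_def w_ratio(1) minus_diff_eq .
    show "(h k has_sum H k) (loops n)"
      using conjunct2[OF loops_has_sum[OF qpow[OF k], of n "\<lambda>i. \<beta> i * w i ^ k / of_nat k" "\<lambda>i. - \<beta> i / w i ^ k"]]
      unfolding h_def H_def .
  qed
  have small: "norm (w j / w i) < 1" if "1 \<le> i" "i < j" "j \<le> n" for i j
    unfolding w_ratio using strip[OF that] by (simp add: norm_exp_eq_Re)
  have small': "norm (q * (w i / w j)) < 1" if "1 \<le> i" "i < j" "j \<le> n" for i j
    unfolding w_ratio q_def using strip[OF that] by (intro norm_nome_exp) simp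
  \<comment> \<open>For i < j this follows from the first half of \<open>ordering\<close> and |q| <
    1, for i = j from |q| < 1 alone, for j < i from the second half.\<close>
  have "norm (q * (w j / w i)) < 1" if "i \<in> {1..n}" "j \<in> {1..n}" for i j
  proof -
    consider "i < j" | "i = j" | "j < i" by linarith
    then show ?thesis
    proof cases
      case 1
      have "norm q * norm (w j / w i) \<le> norm q * 1"
        using small[of i j] 1 that by (intro mult_left_mono) auto
      then show ?thesis unfolding norm_mult[of q] using q(1) by linarith
    next
      case 2
      then show ?thesis using q w0 by simp
    next
      case 3
      then show ?thesis using small'[of j i] that by simp
    qed
  qed
  then obtain D where D: "\<And>K. (\<Prod>k = 1..K. H k) \<le> D"
    using loop_sums_bounded[where \<beta>=\<beta> and w=w and n=n, OF q(1) small] unfolding H_def by blast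
  have "(\<lambda>K. \<Sum>k = 1..K. a i j k) \<longlonglongrightarrow> L i j" if "1 \<le> i" "i < j" "j \<le> n" for i j
  proof -
    have "(\<lambda>k. a i j k) sums L i j"
      unfolding a_def L_def minus_diff_eq
      using small[OF that] small'[OF that] unfolding w_ratio(1) minus_diff_eq
      by (intro sums_add sums_diff sums_mult qlog_sums q)
    then have "(\<lambda>K. \<Sum>k<Suc K. a i j k) \<longlonglongrightarrow> L i j" unfolding sums_def by (rule LIMSEQ_Suc)
    \<comment> \<open>The power series start at k = 0, where the term is 0 because 1 / 0 = 0; the
      modes start at k = 1.\<close>
    moreover have "(\<Sum>k<Suc K. a i j k) = (\<Sum>k = 1..K. a i j k)" for K
    proof (rule sum.mono_neutral_right)
      have "a i j 0 = 0" by (simp add: a_def)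
      moreover have "k = 0" if "k \<in> {..<Suc K} - {1..K}" for k using that by auto
      ultimately show "\<forall>k\<in>{..<Suc K} - {1..K}. a i j k = 0" by metis
    qed auto
    ultimately show ?thesis by simp
  qed
  then have "(\<lambda>K. 1 / (\<Prod>k = 1..K. 1 - q ^ k) * exp (\<Sum>j = 1..n. \<Sum>i = 1..<j. \<beta> i * \<beta> j * (\<Sum>k = 1..K. a i j k))) \<longlonglongrightarrow>
      1 / exp (qlog q q) * exp (\<Sum>j = 1..n. \<Sum>i = 1..<j. \<beta> i * \<beta> j * L i j)"
    by (intro tendsto_mult tendsto_divide tendsto_exp tendsto_sum tendsto_const euler_product_tendsto q) auto
  moreover have "1 / (\<Prod>k = 1..K. 1 - q ^ k) * exp (\<Sum>j = 1..n. \<Sum>i = 1..<j. \<beta> i * \<beta> j * (\<Sum>k = 1..K. a i j k)) =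
      (\<Prod>k = 1..K. T k)" for K
  proof -
    have "(\<Sum>j = 1..n. \<Sum>i = 1..<j. \<beta> i * \<beta> j * (\<Sum>k = 1..K. a i j k)) =
        (\<Sum>j = 1..n. \<Sum>k = 1..K. \<Sum>i = 1..<j. \<beta> i * \<beta> j * a i j k)"
      unfolding sum_distrib_left by (intro sum.cong refl sum.swap)
    also have "\<dots> = (\<Sum>k = 1..K. \<Sum>j = 1..n. \<Sum>i = 1..<j. \<beta> i * \<beta> j * a i j k)"
      by (rule sum.swap)
    finally show ?thesis
      by (simp add: T_def prod.distrib prod_dividef exp_sum)
  qed
  ultimately have lim: "(\<lambda>K. \<Prod>k = 1..K. T k) \<longlonglongrightarrow>
      1 / exp (qlog q q) * exp (\<Sum>j = 1..n. \<Sum>i = 1..<j. \<beta> i * \<beta> j * L i j)" by simp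
  have vac: "f k (vacuum_loop n) = 1" "h k (vacuum_loop n) = 1" for k
    by (simp_all add: f_def h_def mode_path_vacuum_loop) (simp_all add: vacuum_loop_def)
  have dom: "norm (f k c) \<le> h k c" for k c
    unfolding f_def h_def norm_mult[of "mode_path n _ _ c"] norm_power[of "q ^ k"]
    by (intro mult_right_mono norm_mode_path_le) simp
  have "((\<lambda>g. \<Prod>k | g k \<noteq> vacuum_loop n. f k (g k)) has_sum
      1 / exp (qlog q q) * exp (\<Sum>j = 1..n. \<Sum>i = 1..<j. \<beta> i * \<beta> j * L i j)) (finite_occupations n)"
    unfolding finite_occupations_def
    by (rule has_sum_finite_support[where h=h, OF vacuum_loop_in_loops vac(1) vac(2) sums(1) sums(2) dom D lim])
  then have occ: "((\<lambda>s. \<Prod>k | occupation n s k \<noteq> vacuum_loop n. f k (occupation n s k)) has_sum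
      1 / exp (qlog q q) * exp (\<Sum>j = 1..n. \<Sum>i = 1..<j. \<beta> i * \<beta> j * L i j)) (charged_loops \<alpha> \<beta> n)"
    using has_sum_reindex_bij_betw[OF bij_betw_occupation[OF neutral, of \<alpha>],
        of "\<lambda>g. \<Prod>k | g k \<noteq> vacuum_loop n. f k (g k)"] by simp
  define C where "C = (\<Prod>i = 1..n. exp (z i * (\<beta> i)\<^sup>2 / 2) * exp (\<beta> i * z i * charge_at \<alpha> \<beta> i)) *
    exp (2 * pi * \<i> * \<tau> * (\<alpha>\<^sup>2 / 2 - 1 / 24))"
  have weight: "path_weight (Suc n) ?A s = C * (\<Prod>k | occupation n s k \<noteq> vacuum_loop n. f k (occupation n s k))"
    if "s \<in> charged_loops \<alpha> \<beta> n" for s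
    unfolding path_weight_charged[OF that neutral] C_def f_def w_def q_def nome_def by (rule refl)
  define V where "V = 1 / exp (qlog q q) * exp (\<Sum>j = 1..n. \<Sum>i = 1..<j. \<beta> i * \<beta> j * L i j)"
  have "((\<lambda>s. C * (\<Prod>k | occupation n s k \<noteq> vacuum_loop n. f k (occupation n s k))) has_sum C * V) (charged_loops \<alpha> \<beta> n)"
    unfolding V_def by (rule has_sum_cmult_right[OF occ])
  then have "(path_weight (Suc n) ?A has_sum C * V) (charged_loops \<alpha> \<beta> n)"
    by (rule iffD2[OF has_sum_cong, rotated]) (erule weight)
  moreover have "(path_weight (Suc n) ?A has_sum C * V) (charged_loops \<alpha> \<beta> n) \<longleftrightarrow>
      (path_weight (Suc n) ?A has_sum C * V) (closed_paths \<alpha> (Suc n))"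
  proof (rule has_sum_cong_neutral)
    show "path_weight (Suc n) ?A s = 0" if "s \<in> closed_paths \<alpha> (Suc n) - charged_loops \<alpha> \<beta> n" for s
      using that by (rule path_weight_uncharged)
  qed (auto simp: charged_loops_def)
  ultimately have total: "(path_weight (Suc n) ?A has_sum C * V) (closed_paths \<alpha> (Suc n))" by blast
  have pairs: "(\<Prod>(r, s)\<in>{(r, s). 1 \<le> r \<and> r < s \<and> s \<le> n}. prime_form_power (z r - z s) \<tau> (\<beta> r * \<beta> s)) =
      exp (\<Sum>j = 1..n. \<Sum>i = 1..<j. \<beta> i * \<beta> j * ((z i - z j) / 2)) *
      exp (\<Sum>j = 1..n. \<Sum>i = 1..<j. \<beta> i * \<beta> j * L i j)"
  proof -
    have "(\<Prod>(r, s)\<in>{(r, s). 1 \<le> r \<and> r < s \<and> s \<le> n}. prime_form_power (z r - z s) \<tau> (\<beta> r * \<beta> s)) =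
        (\<Prod>(j, i)\<in>Sigma {1..n} (\<lambda>j. {1..<j}). prime_form_power (z i - z j) \<tau> (\<beta> i * \<beta> j))"
      by (rule prod.reindex_bij_witness[where i="\<lambda>(j, i). (i, j)" and j="\<lambda>(i, j). (j, i)"]) auto
    also have "\<dots> = (\<Prod>j = 1..n. \<Prod>i = 1..<j. prime_form_power (z i - z j) \<tau> (\<beta> i * \<beta> j))"
      by (rule prod.Sigma[symmetric]) auto
    also have "\<dots> = (\<Prod>j = 1..n. \<Prod>i = 1..<j. exp (\<beta> i * \<beta> j * ((z i - z j) / 2)) * exp (\<beta> i * \<beta> j * L i j))"
    proof (intro prod.cong refl)
      fix j i assume "j \<in> {1..n}" "i \<in> {1..<j}"
      then have "1 \<le> i" "i < j" "j \<le> n" by auto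
      note s = strip[OF this]
      have "\<beta> i * \<beta> j * ((z i - z j) / 2 + qlog (nome \<tau>) (exp (- (z i - z j))) +
          qlog (nome \<tau>) (nome \<tau> * exp (z i - z j)) - 2 * qlog (nome \<tau>) (nome \<tau>)) =
          \<beta> i * \<beta> j * ((z i - z j) / 2) + \<beta> i * \<beta> j * L i j"
        unfolding L_def q_def by (simp only: distrib_left right_diff_distrib add.assoc diff_conv_add_uminus)
      then show "prime_form_power (z i - z j) \<tau> (\<beta> i * \<beta> j) =
          exp (\<beta> i * \<beta> j * ((z i - z j) / 2)) * exp (\<beta> i * \<beta> j * L i j)"
        unfolding prime_form_power_qlog[OF tau s] exp_add[symmetric] by (rule arg_cong)
    qed
    finally show ?thesis by (simp add: prod.distrib exp_sum)
  qed
  \<comment> \<open>The shift by 1/24 gives the prefactor of \<eta>, and the oscillator partition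
    function 1 / exp (qlog q q) gives its product.\<close>
  have "exp (2 * pi * \<i> * \<tau> * (\<alpha>\<^sup>2 / 2 - 1 / 24)) =
      exp (2 * pi * \<i> * \<tau> * (\<alpha>\<^sup>2 / 2)) / exp (2 * pi * \<i> * \<tau> / 24)"
    by (simp only: exp_diff[symmetric] right_diff_distrib times_divide_eq_right mult_1_right)
  moreover have "E * F * (X / Y) * (1 / P * G) = X / (Y * P) * E * (F * G)" for E F X Y P G :: complex
    by simp
  ultimately have "C * V =
      exp (2 * pi * \<i> * \<tau> * (\<alpha>\<^sup>2 / 2)) / dedekind_eta \<tau> * exp (\<alpha> * (\<Sum>i = 1..n. \<beta> i * z i)) *
      (\<Prod>(r, s)\<in>{(r, s). 1 \<le> r \<and> r < s \<and> s \<le> n}. prime_form_power (z r - z s) \<tau> (\<beta> r * \<beta> s))"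
    unfolding C_def V_def charge_exponent[OF neutral] pairs dedekind_eta_qlog[OF tau] q_def[symmetric]
    by (simp only:)
  with total show ?thesis
    unfolding torus_converges_def torus_function_def trace_converges_def module_trace_def
    by (intro conjI has_sum_imp_summable[OF total] infsumI) (simp only:)
qed

end
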